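(* Let $(\gamma,\beta)\in\mathbb R^2\setminus\{(0,0)\}$ and let $\varphi:(0,1]\to\mathbb R$ be $\varphi(t)=t^\gamma\sin(t^{-\beta})$. Let $H(t)=\xi_{\varphi(t)}\xi_{\varphi(t)}^T$, let $W_H(1;z)$ be its monodromy matrix, and let $\kappa_H$ be the function produced by the algorithm with some fixed constant $c>0$. Then, as $r\to\infty$, \[ \log\Bigl(\max_{|z|=r}\|W_H(1;z)\|\Bigr)\asymp\log|w_{H,22}(1;ir)|\asymp\kappa_H(r)\asymp\begin{cases}r^{1/2},&\beta<\gamma+1,\\ r^{1/2}\log r,&\beta=\gamma+1,\\ r^{\hat\rho},&\beta>\gamma+1,\end{cases} \] where $\hat\rho=\frac{\beta}{\beta+\gamma+1}$ if $\gamma\ge0$ and $\hat\rho=\frac{\beta-\gamma}{\beta-\gamma+1}$ if $\gamma<0$.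
   Context: Notation: $\xi_\phi=(\cos\phi,\sin\phi)^T$. With $J=\begin{pmatrix}0&-1\\1&0\end{pmatrix}$, the fundamental solution $W_H(t;z)=(w_{H,ij}(t;z))$ solves $\partial_tW_H(t;z)J=zW_H(t;z)H(t)$ with $W_H(0;z)=I$ on $[0,1]$. $W_H(1;\cdot)$ is the monodromy matrix. Put $\Omega(s,t)=\int_s^tH$. Algorithm for $\kappa_H$ (constant $c$, interval $[0,1]$): for $r>0$ set $\sigma_0=0$. Recursively: - if $\det\Omega(\sigma_{j-1},1)>c/r^2$, let $\sigma_j$ be the unique point in $(\sigma_{j-1},1)$ with $\det\Omega(\sigma_{j-1},\sigma_j)=c/r^2$; - otherwise $\sigma_j=1$, $\kappa_H(r)=j$, and stop. Asymptotic notation: $f\asymp g$ as $r\to\infty$ means $C_1g(r)\le f(r)\le C_2g(r)$ for large $r$, with constants $C_1,C_2>0$. *)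

theory Defs
  imports "HOL-Analysis.Analysis"
begin

definition xi :: "real \<Rightarrow> real^2" where
  "xi p = vector [cos p, sin p]"

definition ham_of :: "(real \<Rightarrow> real) \<Rightarrow> real \<Rightarrow> real^2^2" where
  "ham_of phi t = (\<chi> i j. xi (phi t) $ i * xi (phi t) $ j)"

definition Jmat :: "complex^2^2" where
  "Jmat = (\<chi> i j. if i = 1 \<and> j = 2 then -1 else if i = 2 \<and> j = 1 then 1 else 0)"

definition cmat :: "real^2^2 \<Rightarrow> complex^2^2" where
  "cmat A = (\<chi> i j. complex_of_real (A $ i $ j))"

text \<open>W solves d/dt W(t) J = z W(t) H(t), W(0) = I on [0,1], in integrated form:
  W(t) = I - z int_0^t W(s) H(s) J ds  (since J^{-1} = -J).\<close>
definition fund_sol :: "(real \<Rightarrow> real^2^2) \<Rightarrow> complex \<Rightarrow> (real \<Rightarrow> complex^2^2) \<Rightarrow> bool" where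
  "fund_sol H z W \<longleftrightarrow> continuous_on {0..1} W \<and>
     (\<forall>t\<in>{0..1}. ((\<lambda>s. mat z ** (W s ** cmat (H s) ** Jmat)) has_integral (mat 1 - W t)) {0..t})"

definition monodromy :: "(real \<Rightarrow> real^2^2) \<Rightarrow> complex \<Rightarrow> complex^2^2" where
  "monodromy H z = (THE M. \<exists>W. fund_sol H z W \<and> W 1 = M)"

definition Omega :: "(real \<Rightarrow> real^2^2) \<Rightarrow> real \<Rightarrow> real \<Rightarrow> real^2^2" where
  "Omega H s t = integral {s..t} H"

definition kstep :: "(real \<Rightarrow> real^2^2) \<Rightarrow> real \<Rightarrow> real \<Rightarrow> real \<Rightarrow> real" where
  "kstep H c r s = (if det (Omega H s 1) > c / r^2
      then (THE t. s < t \<and> t < 1 \<and> det (Omega H s t) = c / r^2) else 1)"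

definition ksigma :: "(real \<Rightarrow> real^2^2) \<Rightarrow> real \<Rightarrow> real \<Rightarrow> nat \<Rightarrow> real" where
  "ksigma H c r j = (kstep H c r ^^ j) 0"

definition kappa :: "(real \<Rightarrow> real^2^2) \<Rightarrow> real \<Rightarrow> real \<Rightarrow> nat" where
  "kappa H c r = (LEAST j. j \<ge> 1 \<and> \<not> (det (Omega H (ksigma H c r (j - 1)) 1) > c / r^2))"

definition asymp_eq :: "(real \<Rightarrow> real) \<Rightarrow> (real \<Rightarrow> real) \<Rightarrow> bool" (infix "\<asymp>" 50) where
  "f \<asymp> g \<longleftrightarrow> (\<exists>C1>0. \<exists>C2>0. eventually (\<lambda>r. C1 * g r \<le> f r \<and> f r \<le> C2 * g r) at_top)"

end

theory Submission
  imports Defs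
begin

text \<open>A row \<open>w\<close> of the fundamental solution satisfies \<open>w' = z (w \<cdot> \<xi>) \<eta>\<close>, where \<open>\<eta>\<close> is \<open>\<xi>\<close>
  turned by a right angle.

  Lower bound. For \<open>z = \<i> r\<close> the energy \<open>E = Im (w2 * cnj w1)\<close> of the bottom row has derivative
  \<open>r * |w \<cdot> \<xi>|\<^sup>2\<close>, and \<open>|w2|\<^sup>2\<close> has derivative \<open>2 * r * cos\<^sup>2 \<phi> * E\<close>. On an interval with
  \<open>det \<Omega> = c / r\<^sup>2\<close> the row may be frozen at the left end point, because the Volterra kernel that describes the
  error has Hilbert--Schmidt norm \<open>sqrt (det \<Omega>)\<close>; positivity of \<open>\<Omega>\<close> then shows that \<open>E\<close> grows by a
  factor depending only on \<open>c\<close>. Hence \<open>log |w22 (\<i> r)|\<close> is at least a multiple of \<open>\<kappa> r\<close>, up to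
  \<open>O (log r)\<close>, for every angle function \<open>\<phi>\<close>.

  Upper bound. Near \<open>0\<close> the row is estimated by Gronwall's inequality in a constant weighted norm adapted to the
  amplitude of \<open>\<phi>\<close>. On the rest of the interval one uses the frame rotating with \<open>\<phi>\<close> and weights that balance
  \<open>r\<close> against \<open>|\<phi>'|\<close>, which gives the exponent \<open>\<integral> sqrt (r * |\<phi>'|)\<close>.

  Finally \<open>\<kappa> r\<close> is bounded below by packing intervals of length about \<open>1 / sqrt (r * |\<phi>'|)\<close> into the stretches
  where \<open>\<phi>\<close> is steep and monotone. The two bounds then agree, and the upper bound for \<open>\<kappa>\<close> is a consequence of
  the other two.\<close>

section \<open>The fundamental solution\<close>

text \<open>Put 2e = \<beta> - \<gamma> + 1. Then |phi'| is at most of order t^(-2e) for every sign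
  of \<beta>, and sqrt (r |phi'|) becomes sqrt r * t^(-e). The three cases of the theorem are e < 1,
  e = 1 and e > 1, in which the integral of t^(-e) converges at 0, diverges logarithmically, or
  diverges like a power. The rotating frame is used down to t0 = r^(-1/\<nu>); below t0 the exponent
  is r * t0^(1 + max \<gamma> 0). For e > 1 the value \<nu> = 2e + 2 max \<gamma> 0 makes both
  contributions equal. The same \<nu> decides how close to 0 the packing can be carried: closer to 0
  the angle is too steep or the stretches are too short. This coincidence is why the two bounds
  meet. The obstacle throughout is the point 0, where phi has in general no limit and solutions need
  not be differentiable. Hence quantities are compared through derivatives in the open interval and
  continuity on the closed one, instead of through integrals.\<close>

lemma bounded_continuous_integrable:
  fixes f :: "real \<Rightarrow> 'a::euclidean_space"
  assumes "continuous_on {0<..1} f" and "\<And>t. t \<in> {0<..1} \<Longrightarrow> norm (f t) \<le> B" and "0 \<le> a" "b \<le> 1"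
  shows "f integrable_on {a..b}"
proof -
  have "f integrable_on {0<..<1}"
  proof (rule measurable_bounded_by_integrable_imp_integrable)
    show "f \<in> borel_measurable (lebesgue_on {0<..<1})"
      by (rule continuous_imp_measurable_on_sets_lebesgue[OF continuous_on_subset[OF assms(1)]]) auto
    show "(\<lambda>_. B) integrable_on {0<..<1::real}"
      unfolding integrable_on_open_interval_real by (rule integrable_const_ivl)
  qed (use assms in auto)
  then have "f integrable_on {0..1}"
    unfolding integrable_on_open_interval_real .
  then show ?thesis
    by (rule integrable_on_subinterval) (use assms in auto)
qed

lemma integral_has_derivative_interior:
  fixes f :: "real \<Rightarrow> 'a::euclidean_space"
  assumes "continuous_on {0<..1} f" and "\<And>t. t \<in> {0<..1} \<Longrightarrow> norm (f t) \<le> B"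
    and "0 \<le> a" "a < t" "t < 1"
  shows "((\<lambda>u. integral {a..u} f) has_vector_derivative f t) (at t)"
proof -
  have i: "f integrable_on {a..1}"
    using bounded_continuous_integrable[OF assms(1,2)] assms(3) by simp
  have "continuous_on {0<..<1} f"
    by (rule continuous_on_subset[OF assms(1)]) auto
  then have "isCont f t"
    using assms by (subst (asm) continuous_on_eq_continuous_at) auto
  then have "((\<lambda>u. integral {a..u} f) has_vector_derivative f t) (at t within {a..1})"
    using assms by (intro integral_has_vector_derivative_continuous_at[where S="{}", simplified] i) (auto intro: continuous_at_imp_continuous_at_within)
  moreover have "at t within {a..1} = at t"
    using assms by (intro at_within_interior) auto
  ultimately show ?thesis by simp
qed

lemma integral_continuous_closed:
  fixes f :: "real \<Rightarrow> 'a::euclidean_space"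
  assumes "continuous_on {0<..1} f" and "\<And>t. t \<in> {0<..1} \<Longrightarrow> norm (f t) \<le> B" and "0 \<le> a"
  shows "continuous_on {a..1} (\<lambda>u. integral {a..u} f)"
  using bounded_continuous_integrable[OF assms(1,2)] assms(3) by (intro indefinite_integral_continuous_1) auto

text \<open>The Picard operator is a contraction for the sup norm weighted by \<open>exp (- 2 * K * t)\<close>,
  so the interval need not be subdivided.\<close>
lemma linear_volterra_exists:
  fixes A :: "real \<Rightarrow> 'a::euclidean_space \<Rightarrow> 'a"
  assumes lin: "\<And>t. linear (A t)"
    and cont: "\<And>y. continuous_on {0..1} y \<Longrightarrow> continuous_on {0<..1} (\<lambda>t. A t (y t))"
    and bnd: "\<And>t x. norm (A t x) \<le> K * norm x" and "K > 0"
  obtains X where "continuous_on {0..1} X"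
    and "\<And>t. t \<in> {0..1} \<Longrightarrow> ((\<lambda>s. A s (X s)) has_integral (X t - x0)) {0..t}"
proof -
  have int: "(\<lambda>s. A s (y s)) integrable_on {a..b}"
    and ic: "continuous_on {0..1} (\<lambda>u. integral {0..u} (\<lambda>s. A s (y s)))"
    if y: "continuous_on {0..1} y" and "0 \<le> a" "b \<le> 1" for y a b
  proof -
    have "bounded (y ` {0..1})"
      by (intro compact_imp_bounded compact_continuous_image y) auto
    then obtain M where M: "\<And>t. t \<in> {0..1} \<Longrightarrow> norm (y t) \<le> M" unfolding bounded_iff by blast
    have *: "norm (A t (y t)) \<le> K * M" if "t \<in> {0<..1}" for t
      by (rule order_trans[OF bnd]) (use M[of t] that \<open>K > 0\<close> in \<open>auto intro!: mult_left_mono\<close>)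
    show "(\<lambda>s. A s (y s)) integrable_on {a..b}"
      by (rule bounded_continuous_integrable[OF cont[OF y] *]) (use that in auto)
    show "continuous_on {0..1} (\<lambda>u. integral {0..u} (\<lambda>s. A s (y s)))"
      by (rule integral_continuous_closed[OF cont[OF y] *]) auto
  qed
  \<comment> \<open>\<open>bcontfun\<close> consists of functions on the whole line, so functions on
    {0..1} are extended by constants through the clamp \<open>cl\<close>.\<close>
  define cl where "cl t = max 0 (min 1 t)" for t :: real
  have cl: "cl t \<in> {0..1}" "t \<in> {0..1} \<Longrightarrow> cl t = t" for t by (auto simp: cl_def)
  have clc: "continuous_on UNIV cl" unfolding cl_def by (intro continuous_intros)
  \<comment> \<open>The unknown is Y t = exp (- 2 * K * t) X t, which turns the weighted norm for X
    into the plain sup metric of \<open>bcontfun\<close>.\<close>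
  define F where "F Y t = exp (- 2 * K * t) *\<^sub>R (x0 + integral {0..t} (\<lambda>s. A s (exp (2 * K * s) *\<^sub>R apply_bcontfun Y s)))"
    for Y :: "real \<Rightarrow>\<^sub>C 'a" and t
  have yc: "continuous_on {0..1} (\<lambda>s. exp (2 * K * s) *\<^sub>R apply_bcontfun Y s)" for Y :: "real \<Rightarrow>\<^sub>C 'a"
    by (intro continuous_intros) auto
  have Fc: "continuous_on {0..1} (F Y)" for Y
    unfolding F_def by (intro continuous_intros ic yc) auto
  have Fb: "(\<lambda>t. F Y (cl t)) \<in> bcontfun" for Y
  proof -
    have "continuous_on UNIV (\<lambda>t. F Y (cl t))"
      by (rule continuous_on_compose2[OF Fc clc]) (use cl in auto)
    moreover have "bounded (F Y ` {0..1})"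
      by (intro compact_imp_bounded compact_continuous_image Fc) auto
    then obtain M where "\<And>t. t \<in> {0..1} \<Longrightarrow> norm (F Y t) \<le> M" unfolding bounded_iff by blast
    ultimately show ?thesis using cl by (intro bcontfun_normI[of _ M]) auto
  qed
  define T where "T Y = Bcontfun (\<lambda>t. F Y (cl t))" for Y
  have T: "apply_bcontfun (T Y) t = F Y (cl t)" for Y t
    unfolding T_def using Fb by (simp add: Bcontfun_inverse)
  have "\<exists>!Y. T Y = Y"
  proof (rule banach_fix_type[of "1/2"])
    show "\<forall>Y Z. dist (T Y) (T Z) \<le> 1/2 * dist Y Z"
    proof (intro allI dist_bound)
      fix Y Z :: "real \<Rightarrow>\<^sub>C 'a" and u
      define t where "t = cl u"
      have t: "t \<in> {0..1}" using cl t_def by auto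
      let ?d = "dist Y Z"
      have "dist (F Y t) (F Z t) = exp (- 2 * K * t) * norm (integral {0..t} (\<lambda>s. A s (exp (2 * K * s) *\<^sub>R apply_bcontfun Y s) - A s (exp (2 * K * s) *\<^sub>R apply_bcontfun Z s)))"
        using t unfolding F_def dist_norm
        by (subst integral_diff) (auto intro!: int yc simp flip: scaleR_diff_right)
      also have "norm (integral {0..t} (\<lambda>s. A s (exp (2 * K * s) *\<^sub>R apply_bcontfun Y s) - A s (exp (2 * K * s) *\<^sub>R apply_bcontfun Z s)))
          \<le> ?d/2 * exp (2 * K * t) - ?d/2 * exp (2 * K * 0)"
      proof (rule integral_norm_bound_integral[THEN order_trans])
        have hi: "((\<lambda>s. ?d * K * exp (2 * K * s)) has_integral ?d/2 * exp (2 * K * t) - ?d/2 * exp (2 * K * 0)) {0..t}"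
          using t by (intro fundamental_theorem_of_calculus)
            (auto intro!: derivative_eq_intros simp flip: has_real_derivative_iff_has_vector_derivative)
        show "(\<lambda>s. ?d * K * exp (2 * K * s)) integrable_on {0..t}" using hi by (rule has_integral_integrable)
        show "integral {0..t} (\<lambda>s. ?d * K * exp (2 * K * s)) \<le> ?d/2 * exp (2 * K * t) - ?d/2 * exp (2 * K * 0)"
          by (simp only: integral_unique[OF hi])
        show "(\<lambda>s. A s (exp (2 * K * s) *\<^sub>R apply_bcontfun Y s) - A s (exp (2 * K * s) *\<^sub>R apply_bcontfun Z s)) integrable_on {0..t}"
          using t by (intro integrable_diff int yc) auto
        fix s assume "s \<in> {0..t}"
        have "norm (A s (exp (2 * K * s) *\<^sub>R apply_bcontfun Y s) - A s (exp (2 * K * s) *\<^sub>R apply_bcontfun Z s))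
          = norm (A s (exp (2 * K * s) *\<^sub>R (apply_bcontfun Y s - apply_bcontfun Z s)))"
          by (simp add: linear_diff[OF lin] scaleR_diff_right)
        also have "\<dots> \<le> K * (exp (2 * K * s) * ?d)"
          by (rule order_trans[OF bnd]) (use \<open>K > 0\<close> dist_bounded[of Y s Z] in \<open>auto simp: dist_norm\<close>)
        finally show "norm (A s (exp (2 * K * s) *\<^sub>R apply_bcontfun Y s) - A s (exp (2 * K * s) *\<^sub>R apply_bcontfun Z s)) \<le> ?d * K * exp (2 * K * s)"
          by (simp add: mult_ac)
      qed
      also have "exp (- 2 * K * t) * (?d/2 * exp (2 * K * t) - ?d/2 * exp (2 * K * 0)) = ?d / 2 * (1 - exp (- 2 * K * t))"
        by (simp add: algebra_simps flip: exp_add)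
      also have "\<dots> \<le> ?d/2 * 1" by (intro mult_left_mono) auto
      finally show "dist (apply_bcontfun (T Y) u) (apply_bcontfun (T Z) u) \<le> 1/2 * ?d"
        by (simp add: T t_def)
    qed
  qed auto
  then obtain Y where Y: "T Y = Y" by auto
  define X where "X t = exp (2 * K * t) *\<^sub>R apply_bcontfun Y t" for t
  have Xc: "continuous_on {0..1} X" unfolding X_def by (rule yc)
  have "X t = x0 + integral {0..t} (\<lambda>s. A s (X s))" if "t \<in> {0..1}" for t
  proof -
    have "apply_bcontfun Y t = F Y t" using T[of Y t] cl(2)[OF that] Y by simp
    then show ?thesis by (simp add: X_def F_def flip: exp_add)
  qed
  then have "((\<lambda>s. A s (X s)) has_integral (X t - x0)) {0..t}" if "t \<in> {0..1}" for t
    using integrable_integral[OF int[OF Xc, of 0 t]] that by simp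
  with Xc show ?thesis by (rule that)
qed

text \<open>W is multiplied by H from the right, so its rows decouple and each solves this system.
  Derivatives are demanded in the open interval only, because H need not extend continuously to 0;
  continuity on {0..1} carries the initial values.\<close>

definition row_solution :: "(real \<Rightarrow> real) \<Rightarrow> complex \<Rightarrow> (real \<Rightarrow> complex) \<Rightarrow> (real \<Rightarrow> complex) \<Rightarrow> bool" where
  "row_solution phi z w1 w2 \<longleftrightarrow> continuous_on {0..1} w1 \<and> continuous_on {0..1} w2 \<and>
    (\<forall>t\<in>{0<..<1}.
      (w1 has_vector_derivative - z * (w1 t * cos (phi t) + w2 t * sin (phi t)) * sin (phi t)) (at t) \<and>
      (w2 has_vector_derivative z * (w1 t * cos (phi t) + w2 t * sin (phi t)) * cos (phi t)) (at t))"

lemma ode_matrix_entries: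
  fixes W :: "complex^2^2"
  shows "(mat z ** (W ** cmat (ham_of phi s) ** Jmat)) $ i $ 1 = z * (W$i$1 * cos (phi s) + W$i$2 * sin (phi s)) * sin (phi s)"
    "(mat z ** (W ** cmat (ham_of phi s) ** Jmat)) $ i $ 2 = - z * (W$i$1 * cos (phi s) + W$i$2 * sin (phi s)) * cos (phi s)"
  using exhaust_2[of i]
  by (auto simp: matrix_matrix_mult_def mat_def cmat_def ham_of_def Jmat_def xi_def sum_2 algebra_simps
      power2_eq_square)

lemma norm_matrix_le_sum_entries:
  fixes M :: "'a::real_normed_vector^2^2"
  shows "norm M \<le> (\<Sum>i\<in>UNIV. \<Sum>j\<in>UNIV. norm (M$i$j))"
proof -
  have "norm M \<le> (\<Sum>i\<in>UNIV. norm (M$i))"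
    unfolding norm_vec_def[of M] by (rule L2_set_le_sum) auto
  also have "\<dots> \<le> (\<Sum>i\<in>UNIV. \<Sum>j\<in>UNIV. norm (M$i$j))"
    by (intro sum_mono) (metis L2_set_le_sum norm_ge_zero norm_vec_def)
  finally show ?thesis .
qed

lemma norm_matrix_entry_le:
  fixes M :: "complex^2^2"
  shows "norm (M$i$j) \<le> norm M"
  using Finite_Cartesian_Product.norm_nth_le[of "M$i" j] Finite_Cartesian_Product.norm_nth_le[of M i] by linarith

locale angle =
  fixes phi :: "real \<Rightarrow> real"
  assumes phi_cont: "continuous_on {0<..1} phi"
begin

lemma fund_sol_initial:
  assumes "fund_sol (ham_of phi) z W" shows "W 0 = mat 1"
proof -
  have "((\<lambda>s. mat z ** (W s ** cmat (ham_of phi s) ** Jmat)) has_integral (mat 1 - W 0)) {0..0}"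
    using assms unfolding fund_sol_def by (meson atLeastAtMost_iff order_refl zero_le_one)
  moreover have "((\<lambda>s. mat z ** (W s ** cmat (ham_of phi s) ** Jmat)) has_integral 0) {0..0}"
    unfolding box_real(2)[symmetric] by (rule has_integral_refl(1))
  ultimately have "mat 1 - W 0 = 0" by (rule has_integral_unique)
  then show ?thesis by simp
qed

lemma fund_sol_row:
  assumes W: "fund_sol (ham_of phi) z W"
  shows "row_solution phi z (\<lambda>t. W t $ i $ 1) (\<lambda>t. W t $ i $ 2)"
proof -
  have Wc: "continuous_on {0..1} W" using W by (simp add: fund_sol_def)
  have c: "continuous_on {0..1} (\<lambda>t. W t $ i $ j)" for j
    by (intro continuous_intros Wc)
  let ?f = "\<lambda>s. mat z ** (W s ** cmat (ham_of phi s) ** Jmat)"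
  have d: "((\<lambda>t. W t $ i $ j) has_vector_derivative - (?f t $ i $ j)) (at t)"
    if t: "t \<in> {0<..<1}" for t j
  proof -
    have hi: "((\<lambda>s. ?f s $ i $ j) has_integral ((mat 1 - W t) $ i $ j)) {0..t}" if "t \<in> {0..1}" for t
      using has_integral_linear[of ?f "mat 1 - W t" "{0..t}" "\<lambda>M. M $ i $ j"] W that
        bounded_linear_compose[OF bounded_linear_vec_nth[of j] bounded_linear_vec_nth[of i]]
      by (simp add: fund_sol_def o_def)
    have eq: "W t $ i $ j = mat 1 $ i $ j - integral {0..t} (\<lambda>s. ?f s $ i $ j)" if "t \<in> {0..1}" for t
      using integral_unique[OF hi[OF that]] by simp
    have W1: "continuous_on {0<..1} (\<lambda>t. W t $ i $ j)" for j
      by (rule continuous_on_subset[OF c]) auto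
    have fc: "continuous_on {0<..1} (\<lambda>s. ?f s $ i $ j)"
      using exhaust_2[of j]
      by (elim disjE; simp only: ode_matrix_entries) (auto intro!: continuous_intros W1 phi_cont)
    have "compact ((\<lambda>t. W t $ i $ j) ` {0..1})" for j
      by (intro compact_continuous_image c) auto
    then have "bounded ((\<lambda>t. W t $ i $ j) ` {0..1})" for j using compact_imp_bounded by blast
    then have "\<exists>M. \<forall>t\<in>{0..1}. norm (W t $ i $ j) \<le> M" for j unfolding bounded_iff by blast
    then obtain M where M: "\<And>t j. t \<in> {0..1} \<Longrightarrow> norm (W t $ i $ j) \<le> M j" by metis
    have fb: "norm (?f t $ i $ j) \<le> norm z * (M 1 + M 2)" if t: "t \<in> {0<..1}" for t
    proof -
      define p where "p = W t $ i $ 1 * cos (phi t) + W t $ i $ 2 * sin (phi t)"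
      have "norm p \<le> norm (W t $ i $ 1) * \<bar>cos (phi t)\<bar> + norm (W t $ i $ 2) * \<bar>sin (phi t)\<bar>"
        unfolding p_def by (rule order_trans[OF norm_triangle_ineq]) (simp add: norm_mult)
      also have "\<dots> \<le> norm (W t $ i $ 1) * 1 + norm (W t $ i $ 2) * 1"
        by (intro add_mono mult_left_mono) auto
      also have "\<dots> \<le> M 1 + M 2" using M[of t 1] M[of t 2] t by auto
      finally have p: "norm p \<le> M 1 + M 2" .
      have "norm (?f t $ i $ j) \<le> norm z * norm p * 1"
        using exhaust_2[of j]
        by (auto simp: ode_matrix_entries norm_mult p_def[symmetric] intro!: mult_left_le)
      also have "\<dots> \<le> norm z * (M 1 + M 2)" using p by (simp add: mult_left_mono)
      finally show ?thesis .
    qed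
    have "((\<lambda>t. mat 1 $ i $ j - integral {0..t} (\<lambda>s. ?f s $ i $ j)) has_vector_derivative 0 - ?f t $ i $ j) (at t)"
      by (intro has_vector_derivative_diff has_vector_derivative_const
          integral_has_derivative_interior[OF fc fb]) (use t in auto)
    then have "((\<lambda>t. W t $ i $ j) has_vector_derivative 0 - ?f t $ i $ j) (at t)"
      by (rule has_vector_derivative_transform_within_open[of _ _ _ "{0<..<1}"]) (use t eq in auto)
    then show ?thesis by simp
  qed
  show ?thesis
    unfolding row_solution_def using c d[of _ 1] d[of _ 2] by (auto simp: ode_matrix_entries)
qed

lemma fund_sol_exists: "\<exists>W. fund_sol (ham_of phi) z W"
proof -
  define A where "A s X = - (mat z ** (X ** cmat (ham_of phi s) ** Jmat))"
    for s and X :: "complex^2^2"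
  have A1: "A s X $ i $ 1 = - (z * (X$i$1 * cos (phi s) + X$i$2 * sin (phi s)) * sin (phi s))"
    and A2: "A s X $ i $ 2 = z * (X$i$1 * cos (phi s) + X$i$2 * sin (phi s)) * cos (phi s)" for s X i
    by (simp_all add: A_def ode_matrix_entries)
  have lin: "linear (A s)" for s
    by (intro linearI) (auto simp: vec_eq_iff forall_2 A1 A2 algebra_simps scaleR_conv_of_real[where 'a=complex])
  \<comment> \<open>Four entries, each at most 2 |z| |X|; the added 1 keeps the constant positive
    for z = 0.\<close>
  have bnd: "norm (A s X) \<le> (8 * norm z + 1) * norm X" for s X
  proof -
    have e: "norm (A s X $ i $ j) \<le> 2 * norm z * norm X" for i j
    proof -
      define p where "p = X$i$1 * cos (phi s) + X$i$2 * sin (phi s)"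
      have "norm p \<le> norm (X$i$1) * \<bar>cos (phi s)\<bar> + norm (X$i$2) * \<bar>sin (phi s)\<bar>"
        unfolding p_def by (rule order_trans[OF norm_triangle_ineq]) (simp add: norm_mult)
      also have "\<dots> \<le> norm X * 1 + norm X * 1"
        by (intro add_mono mult_mono norm_matrix_entry_le) auto
      finally have p: "norm p \<le> 2 * norm X" by simp
      have "norm (A s X $ i $ j) \<le> norm z * norm p * 1"
        using exhaust_2[of j]
        by (auto simp: A1 A2 norm_mult p_def[symmetric] intro!: mult_left_le)
      also have "\<dots> \<le> norm z * (2 * norm X)" using p by (simp add: mult_left_mono)
      finally show ?thesis by simp
    qed
    have "norm (A s X) \<le> (\<Sum>i\<in>UNIV. \<Sum>j\<in>UNIV. norm (A s X$i$j))" by (rule norm_matrix_le_sum_entries)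
    also have "\<dots> \<le> (\<Sum>i\<in>(UNIV::2 set). \<Sum>j\<in>(UNIV::2 set). 2 * norm z * norm X)"
      by (intro sum_mono e)
    also have "\<dots> \<le> (8 * norm z + 1) * norm X" by (simp add: algebra_simps)
    finally show ?thesis .
  qed
  have cont: "continuous_on {0<..1} (\<lambda>t. A t (y t))" if y: "continuous_on {0..1} y" for y
  proof -
    have y': "continuous_on {0<..1} y" by (rule continuous_on_subset[OF y]) auto
    have "continuous_on {0<..1} (\<lambda>t. A t (y t) $ i $ j)" for i j
      using exhaust_2[of j]
      by (elim disjE; simp only: A1 A2) (auto intro!: continuous_intros y' phi_cont)
    then have "continuous_on {0<..1} (\<lambda>t. \<chi> i. \<chi> j. A t (y t) $ i $ j)"
      by (intro continuous_on_vec_lambda)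
    then show ?thesis by simp
  qed
  obtain W where W: "continuous_on {0..1} W"
    "\<And>t. t \<in> {0..1} \<Longrightarrow> ((\<lambda>s. A s (W s)) has_integral (W t - mat 1)) {0..t}"
    using linear_volterra_exists[OF lin cont bnd] by (metis add_nonneg_pos mult_nonneg_nonneg norm_ge_zero zero_le_numeral zero_less_one)
  have "((\<lambda>s. mat z ** (W s ** cmat (ham_of phi s) ** Jmat)) has_integral (mat 1 - W t)) {0..t}" if "t \<in> {0..1}" for t
    using has_integral_neg[OF W(2)[OF that]] by (simp add: A_def)
  with W(1) show ?thesis unfolding fund_sol_def by blast
qed

end

section \<open>Growth of rows near 0, uniqueness, and the rows of the monodromy matrix\<close>

lemma gronwall:
  fixes N G k N' :: "real \<Rightarrow> real"
  assumes "a \<le> b" "continuous_on {a..b} N" "continuous_on {a..b} G"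
    and "\<And>t. a < t \<Longrightarrow> t < b \<Longrightarrow> (N has_real_derivative N' t) (at t)"
    and "\<And>t. a < t \<Longrightarrow> t < b \<Longrightarrow> (G has_real_derivative k t) (at t)"
    and "\<And>t. a < t \<Longrightarrow> t < b \<Longrightarrow> N' t \<le> k t * N t"
  shows "N b \<le> N a * exp (G b - G a)"
proof -
  have "N b * exp (- G b) \<le> N a * exp (- G a)"
  proof (rule DERIV_nonpos_imp_decreasing_open[of a b "\<lambda>t. N t * exp (- G t)"])
    fix t assume t: "a < t" "t < b"
    have "((\<lambda>t. N t * exp (- G t)) has_real_derivative (N' t - k t * N t) * exp (- G t)) (at t)"
      using assms(4,5)[OF t] by (auto intro!: derivative_eq_intros simp: algebra_simps)
    then show "\<exists>y. ((\<lambda>t. N t * exp (- G t)) has_real_derivative y) (at t) \<and> y \<le> 0"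
      using assms(6)[OF t] by (auto intro!: exI mult_nonpos_nonneg)
  qed (use assms in \<open>auto intro!: continuous_intros\<close>)
  then have "N b * exp (- G b) * exp (G b) \<le> N a * exp (- G a) * exp (G b)"
    by (rule mult_right_mono) simp
  then show ?thesis by (simp add: mult.assoc flip: exp_add)
qed

lemma has_real_derivative_norm_square:
  fixes w :: "real \<Rightarrow> complex"
  assumes "(w has_vector_derivative d) (at t)"
  shows "((\<lambda>t. (cmod (w t))\<^sup>2) has_real_derivative 2 * (w t \<bullet> d)) (at t)"
proof -
  have "((\<lambda>t. w t \<bullet> w t) has_vector_derivative w t \<bullet> d + d \<bullet> w t) (at t)"
    by (rule bounded_bilinear.has_vector_derivative[OF bounded_bilinear_inner assms assms])
  then show ?thesis
    by (simp add: has_real_derivative_iff_has_vector_derivative power2_norm_eq_inner inner_commute)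
qed

text \<open>In the variables w1 / sqrt \<theta> and sqrt \<theta> * w2 every coefficient of the
  system is at most r * \<theta>: the equation for w1 carries a factor sin phi, and w2 enters both
  equations with another one. A small amplitude of phi thus replaces the rate r by r *
  \<theta>.\<close>

lemma row_solution_bound_near_0:
  assumes "row_solution phi z w1 w2" and "0 < \<theta>" "\<theta> \<le> 1" "0 \<le> b" "b \<le> 1"
    and small: "\<And>t. t \<in> {0<..<b} \<Longrightarrow> \<bar>sin (phi t)\<bar> \<le> \<theta>" and r: "norm z \<le> r"
  shows "(cmod (w1 b))\<^sup>2 / \<theta> + \<theta> * (cmod (w2 b))\<^sup>2
    \<le> ((cmod (w1 0))\<^sup>2 / \<theta> + \<theta> * (cmod (w2 0))\<^sup>2) * exp (4 * r * \<theta> * b)"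
proof -
  define p where "p t = w1 t * cos (phi t) + w2 t * sin (phi t)" for t
  have d: "(w1 has_vector_derivative - z * p t * sin (phi t)) (at t)"
     "(w2 has_vector_derivative z * p t * cos (phi t)) (at t)" if "0 < t" "t < b" for t
    using assms that by (auto simp: row_solution_def p_def)
  have c: "continuous_on {0..b} w1" "continuous_on {0..b} w2"
    using assms by (auto simp: row_solution_def intro: continuous_on_subset)
  define N' where "N' t = 2 * (w1 t \<bullet> (- z * p t * sin (phi t))) / \<theta> + \<theta> * (2 * (w2 t \<bullet> (z * p t * cos (phi t))))" for t
  have "(cmod (w1 b))\<^sup>2 / \<theta> + \<theta> * (cmod (w2 b))\<^sup>2
    \<le> ((cmod (w1 0))\<^sup>2 / \<theta> + \<theta> * (cmod (w2 0))\<^sup>2) * exp (4 * r * \<theta> * b - 4 * r * \<theta> * 0)"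
  proof (rule gronwall[where N = "\<lambda>b. (cmod (w1 b))\<^sup>2 / \<theta> + \<theta> * (cmod (w2 b))\<^sup>2"
        and N' = N' and k = "\<lambda>_. 4 * r * \<theta>"])
    fix t assume t: "0 < t" "t < b"
    show "((\<lambda>b. (cmod (w1 b))\<^sup>2 / \<theta> + \<theta> * (cmod (w2 b))\<^sup>2) has_real_derivative N' t) (at t)"
      unfolding N'_def
      by (intro DERIV_add DERIV_cdivide DERIV_cmult has_real_derivative_norm_square d t)
    show "((*) (4 * r * \<theta>) has_real_derivative 4 * r * \<theta>) (at t)"
      by (auto intro!: derivative_eq_intros)
    define x y where "x = cmod (w1 t)" and "y = cmod (w2 t)"
    have xy: "x \<ge> 0" "y \<ge> 0" by (auto simp: x_def y_def)
    have r0: "r \<ge> 0" using r norm_ge_zero order_trans by blast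
    have sn: "\<bar>sin (phi t)\<bar> \<le> \<theta>" using small[of t] t by simp
    have "cmod (p t) \<le> x * \<bar>cos (phi t)\<bar> + y * \<bar>sin (phi t)\<bar>"
      unfolding p_def x_def y_def by (rule order_trans[OF norm_triangle_ineq]) (simp add: norm_mult)
    also have "\<dots> \<le> x * 1 + y * \<theta>" using sn xy by (intro add_mono mult_left_mono) auto
    finally have p: "cmod (p t) \<le> x + \<theta> * y" by (simp add: mult.commute)
    have n1: "cmod (- z * p t * sin (phi t)) \<le> r * (x + \<theta> * y) * \<theta>"
      unfolding norm_mult using p sn r r0 xy \<open>0 < \<theta>\<close> by (auto intro!: mult_mono)
    have n2: "cmod (z * p t * cos (phi t)) \<le> r * (x + \<theta> * y) * 1"
      unfolding norm_mult using p r r0 xy \<open>0 < \<theta>\<close> by (intro mult_mono) auto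
    have "w1 t \<bullet> (- z * p t * sin (phi t)) \<le> x * (r * (x + \<theta> * y) * \<theta>)"
      by (rule order_trans[OF norm_cauchy_schwarz]) (use n1 xy in \<open>auto simp: x_def intro!: mult_left_mono\<close>)
    then have a1: "2 * (w1 t \<bullet> (- z * p t * sin (phi t))) / \<theta> \<le> 2 * x * (r * (x + \<theta> * y))"
      using \<open>0 < \<theta>\<close> by (simp add: field_simps)
    have "w2 t \<bullet> (z * p t * cos (phi t)) \<le> y * (r * (x + \<theta> * y))"
      by (rule order_trans[OF norm_cauchy_schwarz]) (use n2 xy in \<open>auto simp: y_def intro!: mult_left_mono\<close>)
    then have a2: "\<theta> * (2 * (w2 t \<bullet> (z * p t * cos (phi t)))) \<le> \<theta> * (2 * (y * (r * (x + \<theta> * y))))"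
      using \<open>0 < \<theta>\<close> by (intro mult_left_mono) auto
    have "N' t \<le> 2 * r * (x + \<theta> * y)\<^sup>2"
      unfolding N'_def using add_mono[OF a1 a2] by (simp add: power2_eq_square algebra_simps)
    also have "\<dots> \<le> 2 * r * (2 * (x\<^sup>2 + (\<theta> * y)\<^sup>2))"
      using r0 sum_squares_bound[of x "\<theta> * y"] by (intro mult_left_mono) (auto simp: power2_sum)
    also have "\<dots> = 4 * r * \<theta> * (x\<^sup>2 / \<theta> + \<theta> * y\<^sup>2)"
      using \<open>0 < \<theta>\<close> by (simp add: field_simps power2_eq_square)
    finally show "N' t \<le> 4 * r * \<theta> * ((cmod (w1 t))\<^sup>2 / \<theta> + \<theta> * (cmod (w2 t))\<^sup>2)"
      by (simp add: x_def y_def)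
  qed (use assms in \<open>auto intro!: continuous_intros c\<close>)
  then show ?thesis by simp
qed

context angle
begin

text \<open>The difference of two rows solves the same linear system and starts at 0. The bound near
  0 with \<theta> = 1 and b = 1 applies to every angle and forces the difference to vanish at
  1.\<close>

lemma fund_sol_unique:
  assumes "fund_sol (ham_of phi) z W" "fund_sol (ham_of phi) z V"
  shows "W 1 = V 1"
proof -
  have "W 1 $ i $ 1 = V 1 $ i $ 1 \<and> W 1 $ i $ 2 = V 1 $ i $ 2" for i
  proof -
    let ?w = "\<lambda>j t. W t $ i $ j - V t $ i $ j"
    have rs: "row_solution phi z (?w 1) (?w 2)"
    proof -
      have *: "(?w j has_vector_derivative d - e) (at t)"
        if "((\<lambda>t. W t $ i $ j) has_vector_derivative d) (at t)" "((\<lambda>t. V t $ i $ j) has_vector_derivative e) (at t)" for j d e t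
        by (intro has_vector_derivative_diff that)
      show ?thesis
        unfolding row_solution_def
      proof (intro conjI ballI)
        fix t :: real assume t: "t \<in> {0<..<1}"
        note d = fund_sol_row[OF assms(1), of i, unfolded row_solution_def, THEN conjunct2, THEN conjunct2, rule_format, OF t]
          fund_sol_row[OF assms(2), of i, unfolded row_solution_def, THEN conjunct2, THEN conjunct2, rule_format, OF t]
        show "(?w 1 has_vector_derivative - z * (?w 1 t * cos (phi t) + ?w 2 t * sin (phi t)) * sin (phi t)) (at t)"
          by (rule has_vector_derivative_eq_rhs[OF *[OF d(1)[THEN conjunct1] d(2)[THEN conjunct1]]]) (simp add: algebra_simps)
        show "(?w 2 has_vector_derivative z * (?w 1 t * cos (phi t) + ?w 2 t * sin (phi t)) * cos (phi t)) (at t)"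
          by (rule has_vector_derivative_eq_rhs[OF *[OF d(1)[THEN conjunct2] d(2)[THEN conjunct2]]]) (simp add: algebra_simps)
      qed (use fund_sol_row[OF assms(1), of i] fund_sol_row[OF assms(2), of i] in
          \<open>auto simp: row_solution_def intro!: continuous_on_diff\<close>)
    qed
    have "?w 1 0 = 0" "?w 2 0 = 0" using fund_sol_initial[OF assms(1)] fund_sol_initial[OF assms(2)] by auto
    with row_solution_bound_near_0[OF rs, of 1 1 "norm z"] show ?thesis
      by (simp add: sum_power2_le_zero_iff)
  qed
  then show ?thesis by (simp add: vec_eq_iff forall_2)
qed

lemma monodromy_eq:
  assumes "fund_sol (ham_of phi) z W" shows "monodromy (ham_of phi) z = W 1"
  unfolding monodromy_def using assms fund_sol_unique by (intro the_equality) auto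

text \<open>The only interface to the matrix problem used later: both bounds work with single rows,
  the lower one with i = 2.\<close>

lemma monodromy_row:
  obtains w1 w2 where "row_solution phi z w1 w2" "w1 0 = mat 1 $ i $ 1" "w2 0 = mat 1 $ i $ 2"
    "monodromy (ham_of phi) z $ i $ 1 = w1 1" "monodromy (ham_of phi) z $ i $ 2 = w2 1"
proof -
  obtain W where W: "fund_sol (ham_of phi) z W" using fund_sol_exists by blast
  show ?thesis
    by (rule that[OF fund_sol_row[OF W, of i]]) (simp_all add: fund_sol_initial[OF W] monodromy_eq[OF W])
qed

end

section \<open>The determinant of Omega\<close>

text \<open>Stands in for comparing the integrals of f' and g'. It asks for no integrability and no
  derivative at the end points, so it also works on intervals that start at the singular point
  0.\<close>

lemma mono_on_interior_derivative:
  fixes f g f' g' :: "real \<Rightarrow> real"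
  assumes "a \<le> b" "continuous_on {a..b} f" "continuous_on {a..b} g"
    and "\<And>t. a < t \<Longrightarrow> t < b \<Longrightarrow> (f has_real_derivative f' t) (at t)"
    and "\<And>t. a < t \<Longrightarrow> t < b \<Longrightarrow> (g has_real_derivative g' t) (at t)"
    and "\<And>t. a < t \<Longrightarrow> t < b \<Longrightarrow> f' t \<le> g' t"
  shows "f b - f a \<le> g b - g a"
proof -
  have "g a - f a \<le> g b - f b"
  proof (rule DERIV_nonneg_imp_increasing_open[of a b "\<lambda>t. g t - f t"])
    fix t assume t: "a < t" "t < b"
    show "\<exists>y. ((\<lambda>t. g t - f t) has_real_derivative y) (at t) \<and> 0 \<le> y"
      using DERIV_diff[OF assms(5)[OF t] assms(4)[OF t]] assms(6)[OF t] by (intro exI[of _ "g' t - f' t"]) auto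
  qed (use assms in \<open>auto intro!: continuous_intros\<close>)
  then show ?thesis by simp
qed

context angle
begin

text \<open>\<open>OA\<close>, \<open>OB\<close> and \<open>OC\<close> are the two diagonal entries
  and the off-diagonal entry of \<open>Omega\<close>, and \<open>OD\<close> is its determinant, see
  \<open>det_Omega\<close>.\<close>

definition OA :: "real \<Rightarrow> real \<Rightarrow> real" where "OA a t = integral {a..t} (\<lambda>s. (cos (phi s))\<^sup>2)"
definition OB :: "real \<Rightarrow> real \<Rightarrow> real" where "OB a t = integral {a..t} (\<lambda>s. (sin (phi s))\<^sup>2)"
definition OC :: "real \<Rightarrow> real \<Rightarrow> real" where "OC a t = integral {a..t} (\<lambda>s. sin (phi s) * cos (phi s))"
definition OD :: "real \<Rightarrow> real \<Rightarrow> real" where "OD a t = OA a t * OB a t - (OC a t)\<^sup>2"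
text \<open>\<open>OK a \<alpha> t\<close> is the integral of \<open>(sin (\<alpha> - phi s))\<^sup>2\<close> over \<open>{a..t}\<close>, see \<open>OK_derivative\<close>.\<close>
definition OK :: "real \<Rightarrow> real \<Rightarrow> real \<Rightarrow> real" where
  "OK a \<alpha> t = (sin \<alpha>)\<^sup>2 * OA a t + (cos \<alpha>)\<^sup>2 * OB a t - 2 * sin \<alpha> * cos \<alpha> * OC a t"

lemma trig_integrands:
  "continuous_on {0<..1} (\<lambda>s. (cos (phi s))\<^sup>2)" "continuous_on {0<..1} (\<lambda>s. (sin (phi s))\<^sup>2)"
  "continuous_on {0<..1} (\<lambda>s. sin (phi s) * cos (phi s))"
  by (intro continuous_intros phi_cont)+

lemma trig_integrand_bounds:
  "norm ((cos (phi s))\<^sup>2) \<le> 1" "norm ((sin (phi s))\<^sup>2) \<le> 1" "norm (sin (phi s) * cos (phi s)) \<le> 1"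
proof -
  have "\<bar>sin (phi s)\<bar> * \<bar>cos (phi s)\<bar> \<le> 1 * 1" by (rule mult_mono) auto
  then show "norm (sin (phi s) * cos (phi s)) \<le> 1" by (simp add: abs_mult)
qed (auto simp: abs_square_le_1)

lemma Omega_integrals_refl [simp]: "OA a a = 0" "OB a a = 0" "OC a a = 0" "OD a a = 0" "OK a \<alpha> a = 0"
  by (simp_all add: OA_def OB_def OC_def OD_def OK_def)

lemma Omega_integrals_derivative:
  assumes "0 \<le> a" "a < t" "t < 1"
  shows "(OA a has_real_derivative (cos (phi t))\<^sup>2) (at t)"
    "(OB a has_real_derivative (sin (phi t))\<^sup>2) (at t)"
    "(OC a has_real_derivative sin (phi t) * cos (phi t)) (at t)"
  unfolding OA_def[abs_def] OB_def[abs_def] OC_def[abs_def] has_real_derivative_iff_has_vector_derivative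
  by (intro integral_has_derivative_interior[OF trig_integrands(1) trig_integrand_bounds(1) assms]
      integral_has_derivative_interior[OF trig_integrands(2) trig_integrand_bounds(2) assms]
      integral_has_derivative_interior[OF trig_integrands(3) trig_integrand_bounds(3) assms])+

lemma OK_derivative:
  assumes "0 \<le> a" "a < t" "t < 1"
  shows "(OK a \<alpha> has_real_derivative (sin (\<alpha> - phi t))\<^sup>2) (at t)"
  unfolding OK_def[abs_def]
  by (rule derivative_eq_intros Omega_integrals_derivative[OF assms] refl)+
    (simp add: sin_diff power2_eq_square algebra_simps)

text \<open>Omega grows in a rank-one direction, so the derivative of its determinant is the
  adjugate form at xi (phi t), which is \<open>OK a (phi t) t\<close>. As \<open>OK\<close> is
  itself an integral, \<open>OD a b\<close> is the double integral of sin^2 (phi t - phi s) over a <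
  s < t < b.\<close>

lemma OD_derivative:
  assumes "0 \<le> a" "a < t" "t < 1"
  shows "(OD a has_real_derivative OK a (phi t) t) (at t)"
  unfolding OD_def[abs_def]
  by (rule derivative_eq_intros Omega_integrals_derivative[OF assms] refl)+
    (simp add: OK_def power2_eq_square algebra_simps)

lemma Omega_integrals_continuous:
  assumes "0 \<le> a" "b \<le> 1" "a \<le> a'"
  shows "continuous_on {a'..b} (OA a)" "continuous_on {a'..b} (OB a)" "continuous_on {a'..b} (OC a)"
    "continuous_on {a'..b} (OD a)" "continuous_on {a'..b} (OK a \<alpha>)"
proof -
  have "continuous_on {a..1} (OA a)" "continuous_on {a..1} (OB a)" "continuous_on {a..1} (OC a)"
    unfolding OA_def[abs_def] OB_def[abs_def] OC_def[abs_def] using assms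
      integral_continuous_closed[OF trig_integrands(1) trig_integrand_bounds(1)]
      integral_continuous_closed[OF trig_integrands(2) trig_integrand_bounds(2)]
      integral_continuous_closed[OF trig_integrands(3) trig_integrand_bounds(3)] by auto
  then show *: "continuous_on {a'..b} (OA a)" "continuous_on {a'..b} (OB a)" "continuous_on {a'..b} (OC a)"
    using assms by (auto elim!: continuous_on_subset)
  show "continuous_on {a'..b} (OD a)" "continuous_on {a'..b} (OK a \<alpha>)"
    unfolding OD_def[abs_def] OK_def[abs_def] by (intro continuous_intros *)+
qed

lemma OK_nonneg: assumes "0 \<le> a" "a \<le> t" "t \<le> 1" shows "0 \<le> OK a \<alpha> t"
proof -
  have "0 - 0 \<le> OK a \<alpha> t - OK a \<alpha> a"
    using assms by (intro mono_on_interior_derivative[where f = "\<lambda>_. 0" and f' = "\<lambda>_. 0" and g' = "\<lambda>t. (sin (\<alpha> - phi t))\<^sup>2"]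
      Omega_integrals_continuous OK_derivative) auto
  then show ?thesis by simp
qed

lemma OD_mono_right: assumes "0 \<le> a" "a \<le> t" "t \<le> u" "u \<le> 1" shows "OD a t \<le> OD a u"
proof -
  have "0 - 0 \<le> OD a u - OD a t"
    using assms by (intro mono_on_interior_derivative[where f = "\<lambda>_. 0" and f' = "\<lambda>_. 0" and g' = "\<lambda>t. OK a (phi t) t"]
      Omega_integrals_continuous OD_derivative OK_nonneg) auto
  then show ?thesis by simp
qed

lemma OD_nonneg: assumes "0 \<le> a" "a \<le> t" "t \<le> 1" shows "0 \<le> OD a t"
  using OD_mono_right[of a a t] assms by simp

lemma OA_bounds: assumes "0 \<le> a" "a \<le> t" "t \<le> 1" shows "0 \<le> OA a t" "OA a t \<le> 1"
proof -
  show "0 \<le> OA a t" unfolding OA_def by (rule integral_nonneg[OF bounded_continuous_integrable[OF trig_integrands(1) trig_integrand_bounds(1)]]) (use assms in auto)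
  have "OA a t - OA a a \<le> t - a"
    using assms trig_integrand_bounds(1)
    by (intro mono_on_interior_derivative[where g = "\<lambda>x. x" and f' = "\<lambda>t. (cos (phi t))\<^sup>2" and g' = "\<lambda>_. 1"]
      Omega_integrals_continuous Omega_integrals_derivative) auto
  then show "OA a t \<le> 1" using assms by simp
qed

lemma OB_bounds: assumes "0 \<le> a" "a \<le> t" "t \<le> 1" shows "0 \<le> OB a t" "OB a t \<le> 1"
proof -
  show "0 \<le> OB a t" unfolding OB_def by (rule integral_nonneg[OF bounded_continuous_integrable[OF trig_integrands(2) trig_integrand_bounds(2)]]) (use assms in auto)
  have "OB a t - OB a a \<le> t - a"
    using assms trig_integrand_bounds(2)
    by (intro mono_on_interior_derivative[where g = "\<lambda>x. x" and f' = "\<lambda>t. (sin (phi t))\<^sup>2" and g' = "\<lambda>_. 1"]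
      Omega_integrals_continuous Omega_integrals_derivative) auto
  then show "OB a t \<le> 1" using assms by simp
qed

lemma OD_le: assumes "0 \<le> a" "a \<le> t" "t \<le> 1" shows "OD a t \<le> OA a t" "OD a t \<le> OB a t"
proof -
  have "OD a t \<le> OA a t * OB a t" by (simp add: OD_def)
  moreover have "OA a t * OB a t \<le> OA a t" "OA a t * OB a t \<le> OB a t"
    using OA_bounds[OF assms] OB_bounds[OF assms] by (auto intro: mult_left_le mult_left_le_one_le)
  ultimately show "OD a t \<le> OA a t" "OD a t \<le> OB a t" by auto
qed

text \<open>\<open>OK a \<alpha> t\<close> is the value of the positive semidefinite form Omega at
  the unit vector (sin \<alpha>, - cos \<alpha>), and a positive determinant excludes null
  vectors.\<close>

lemma OK_pos: assumes "0 \<le> a" "a \<le> t" "t \<le> 1" "OD a t > 0" shows "OK a \<alpha> t > 0"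
proof (rule ccontr)
  assume "\<not> ?thesis"
  then have K: "OK a \<alpha> t = 0" using OK_nonneg[OF assms(1-3), of \<alpha>] by simp
  define s c where "s = sin \<alpha>" and "c = cos \<alpha>"
  \<comment> \<open>\<open>OK\<close>, \<open>V\<close> and \<open>U\<close> are the entries of
    Omega in the orthonormal basis (s, -c), (c, s); a rotation preserves the determinant.\<close>
  define V where "V = c\<^sup>2 * OA a t + s\<^sup>2 * OB a t + 2 * s * c * OC a t"
  define U where "U = s * c * (OA a t - OB a t) + (s\<^sup>2 - c\<^sup>2) * OC a t"
  have "OK a \<alpha> t * V - U\<^sup>2 = OD a t * (s\<^sup>2 + c\<^sup>2)\<^sup>2"
    unfolding OK_def V_def U_def OD_def s_def[symmetric] c_def[symmetric] by algebra
  moreover have "s\<^sup>2 + c\<^sup>2 = 1" by (simp add: s_def c_def)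
  ultimately have "OD a t = - U\<^sup>2" using K by simp
  then show False using assms(4) zero_le_power2[of U] by linarith
qed

text \<open>The determinant may stay at 0 for a while, for instance as long as phi is constant; once
  it is positive, its derivative \<open>OK\<close> is positive too. This yields the uniqueness on
  which the description in \<open>kstep\<close> relies.\<close>

lemma OD_strict_mono:
  assumes "0 \<le> a" "a \<le> t" "t < u" "u \<le> 1" "OD a t > 0" shows "OD a t < OD a u"
proof (rule DERIV_pos_imp_increasing_open[OF \<open>t < u\<close>])
  fix x assume x: "t < x" "x < u"
  have "OD a x > 0" using OD_mono_right[of a t x] x assms by simp
  then have "OK a (phi x) x > 0" using OK_pos x assms by simp
  then show "\<exists>y. (OD a has_real_derivative y) (at x) \<and> 0 < y"
    using OD_derivative[of a x] x assms by auto
qed (use assms in \<open>auto intro!: Omega_integrals_continuous\<close>)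

lemma Omega_integrals_add:
  assumes "0 \<le> a" "a \<le> b" "b \<le> t" "t \<le> 1"
  shows "OA a t = OA a b + OA b t" "OB a t = OB a b + OB b t" "OC a t = OC a b + OC b t"
  unfolding OA_def OB_def OC_def using assms
    bounded_continuous_integrable[OF trig_integrands(1) trig_integrand_bounds(1), of a t]
    bounded_continuous_integrable[OF trig_integrands(2) trig_integrand_bounds(2), of a t]
    bounded_continuous_integrable[OF trig_integrands(3) trig_integrand_bounds(3), of a t]
  by (auto simp: Henstock_Kurzweil_Integration.integral_combine)

text \<open>The difference of the two sides is the cross term of det (M1 + M2) for positive
  semidefinite M1 and M2. After squaring, the claim is AM-GM for a1 * b2 and a2 * b1.\<close>

lemma mixed_discriminant_nonneg:
  fixes a1 :: real
  assumes "0 \<le> a1" "0 \<le> b1" "0 \<le> a2" "0 \<le> b2" "c1\<^sup>2 \<le> a1 * b1" "c2\<^sup>2 \<le> a2 * b2"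
  shows "2 * c1 * c2 \<le> a1 * b2 + a2 * b1"
proof (rule power2_le_imp_le)
  have "(2 * c1 * c2)\<^sup>2 = 4 * (c1\<^sup>2 * c2\<^sup>2)" by (simp add: power_mult_distrib)
  also have "\<dots> \<le> 4 * ((a1 * b1) * (a2 * b2))" using assms by (intro mult_left_mono mult_mono) auto
  also have "\<dots> \<le> (a1 * b2 + a2 * b1)\<^sup>2"
    using zero_le_power2[of "a1 * b2 - a2 * b1"] by (simp add: power2_eq_square algebra_simps)
  finally show "(2 * c1 * c2)\<^sup>2 \<le> (a1 * b2 + a2 * b1)\<^sup>2" .
qed (use assms in auto)

text \<open>Omega is additive over adjacent intervals, and the determinant is superadditive on
  positive semidefinite matrices.\<close>

lemma OD_mono_left:
  assumes "0 \<le> a" "a \<le> b" "b \<le> t" "t \<le> 1" shows "OD b t \<le> OD a t"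
proof -
  have "2 * OC a b * OC b t \<le> OA a b * OB b t + OA b t * OB a b"
    using OD_nonneg[of a b] OD_nonneg[of b t] OA_bounds[of a b] OA_bounds[of b t] OB_bounds[of a b] OB_bounds[of b t] assms
    by (intro mixed_discriminant_nonneg) (auto simp: OD_def)
  moreover have "0 \<le> OD a b" using OD_nonneg assms by simp
  ultimately show ?thesis
    unfolding OD_def Omega_integrals_add[OF assms] by (simp add: power2_eq_square algebra_simps)
qed

text \<open>Of the double integral of sin^2 (phi t - phi s) only the rectangle with s in (a, a') and
  t in (b', b) is kept.\<close>

lemma OD_lower_bound:
  assumes "0 \<le> a" "a \<le> a'" "a' \<le> b'" "b' \<le> b" "b \<le> 1"
    and m: "\<And>s t. a < s \<Longrightarrow> s < a' \<Longrightarrow> b' < t \<Longrightarrow> t < b \<Longrightarrow> m \<le> (sin (phi t - phi s))\<^sup>2"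
  shows "m * (a' - a) * (b - b') \<le> OD a b"
proof -
  have K: "m * (a' - a) \<le> OK a (phi t) t" if t: "b' < t" "t < b" for t
  proof -
    have "m * a' - m * a \<le> OK a (phi t) a' - OK a (phi t) a"
      using assms t by (intro mono_on_interior_derivative[where f' = "\<lambda>_. m" and g' = "\<lambda>s. (sin (phi t - phi s))\<^sup>2"]
          OK_derivative Omega_integrals_continuous continuous_intros m) (auto intro!: derivative_eq_intros)
    moreover have "0 - 0 \<le> OK a (phi t) t - OK a (phi t) a'"
      using assms t by (intro mono_on_interior_derivative[where f = "\<lambda>_. 0" and f' = "\<lambda>_. 0" and g' = "\<lambda>s. (sin (phi t - phi s))\<^sup>2"]
          OK_derivative Omega_integrals_continuous continuous_intros) (auto intro!: derivative_eq_intros)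
    ultimately show ?thesis by (simp add: algebra_simps)
  qed
  have "m * (a' - a) * b - m * (a' - a) * b' \<le> OD a b - OD a b'"
    using assms K by (intro mono_on_interior_derivative[where f' = "\<lambda>_. m * (a' - a)" and g' = "\<lambda>t. OK a (phi t) t"]
          OD_derivative Omega_integrals_continuous continuous_intros) (auto intro!: derivative_eq_intros)
  then show ?thesis using OD_nonneg[of a b'] assms by (simp add: algebra_simps)
qed

lemma det_Omega:
  assumes "0 \<le> a" "t \<le> 1"
  shows "det (Omega (ham_of phi) a t) = OD a t"
proof -
  have H: "ham_of phi s $ 1 $ 1 = (cos (phi s))\<^sup>2" "ham_of phi s $ 2 $ 2 = (sin (phi s))\<^sup>2"
    "ham_of phi s $ 1 $ 2 = sin (phi s) * cos (phi s)" "ham_of phi s $ 2 $ 1 = sin (phi s) * cos (phi s)" for s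
    by (auto simp: ham_of_def xi_def power2_eq_square)
  have "continuous_on {0<..1} (\<lambda>s. ham_of phi s $ i $ j)" for i j
    using exhaust_2[of i] exhaust_2[of j] by (elim disjE; simp only: H trig_integrands)
  then have "continuous_on {0<..1} (\<lambda>s. \<chi> i. \<chi> j. ham_of phi s $ i $ j)"
    by (intro continuous_on_vec_lambda)
  then have c: "continuous_on {0<..1} (ham_of phi)" by simp
  have "norm (ham_of phi s $ i $ j) \<le> 1" for s i j
    using exhaust_2[of i] exhaust_2[of j] by (elim disjE; simp only: H trig_integrand_bounds)
  then have "(\<Sum>i\<in>UNIV. \<Sum>j\<in>UNIV. norm (ham_of phi s $ i $ j)) \<le> (\<Sum>i\<in>(UNIV::2 set). \<Sum>j\<in>(UNIV::2 set). 1)" for s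
    by (intro sum_mono)
  then have "norm (ham_of phi s) \<le> (\<Sum>i\<in>(UNIV::2 set). \<Sum>j\<in>(UNIV::2 set). 1)" for s
    by (rule order_trans[OF norm_matrix_le_sum_entries])
  then have i: "ham_of phi integrable_on {a..t}"
    using bounded_continuous_integrable[OF c] assms by blast
  have "Omega (ham_of phi) a t $ i $ j = integral {a..t} (\<lambda>s. ham_of phi s $ i $ j)" for i j
    using integral_linear[OF i bounded_linear_compose[OF bounded_linear_vec_nth[of j] bounded_linear_vec_nth[of i]]]
    by (simp add: Omega_def o_def)
  then show ?thesis by (simp add: det_2 H OD_def OA_def OB_def OC_def power2_eq_square)
qed

end

section \<open>Energy growth on the imaginary axis\<close>

text \<open>Cauchy-Schwarz for integrals is reached through its AM-GM form with a free weight l,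
  because that form is pointwise and can be obtained by comparing derivatives. Optimising over l
  recovers the product.\<close>

lemma square_le_of_weighted_bounds:
  fixes Y P K r :: real
  assumes "\<And>l. l > 0 \<Longrightarrow> 2 * Y \<le> r * (l * P + K / l)" "0 \<le> P" "0 \<le> K" "0 \<le> Y" "0 < r"
  shows "Y\<^sup>2 \<le> r\<^sup>2 * P * K"
proof (cases "Y = 0")
  case False
  then have Y: "Y > 0" using assms by simp
  show ?thesis
  proof (cases "P = 0")
    case True
    \<comment> \<open>With P = 0 the bound tends to 0 as l grows; this l already brings it down to
      at most Y, which contradicts Y > 0.\<close>
    have "2 * Y \<le> r * (K / ((r * K + 1) / Y))"
      using assms(1)[of "(r * K + 1) / Y"] Y True assms by (simp add: add_nonneg_pos)
    also have "\<dots> = Y * (r * K) / (r * K + 1)" by simp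
    also have "\<dots> \<le> Y"
    proof -
      have "0 < r * K + 1" using assms by (simp add: add_nonneg_pos)
      then show ?thesis using Y by (simp only: pos_divide_le_eq) (simp add: algebra_simps)
    qed
    finally show ?thesis using Y by simp
  next
    case False
    then have P: "P > 0" using assms by simp
    \<comment> \<open>This l makes the first term equal to Y and, unlike the minimiser sqrt (K / P),
      is positive also for K = 0.\<close>
    have "2 * Y \<le> r * (Y / (r * P) * P + K / (Y / (r * P)))"
      using assms(1)[of "Y / (r * P)"] Y P assms by simp
    also have "\<dots> = Y + r\<^sup>2 * P * K / Y" using Y P assms by (simp add: field_simps power2_eq_square)
    finally have "Y \<le> r\<^sup>2 * P * K / Y" by simp
    then show ?thesis using Y by (simp add: pos_le_divide_eq power2_eq_square)
  qed
qed (use assms in simp)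

text \<open>Let x and y be the real and imaginary part of the row (u, v) and M the matrix with
  entries A, C, C, B. The right-hand side is the form M at x plus the form M at y, and Im (v * cnj
  u) is the determinant of the pair (x, y). Applying the square root of M to both vectors reduces
  the claim to |x|^2 + |y|^2 >= 2 det (x, y).\<close>

lemma binary_form_lower_bound:
  fixes A B C :: real and u v :: complex
  assumes "0 \<le> A" "0 < A * B - C\<^sup>2"
  shows "2 * sqrt (A * B - C\<^sup>2) * Im (v * cnj u) \<le> (cmod u)\<^sup>2 * A + (cmod v)\<^sup>2 * B + 2 * (u \<bullet> v) * C"
proof -
  define d where "d = sqrt (A * B - C\<^sup>2)"
  have d: "A * B = d\<^sup>2 + C\<^sup>2" using assms by (simp add: d_def)
  have A: "A > 0" using assms by (cases "A = 0") auto
  obtain x1 y1 x2 y2 where uv: "u = Complex x1 y1" "v = Complex x2 y2" by (metis complex.exhaust)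
  let ?L = "(cmod u)\<^sup>2 * A + (cmod v)\<^sup>2 * B + 2 * (u \<bullet> v) * C - 2 * d * Im (v * cnj u)"
  \<comment> \<open>Completing the square in the real and in the imaginary part, after
    multiplication by A > 0.\<close>
  have "A * ?L = (A * x1 + C * x2 - d * y2)\<^sup>2 + (A * y1 + C * y2 + d * x2)\<^sup>2"
  proof -
    have "A * ?L = A * A * (x1\<^sup>2 + y1\<^sup>2) + (A * B) * (x2\<^sup>2 + y2\<^sup>2) + 2 * A * C * (x1 * x2 + y1 * y2) - 2 * d * A * (y2 * x1 - x2 * y1)"
      by (simp add: uv cmod_power2 inner_complex_def algebra_simps)
    also have "\<dots> = (A * x1 + C * x2 - d * y2)\<^sup>2 + (A * y1 + C * y2 + d * x2)\<^sup>2"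
      unfolding d by (simp add: power2_eq_square algebra_simps)
    finally show ?thesis .
  qed
  then have "0 \<le> A * ?L" by simp
  then show ?thesis using A by (simp add: zero_le_mult_iff d_def)
qed

context angle
begin

context
  fixes w1 w2 :: "real \<Rightarrow> complex" and r :: real
  assumes sol: "row_solution phi (\<i> * r) w1 w2" and r: "r > 0"
begin

definition en where "en t = Im (w2 t * cnj (w1 t))"
definition pr where "pr t = w1 t * cos (phi t) + w2 t * sin (phi t)"

lemma row_derivatives:
  assumes "0 < t" "t < 1"
  shows "(w1 has_vector_derivative - (\<i> * r) * pr t * sin (phi t)) (at t)"
    "(w2 has_vector_derivative \<i> * r * pr t * cos (phi t)) (at t)"
  using sol assms by (auto simp: row_solution_def pr_def)

lemma row_continuous: "continuous_on {0..1} w1" "continuous_on {0..1} w2"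
  using sol by (auto simp: row_solution_def)

lemma en_continuous: assumes "0 \<le> a" "b \<le> 1" shows "continuous_on {a..b} en"
  unfolding en_def using row_continuous assms
  by (auto intro!: continuous_intros elim!: continuous_on_subset)

lemma en_derivative:
  assumes "0 < t" "t < 1" shows "(en has_real_derivative r * (cmod (pr t))\<^sup>2) (at t)"
proof -
  have e: "en = (\<lambda>t. w2 t \<bullet> (\<i> * w1 t))"
    by (auto simp: en_def inner_complex_def)
  have "((\<lambda>t. \<i> * w1 t) has_vector_derivative \<i> * (- (\<i> * r) * pr t * sin (phi t))) (at t)"
    by (intro derivative_intros row_derivatives assms)
  from bounded_bilinear.has_vector_derivative[OF bounded_bilinear_inner row_derivatives(2)[OF assms] this]
  show ?thesis
    unfolding e has_real_derivative_iff_has_vector_derivative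
    by (rule has_vector_derivative_eq_rhs)
      (simp only: cmod_power2, simp add: inner_complex_def pr_def algebra_simps power2_eq_square)
qed

lemma norm_w2_derivative:
  assumes "0 < t" "t < 1"
  shows "((\<lambda>t. (cmod (w2 t))\<^sup>2) has_real_derivative 2 * r * (cos (phi t))\<^sup>2 * en t) (at t)"
  by (rule DERIV_cong[OF has_real_derivative_norm_square[OF row_derivatives(2)[OF assms]]])
    (simp add: inner_complex_def pr_def en_def algebra_simps power2_eq_square)

lemma en_mono: assumes "0 \<le> a" "a \<le> b" "b \<le> 1" shows "en a \<le> en b"
proof -
  have "0 - 0 \<le> en b - en a"
    using assms r by (intro mono_on_interior_derivative[where f = "\<lambda>_. 0" and f' = "\<lambda>_. 0" and g' = "\<lambda>t. r * (cmod (pr t))\<^sup>2"]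
      en_continuous en_derivative) auto
  then show ?thesis by simp
qed

text \<open>The Volterra kernel \<open>sin (phi t - phi s)\<close>, \<open>s < t\<close>, has squared Hilbert--Schmidt norm
  \<open>OD a b\<close> on \<open>{a..b}\<close>; hence freezing the row at \<open>a\<close> changes the energy only by a factor.\<close>
lemma frozen_energy_bound:
  assumes ab: "0 \<le> a" "a < b" "b \<le> 1"
  shows "(cmod (w1 a))\<^sup>2 * OA a b + (cmod (w2 a))\<^sup>2 * OB a b + 2 * (w1 a \<bullet> w2 a) * OC a b
    \<le> 2 * (1 + r\<^sup>2 * OD a b) * ((en b - en a) / r)"
proof -
  \<comment> \<open>\<open>P t\<close> is the integral of |pr|^2 over {a..t}, read off from the
    energy.\<close>
  define P where "P t = (en t - en a) / r" for t
  have Pd: "(P has_real_derivative (cmod (pr t))\<^sup>2) (at t)" if "0 < t" "t < 1" for t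
    unfolding P_def using DERIV_cdivide[OF DERIV_diff[OF en_derivative[OF that] DERIV_const], of "en a" r] r by simp
  have Pc: "continuous_on {a..u} P" if "u \<le> 1" for u
    unfolding P_def using that r ab by (auto intro!: continuous_intros en_continuous)
  have Pmono: "0 \<le> P t" "P t \<le> P b" if "a \<le> t" "t \<le> b" for t
    unfolding P_def using en_mono[of a t] en_mono[of t b] that ab r by (auto intro!: divide_right_mono)
  \<comment> \<open>\<open>y \<alpha> t\<close> is the component along xi \<alpha> of the change of
    the row since a. With \<alpha> fixed its derivative is \<i> * r * pr * sin (\<alpha> - phi), so
    the next claim is Cauchy-Schwarz.\<close>
  define y where "y \<alpha> t = (w1 t - w1 a) * of_real (cos \<alpha>) + (w2 t - w2 a) * of_real (sin \<alpha>)" for \<alpha> t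
  have y: "(cmod (y \<alpha> t))\<^sup>2 \<le> r\<^sup>2 * P t * OK a \<alpha> t" if t: "a < t" "t < b" for \<alpha> t
  proof (rule square_le_of_weighted_bounds)
    fix l :: real assume l: "l > 0"
    have "norm (y \<alpha> t - y \<alpha> a) \<le> r / 2 * (l * P t + OK a \<alpha> t / l) - r / 2 * (l * P a + OK a \<alpha> a / l)"
    proof (rule differentiable_bound_general[OF \<open>a < t\<close>, where f' = "\<lambda>t. \<i> * r * pr t * sin (\<alpha> - phi t)"
          and \<phi>' = "\<lambda>t. r / 2 * (l * (cmod (pr t))\<^sup>2 + (sin (\<alpha> - phi t))\<^sup>2 / l)"])
      have w: "continuous_on {a..t} w1" "continuous_on {a..t} w2"
        using row_continuous ab t by (auto elim!: continuous_on_subset)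
      show "continuous_on {a..t} (y \<alpha>)" unfolding y_def by (intro continuous_intros w)
      show "continuous_on {a..t} (\<lambda>t. r / 2 * (l * P t + OK a \<alpha> t / l))"
        using ab t l by (intro continuous_intros Pc Omega_integrals_continuous) auto
      fix u assume u: "a < u" "u < t"
      then have u': "0 < u" "u < 1" using ab t by auto
      have "(y \<alpha> has_vector_derivative (- (\<i> * r) * pr u * sin (phi u) - 0) * of_real (cos \<alpha>) + (\<i> * r * pr u * cos (phi u) - 0) * of_real (sin \<alpha>)) (at u)"
        unfolding y_def by (intro derivative_intros row_derivatives u')
      then show "(y \<alpha> has_vector_derivative \<i> * r * pr u * sin (\<alpha> - phi u)) (at u)"
        by (rule has_vector_derivative_eq_rhs) (simp add: sin_diff algebra_simps)
      have "((\<lambda>t. r / 2 * (l * P t + OK a \<alpha> t / l)) has_real_derivative r / 2 * (l * (cmod (pr u))\<^sup>2 + (sin (\<alpha> - phi u))\<^sup>2 / l)) (at u)"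
        using ab u u' by (intro DERIV_cmult DERIV_add DERIV_cdivide Pd OK_derivative) auto
      then show "((\<lambda>t. r / 2 * (l * P t + OK a \<alpha> t / l)) has_vector_derivative r / 2 * (l * (cmod (pr u))\<^sup>2 + (sin (\<alpha> - phi u))\<^sup>2 / l)) (at u)"
        by (simp add: has_real_derivative_iff_has_vector_derivative)
      define p s where "p = cmod (pr u)" and "s = \<bar>sin (\<alpha> - phi u)\<bar>"
      have "0 \<le> (l * p - s)\<^sup>2 / l" using l by simp
      then have "p * s \<le> 1/2 * (l * p\<^sup>2 + s\<^sup>2 / l)" using l by (simp add: field_simps power2_eq_square)
      then have "r * (p * s) \<le> r * (1/2 * (l * p\<^sup>2 + s\<^sup>2 / l))" using r by (intro mult_left_mono) auto
      then show "norm (\<i> * r * pr u * sin (\<alpha> - phi u)) \<le> r / 2 * (l * (cmod (pr u))\<^sup>2 + (sin (\<alpha> - phi u))\<^sup>2 / l)"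
        using r by (simp add: norm_mult p_def s_def)
    qed
    moreover have "y \<alpha> a = 0" "P a = 0" by (simp_all add: y_def P_def)
    ultimately show "2 * cmod (y \<alpha> t) \<le> r * (l * P t + OK a \<alpha> t / l)" by simp
  qed (use Pmono OK_nonneg t ab r in auto)
  define Q where "Q t = (cmod (w1 a))\<^sup>2 * OA a t + (cmod (w2 a))\<^sup>2 * OB a t + 2 * (w1 a \<bullet> w2 a) * OC a t" for t
  have "Q b - Q a \<le> (2 * P b + 2 * r\<^sup>2 * P b * OD a b) - (2 * P a + 2 * r\<^sup>2 * P b * OD a a)"
  proof (rule mono_on_interior_derivative[where f = Q and g = "\<lambda>t. 2 * P t + 2 * r\<^sup>2 * P b * OD a t"
        and f' = "\<lambda>t. (cmod (w1 a * cos (phi t) + w2 a * sin (phi t)))\<^sup>2"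
        and g' = "\<lambda>t. 2 * (cmod (pr t))\<^sup>2 + 2 * r\<^sup>2 * P b * OK a (phi t) t"])
    show "continuous_on {a..b} Q" unfolding Q_def
      using ab by (intro continuous_intros Omega_integrals_continuous) auto
    show "continuous_on {a..b} (\<lambda>t. 2 * P t + 2 * r\<^sup>2 * P b * OD a t)"
      using ab by (intro continuous_intros Omega_integrals_continuous Pc) auto
    fix t assume t: "a < t" "t < b"
    then have t': "0 < t" "t < 1" using ab by auto
    have "(Q has_real_derivative (cmod (w1 a))\<^sup>2 * (cos (phi t))\<^sup>2 + (cmod (w2 a))\<^sup>2 * (sin (phi t))\<^sup>2 + 2 * (w1 a \<bullet> w2 a) * (sin (phi t) * cos (phi t))) (at t)"
      unfolding Q_def using ab t t' by (intro DERIV_cmult DERIV_add Omega_integrals_derivative) auto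
    then show "(Q has_real_derivative (cmod (w1 a * cos (phi t) + w2 a * sin (phi t)))\<^sup>2) (at t)"
      by (rule DERIV_cong) (simp only: cmod_power2, simp add: inner_complex_def power2_eq_square algebra_simps)
    show "((\<lambda>t. 2 * P t + 2 * r\<^sup>2 * P b * OD a t) has_real_derivative 2 * (cmod (pr t))\<^sup>2 + 2 * r\<^sup>2 * P b * OK a (phi t) t) (at t)"
      using ab t t' by (intro DERIV_cmult DERIV_add Pd OD_derivative) auto
    have "w1 a * cos (phi t) + w2 a * sin (phi t) = pr t - y (phi t) t"
      by (simp add: pr_def y_def algebra_simps)
    then have "(cmod (w1 a * cos (phi t) + w2 a * sin (phi t)))\<^sup>2 \<le> (cmod (pr t) + cmod (y (phi t) t))\<^sup>2"
      using norm_triangle_ineq4[of "pr t" "y (phi t) t"] by (simp add: power_mono)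
    also have "\<dots> \<le> 2 * (cmod (pr t))\<^sup>2 + 2 * (cmod (y (phi t) t))\<^sup>2"
      using sum_squares_bound[of "cmod (pr t)" "cmod (y (phi t) t)"] by (simp add: power2_sum)
    also have "(cmod (y (phi t) t))\<^sup>2 \<le> r\<^sup>2 * P b * OK a (phi t) t"
      by (rule order_trans[OF y[OF t]])
        (use Pmono[of t] OK_nonneg[of a t "phi t"] t t' ab in \<open>auto intro!: mult_right_mono mult_left_mono\<close>)
    finally show "(cmod (w1 a * cos (phi t) + w2 a * sin (phi t)))\<^sup>2 \<le> 2 * (cmod (pr t))\<^sup>2 + 2 * r\<^sup>2 * P b * OK a (phi t) t"
      by simp
  qed (use ab in simp)
  then show ?thesis by (simp add: Q_def P_def[of a] P_def[of b] algebra_simps)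
qed

lemma en_growth:
  assumes ab: "0 \<le> a" "a < b" "b \<le> 1" and c: "c > 0" "OD a b = c / r\<^sup>2" and e: "0 \<le> en a"
  shows "(1 + sqrt c / (1 + c)) * en a \<le> en b"
proof -
  have rD: "r\<^sup>2 * OD a b = c" "sqrt (OD a b) = sqrt c / r" using c r by (auto simp: real_sqrt_divide)
  have "2 * sqrt (OD a b) * en a \<le> (cmod (w1 a))\<^sup>2 * OA a b + (cmod (w2 a))\<^sup>2 * OB a b + 2 * (w1 a \<bullet> w2 a) * OC a b"
    unfolding en_def OD_def
    by (rule binary_form_lower_bound) (use OA_bounds[of a b] ab c r OD_def[of a b] in auto)
  also note frozen_energy_bound[OF ab]
  finally have "2 * sqrt (OD a b) * en a \<le> 2 * (1 + r\<^sup>2 * OD a b) * ((en b - en a) / r)" .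
  then have "sqrt c * en a \<le> (1 + c) * (en b - en a)"
    unfolding rD using r by (simp add: field_simps)
  then show ?thesis using c by (simp add: field_simps)
qed

lemma en_first_step:
  assumes ab: "0 < b" "b \<le> 1" and c: "c > 0" "OD 0 b = c / r\<^sup>2" and w0: "w1 0 = 0" "w2 0 = 1"
  shows "c / (2 * (1 + c) * r) \<le> en b"
proof -
  have "OD 0 b \<le> OB 0 b" using OD_le ab by simp
  also have "\<dots> \<le> 2 * (1 + r\<^sup>2 * OD 0 b) * (en b / r)"
    using frozen_energy_bound[of 0 b] ab by (simp add: w0 en_def[of 0])
  finally have "c / r\<^sup>2 \<le> 2 * (1 + r\<^sup>2 * (c / r\<^sup>2)) * (en b / r)" unfolding c(2) .
  then have "c / r \<le> en b * (2 * (1 + c))" using r by (simp add: field_simps power2_eq_square)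
  then have "c / r / (2 * (1 + c)) \<le> en b" using c by (subst pos_divide_le_eq) auto
  then show ?thesis by (simp add: mult.commute)
qed

text \<open>Converts energy into size of w2: since \<open>en\<close> increases, the rate 2 * r *
  cos^2 phi * en is at least the one with the energy held at its value in a.\<close>

lemma norm_w2_lower:
  assumes "0 \<le> a" "a \<le> b" "b \<le> 1"
  shows "(cmod (w2 a))\<^sup>2 + 2 * r * en a * OA a b \<le> (cmod (w2 b))\<^sup>2"
proof -
  have "2 * r * en a * OA a b - 2 * r * en a * OA a a \<le> (cmod (w2 b))\<^sup>2 - (cmod (w2 a))\<^sup>2"
  proof (rule mono_on_interior_derivative[where f' = "\<lambda>t. 2 * r * en a * (cos (phi t))\<^sup>2" and g' = "\<lambda>t. 2 * r * (cos (phi t))\<^sup>2 * en t"])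
    show "continuous_on {a..b} (\<lambda>t. 2 * r * en a * OA a t)"
      using assms by (intro continuous_intros Omega_integrals_continuous) auto
    show "continuous_on {a..b} (\<lambda>b. (cmod (w2 b))\<^sup>2)"
      using assms row_continuous(2) by (auto intro!: continuous_intros elim!: continuous_on_subset)
    fix t assume t: "a < t" "t < b"
    show "((\<lambda>t. 2 * r * en a * OA a t) has_real_derivative 2 * r * en a * (cos (phi t))\<^sup>2) (at t)"
      using assms t by (intro DERIV_cmult Omega_integrals_derivative) auto
    show "((\<lambda>b. (cmod (w2 b))\<^sup>2) has_real_derivative 2 * r * (cos (phi t))\<^sup>2 * en t) (at t)"
      using assms t by (intro norm_w2_derivative) auto
    have "2 * r * (cos (phi t))\<^sup>2 * en a \<le> 2 * r * (cos (phi t))\<^sup>2 * en t"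
      using en_mono[of a t] assms t r by (intro mult_left_mono) auto
    then show "2 * r * en a * (cos (phi t))\<^sup>2 \<le> 2 * r * (cos (phi t))\<^sup>2 * en t" by (simp add: mult_ac)
  qed (use assms in simp)
  then show ?thesis by simp
qed

end

end

section \<open>The counting function\<close>

context angle
begin

lemma kstep_stop:
  assumes "0 \<le> s" "\<not> OD s 1 > c / r\<^sup>2" shows "kstep (ham_of phi) c r s = 1"
  using assms by (simp add: kstep_def det_Omega)

text \<open>Existence is the intermediate value theorem for \<open>OD s\<close>; uniqueness is
  \<open>OD_strict_mono\<close>, which applies because c / r^2 > 0.\<close>

lemma kstep_move:
  assumes s: "0 \<le> s" "s \<le> 1" and cr: "c > 0" "r > 0" and D: "OD s 1 > c / r\<^sup>2"
  shows "s < kstep (ham_of phi) c r s" "kstep (ham_of phi) c r s < 1"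
    "OD s (kstep (ham_of phi) c r s) = c / r\<^sup>2"
proof -
  have pos: "c / r\<^sup>2 > 0" using cr by simp
  obtain t where t: "s \<le> t" "t \<le> 1" "OD s t = c / r\<^sup>2"
    using IVT'[of "OD s" s "c / r\<^sup>2" 1] s D pos Omega_integrals_continuous(4)[of s 1 s] by auto
  have "t \<noteq> s" "t \<noteq> 1" using t(3) pos D by auto
  then have st: "s < t" "t < 1" using t by auto
  have "kstep (ham_of phi) c r s = (THE t. s < t \<and> t < 1 \<and> det (Omega (ham_of phi) s t) = c / r\<^sup>2)"
    using s D by (simp add: kstep_def det_Omega)
  also have "\<dots> = t"
  proof (rule the_equality)
    show "s < t \<and> t < 1 \<and> det (Omega (ham_of phi) s t) = c / r\<^sup>2"
      using st t s by (simp add: det_Omega)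
    fix u assume "s < u \<and> u < 1 \<and> det (Omega (ham_of phi) s u) = c / r\<^sup>2"
    then have u: "s < u" "u < 1" "OD s u = c / r\<^sup>2" using s by (auto simp: det_Omega)
    then show "u = t"
      using OD_strict_mono[of s u t] OD_strict_mono[of s t u] st t s pos by (cases u t rule: linorder_cases) auto
  qed
  finally show "s < kstep (ham_of phi) c r s" "kstep (ham_of phi) c r s < 1"
    "OD s (kstep (ham_of phi) c r s) = c / r\<^sup>2" using st t by auto
qed

context
  fixes c r :: real
  assumes c: "c > 0" and r: "r > 0"
begin

abbreviation "stp \<equiv> kstep (ham_of phi) c r"

lemma threshold_pos: "c / r\<^sup>2 > 0" using c r by simp

lemma kstep_range: assumes "0 \<le> s" "s \<le> 1" shows "s \<le> stp s" "stp s \<le> 1" "0 \<le> stp s"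
  using kstep_stop[OF assms(1), of c r] kstep_move[OF assms c r] assms
  by (cases "OD s 1 > c / r\<^sup>2"; force)+

lemma kstep_le:
  assumes "0 \<le> s" "s \<le> b" "b < 1" "c / r\<^sup>2 \<le> OD s b" shows "stp s \<le> b"
proof (rule ccontr)
  assume "\<not> ?thesis"
  then have b: "b < stp s" by simp
  \<comment> \<open>Strictness matters: with equality the algorithm would stop and return 1 instead
    of a point up to b.\<close>
  have "OD s b < OD s 1" using OD_strict_mono[of s b 1] assms threshold_pos by simp
  then have m: "stp s < 1" "OD s (stp s) = c / r\<^sup>2"
    using kstep_move[OF _ _ c r, of s] assms by auto
  then show False using OD_strict_mono[of s b "stp s"] assms b threshold_pos by simp
qed

text \<open>An earlier start never ends later, because the determinant over the larger interval is
  larger (\<open>OD_mono_left\<close>). This is what compares the partition of the algorithm with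
  packed intervals.\<close>

lemma kstep_mono: assumes "0 \<le> s" "s \<le> s'" "s' \<le> 1" shows "stp s \<le> stp s'"
proof (cases "OD s' 1 > c / r\<^sup>2")
  case True
  then have m: "s' < stp s'" "stp s' < 1" "OD s' (stp s') = c / r\<^sup>2"
    using kstep_move[OF _ _ c r, of s'] assms by auto
  then have "c / r\<^sup>2 \<le> OD s (stp s')" using OD_mono_left[of s s' "stp s'"] assms by simp
  then show ?thesis using m assms by (intro kstep_le) auto
next
  case False
  then show ?thesis using kstep_stop[of s' c r] kstep_range(2)[of s] assms by simp
qed

lemma kstep_iter_range: assumes "0 \<le> s" "s \<le> 1" shows "s \<le> (stp ^^ n) s \<and> (stp ^^ n) s \<le> 1"
proof (induction n)
  case (Suc n) then show ?case using kstep_range[of "(stp ^^ n) s"] assms by auto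
qed (use assms in auto)

lemma kstep_iter_mono: assumes "0 \<le> s" "s \<le> s'" "s' \<le> 1" shows "(stp ^^ n) s \<le> (stp ^^ n) s'"
proof (induction n)
  case (Suc n) then show ?case
    using kstep_mono[of "(stp ^^ n) s" "(stp ^^ n) s'"] kstep_iter_range[of s n] kstep_iter_range[of s' n] assms by auto
qed (use assms in auto)

lemma kstep_iter_trans:
  assumes "0 \<le> a" "a \<le> 1" "0 \<le> b" "b \<le> 1" "(stp ^^ m) a \<le> b" "(stp ^^ n) b \<le> d"
  shows "(stp ^^ (n + m)) a \<le> d"
proof -
  have "(stp ^^ n) ((stp ^^ m) a) \<le> (stp ^^ n) b"
    using assms kstep_iter_range[of a m] by (intro kstep_iter_mono) auto
  then show ?thesis using assms by (simp add: funpow_add)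
qed

abbreviation "sg \<equiv> ksigma (ham_of phi) c r"

lemma ksigma_0 [simp]: "sg 0 = 0" and ksigma_Suc [simp]: "sg (Suc n) = stp (sg n)"
  by (simp_all add: ksigma_def)

lemma ksigma_range: "0 \<le> sg n" "sg n \<le> 1"
  using kstep_iter_range[of 0 n] by (auto simp: ksigma_def)

lemma ksigma_mono: "i \<le> j \<Longrightarrow> sg i \<le> sg j"
  by (rule lift_Suc_mono_le[of sg]) (use kstep_range ksigma_range in auto)

lemma ksigma_step:
  assumes "sg (Suc i) < 1"
  shows "sg i < sg (Suc i)" "OD (sg i) (sg (Suc i)) = c / r\<^sup>2" "OD (sg i) 1 > c / r\<^sup>2"
proof -
  show D: "OD (sg i) 1 > c / r\<^sup>2"
    using kstep_stop[of "sg i" c r] assms ksigma_range[of i] by fastforce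
  show "sg i < sg (Suc i)" "OD (sg i) (sg (Suc i)) = c / r\<^sup>2"
    using kstep_move[OF _ _ c r D] ksigma_range[of i] by auto
qed

section \<open>Energy along the partition points, termination\<close>

context
  fixes w1 w2 :: "real \<Rightarrow> complex"
  assumes sol: "row_solution phi (\<i> * r) w1 w2" and w0: "w1 0 = 0" "w2 0 = 1"
begin

lemma en_ksigma:
  assumes "sg (Suc n) < 1"
  shows "(1 + sqrt c / (1 + c)) ^ n * (c / (2 * (1 + c) * r)) \<le> en w1 w2 (sg (Suc n))"
  using assms
proof (induction n)
  case 0
  then show ?case
    using en_first_step[OF sol r, of "sg 1" c] ksigma_step[of 0] c w0 by simp
next
  case (Suc n)
  have l: "sg (Suc n) < 1" using ksigma_mono[of "Suc n" "Suc (Suc n)"] Suc.prems by auto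
  have IH: "(1 + sqrt c / (1 + c)) ^ n * (c / (2 * (1 + c) * r)) \<le> en w1 w2 (sg (Suc n))"
    using Suc.IH l by blast
  have q: "0 \<le> 1 + sqrt c / (1 + c)" using c by simp
  have "0 \<le> (1 + sqrt c / (1 + c)) ^ n * (c / (2 * (1 + c) * r))" using q c r by simp
  then have e0: "0 \<le> en w1 w2 (sg (Suc n))" using IH by linarith
  have "(1 + sqrt c / (1 + c)) ^ Suc n * (c / (2 * (1 + c) * r)) \<le> (1 + sqrt c / (1 + c)) * en w1 w2 (sg (Suc n))"
    using mult_left_mono[OF IH q] by (simp add: mult.assoc)
  also have "\<dots> \<le> en w1 w2 (sg (Suc (Suc n)))"
    using ksigma_step[of "Suc n"] Suc.prems ksigma_range[of "Suc n"] c e0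
    by (intro en_growth[OF sol r]) (auto simp del: ksigma_Suc)
  finally show ?case .
qed

lemma norm_w2_ge_1: "1 \<le> cmod (w2 1)"
proof -
  have "en w1 w2 0 = 0" unfolding en_def[OF sol r] using w0 by simp
  then have "1 \<le> (cmod (w2 1))\<^sup>2" using norm_w2_lower[OF sol r, of 0 1] w0 by simp
  then show ?thesis by (metis norm_ge_zero one_power2 power2_le_imp_le)
qed

text \<open>The energy at sigma_(n+1) is converted into |w2|^2 on the rest of the interval. The
  algorithm does not stop at that point, so OA >= OD > c / r^2 there; this conversion uses up step n
  + 2.\<close>

lemma norm_w2_ksigma:
  assumes "sg (Suc (Suc n)) < 1"
  shows "(1 + sqrt c / (1 + c)) ^ n * (c\<^sup>2 / ((1 + c) * r\<^sup>2)) \<le> (cmod (w2 1))\<^sup>2"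
proof -
  let ?s = "sg (Suc n)" and ?q = "1 + sqrt c / (1 + c)"
  have l: "?s < 1" using ksigma_mono[of "Suc n" "Suc (Suc n)"] assms by auto
  have e: "?q ^ n * (c / (2 * (1 + c) * r)) \<le> en w1 w2 ?s" by (rule en_ksigma[OF l])
  have "c / r\<^sup>2 \<le> OA ?s 1"
    using ksigma_step(3)[OF assms] OD_le[of ?s 1] ksigma_range[of "Suc n"] by linarith
  then have "(?q ^ n * (c / (2 * (1 + c) * r))) * (c / r\<^sup>2) \<le> en w1 w2 ?s * OA ?s 1"
    using c r e order_trans[OF _ e, of 0] by (intro mult_mono) auto
  then have "2 * r * ((?q ^ n * (c / (2 * (1 + c) * r))) * (c / r\<^sup>2)) \<le> 2 * r * (en w1 w2 ?s * OA ?s 1)"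
    using r by (intro mult_left_mono) auto
  also have "\<dots> \<le> (cmod (w2 1))\<^sup>2"
    using norm_w2_lower[OF sol r ksigma_range(1,2)[of "Suc n"] order_refl] zero_le_power2[of "cmod (w2 ?s)"]
    unfolding mult.assoc by linarith
  also have "2 * r * ((?q ^ n * (c / (2 * (1 + c) * r))) * (c / r\<^sup>2)) = ?q ^ n * (c\<^sup>2 / ((1 + c) * r\<^sup>2))"
  proof -
    have *: "2 * r * ((X * (c / (2 * d * r))) * (c / r\<^sup>2)) = X * (c\<^sup>2 / (d * r\<^sup>2))" if "d > 0" for X d
      using r that by (simp add: field_simps power2_eq_square)
    show ?thesis by (rule *) (use c in simp)
  qed
  finally show ?thesis .
qed

text \<open>If 1 were never reached, the growth of the energy would push |w2 1| above every bound.
  Termination thus follows from the existence of the row on the whole interval.\<close>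

lemma ksigma_terminates: "\<exists>n. sg n = 1"
proof (rule ccontr)
  assume "\<not> ?thesis"
  then have l: "sg n < 1" for n using ksigma_range(2)[of n] by (simp add: less_le)
  let ?q = "1 + sqrt c / (1 + c)"
  define d where "d = c\<^sup>2 / ((1 + c) * r\<^sup>2)"
  have d: "d > 0" using c r by (simp add: d_def)
  have "?q > 1" using c by simp
  then obtain n where "(cmod (w2 1))\<^sup>2 / d < ?q ^ n" using real_arch_pow by blast
  then have "(cmod (w2 1))\<^sup>2 < ?q ^ n * d" using d by (simp add: pos_divide_less_eq)
  then show False using norm_w2_ksigma[OF l, of n] by (simp add: d_def)
qed

end

text \<open>Termination gives the \<open>LEAST\<close> in \<open>kappa\<close> its meaning. Since
  \<open>kappa\<close> counts intervals, its predecessor is the index of the last interior partition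
  point, which explains the shift by one in the third claim.\<close>

lemma kappa_props:
  shows "kappa (ham_of phi) c r \<ge> 1"
    and "sg n < 1 \<Longrightarrow> n < kappa (ham_of phi) c r"
    and "kappa (ham_of phi) c r = Suc (Suc m) \<Longrightarrow> sg (Suc m) < 1"
proof -
  define P where "P j \<longleftrightarrow> j \<ge> 1 \<and> \<not> OD (sg (j - 1)) 1 > c / r\<^sup>2" for j :: nat
  have k: "kappa (ham_of phi) c r = (LEAST j. P j)"
    using ksigma_range by (simp add: kappa_def P_def det_Omega)
  obtain w1 w2 where w: "row_solution phi (\<i> * r) w1 w2" "w1 0 = 0" "w2 0 = 1"
    "monodromy (ham_of phi) (\<i> * r) $ 2 $ 2 = w2 1"
    by (rule monodromy_row[of "\<i> * r" 2], erule that) (simp_all add: mat_def)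
  obtain N where "sg N = 1"
    using ksigma_terminates[OF w(1-3)] by blast
  then have "P (Suc N)" using threshold_pos by (auto simp: P_def)
  then have P: "P (kappa (ham_of phi) c r)" unfolding k by (rule LeastI)
  then show 1: "kappa (ham_of phi) c r \<ge> 1" by (simp add: P_def)
  show "n < kappa (ham_of phi) c r" if n: "sg n < 1"
  proof (rule ccontr)
    assume "\<not> ?thesis"
    then have le: "kappa (ham_of phi) c r \<le> n" by simp
    obtain j where j: "kappa (ham_of phi) c r = Suc j" using 1 by (cases "kappa (ham_of phi) c r") auto
    then have "sg (Suc j) = 1" using P kstep_stop[of "sg j" c r] ksigma_range[of j] by (simp add: P_def)
    then show False using ksigma_mono[of "Suc j" n] le j n by simp
  qed
  show "sg (Suc m) < 1" if m: "kappa (ham_of phi) c r = Suc (Suc m)"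
  proof -
    have "\<not> P (Suc m)" using not_less_Least[of "Suc m" P] m k by simp
    then have "OD (sg m) 1 > c / r\<^sup>2" by (simp add: P_def)
    then show ?thesis using kstep_move(2)[OF _ _ c r, of "sg m"] ksigma_range[of m] by simp
  qed
qed

end

lemma norm_monodromy_22_ge_1:
  assumes "r > 0" shows "1 \<le> cmod (monodromy (ham_of phi) (\<i> * complex_of_real r) $ 2 $ 2)"
proof -
  obtain w1 w2 where w: "row_solution phi (\<i> * r) w1 w2" "w1 0 = 0" "w2 0 = 1"
    "monodromy (ham_of phi) (\<i> * r) $ 2 $ 2 = w2 1"
    by (rule monodromy_row[of "\<i> * r" 2], erule that) (simp_all add: mat_def)
  show ?thesis
    using norm_w2_ge_1[OF zero_less_one assms w(1-3)] by (simp add: w(4))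
qed

text \<open>Logarithm of \<open>norm_w2_ksigma\<close>. Three of the intervals yield no growth
  factor: the first creates the energy, the last but one converts it, and the last may be too short.
  They go into C, while the factor r^(-2) turns into ln r.\<close>

lemma kappa_le_log_monodromy:
  assumes c: "c > 0"
  obtains q C where "q > 0" "\<And>r. r \<ge> 1 \<Longrightarrow> q * real (kappa (ham_of phi) c r)
    \<le> ln (cmod (monodromy (ham_of phi) (\<i> * complex_of_real r) $ 2 $ 2)) + ln r + C"
proof -
  define q where "q = 1 + sqrt c / (1 + c)"
  define d where "d = c\<^sup>2 / (1 + c)"
  have q: "q > 1" and d: "d > 0" using c by (auto simp: q_def d_def)
  have "ln q * real (kappa (ham_of phi) c r)
    \<le> 2 * ln (cmod (monodromy (ham_of phi) (\<i> * complex_of_real r) $ 2 $ 2)) + 2 * ln r + (3 * ln q + \<bar>ln d\<bar>)"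
    if r: "r \<ge> 1" for r
  proof -
    define M where "M = cmod (monodromy (ham_of phi) (\<i> * complex_of_real r) $ 2 $ 2)"
    have r0: "r > 0" using r by simp
    have M1: "1 \<le> M" unfolding M_def using norm_monodromy_22_ge_1[OF r0] .
    obtain w1 w2 where w: "row_solution phi (\<i> * r) w1 w2" "w1 0 = 0" "w2 0 = 1"
    "monodromy (ham_of phi) (\<i> * r) $ 2 $ 2 = w2 1"
    by (rule monodromy_row[of "\<i> * r" 2], erule that) (simp_all add: mat_def)
    let ?k = "kappa (ham_of phi) c r"
    show ?thesis
    proof (cases "?k \<ge> 3")
      case True
      then obtain n where n: "?k = Suc (Suc (Suc n))" by (metis Suc_le_D numeral_3_eq_3 Suc_le_mono)
      have "q ^ n * (c\<^sup>2 / ((1 + c) * r\<^sup>2)) \<le> M\<^sup>2"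
        unfolding q_def M_def w(4)
        by (rule norm_w2_ksigma[OF c r0 w(1-3) kappa_props(3)[OF c r0 n]])
      then have "q ^ n * (d / r\<^sup>2) \<le> M\<^sup>2" by (simp add: d_def)
      moreover have "0 < q ^ n * (d / r\<^sup>2)" using q d r0 by simp
      ultimately have "ln (q ^ n * (d / r\<^sup>2)) \<le> ln (M\<^sup>2)" using ln_mono by blast
      then have "real n * ln q + (ln d - 2 * ln r) \<le> 2 * ln M"
        using q d r0 M1 by (simp add: ln_mult ln_div ln_realpow)
      then show ?thesis unfolding n M_def[symmetric] by (simp add: algebra_simps)
    next
      case False
      then have "ln q * real ?k \<le> ln q * 3" using q by (intro mult_left_mono) auto
      moreover have "0 \<le> ln M" "0 \<le> ln r" using M1 r by auto
      ultimately show ?thesis unfolding M_def by (simp add: mult.commute)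
    qed
  qed
  then show ?thesis using q by (intro that[of "ln q / 2" "(3 * ln q + \<bar>ln d\<bar>) / 2"]) (auto simp: field_simps)
qed

end

section \<open>Upper bound in the rotating frame\<close>

text \<open>In the frame rotating with \<open>phi\<close> the row satisfies \<open>p' = phi' * q\<close> and \<open>q' = (z - phi') * p\<close>;
  the weight \<open>B\<close> balances the contributions of \<open>z\<close> and \<open>phi'\<close>.\<close>
lemma row_solution_bound_rotating:
  assumes sol: "row_solution phi z w1 w2" and z: "norm z \<le> r" and r: "r \<ge> 1"
    and t0: "0 < t0" "t0 \<le> 1" and K: "K \<ge> 0"
    and contphi: "continuous_on {0<..1} phi"
    and dphi: "\<And>t. t0 < t \<Longrightarrow> t < 1 \<Longrightarrow> (phi has_real_derivative phi' t) (at t)"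
    and bphi: "\<And>t. t0 < t \<Longrightarrow> t < 1 \<Longrightarrow> \<bar>phi' t\<bar> \<le> K * t powr (- 2 * e)"
    and B1: "\<And>t. t0 \<le> t \<Longrightarrow> t \<le> 1 \<Longrightarrow> 1 \<le> sqrt r * t powr e"
    and dPsi: "\<And>t. 0 < t \<Longrightarrow> (Psi has_real_derivative t powr (- e)) (at t)"
  shows "(cmod (w1 1))\<^sup>2 + (cmod (w2 1))\<^sup>2 \<le> r * t0 powr e *
      exp (- \<bar>e\<bar> * ln t0 + (2 * K + 1) * sqrt r * (Psi 1 - Psi t0)) * ((cmod (w1 t0))\<^sup>2 + (cmod (w2 t0))\<^sup>2)"
proof -
  define p where "p t = w1 t * of_real (cos (phi t)) + w2 t * of_real (sin (phi t))" for t
  define q where "q t = w2 t * of_real (cos (phi t)) - w1 t * of_real (sin (phi t))" for t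
  \<comment> \<open>For |phi'| of order t^(-2e) this is the size of sqrt (r / |phi'|), so that r / B
    and B * |phi'| are both of order sqrt r * t^(-e).\<close>
  define B where "B t = sqrt r * t powr e" for t
  define S where "S t = (cmod (w1 t))\<^sup>2 + (cmod (w2 t))\<^sup>2" for t
  define N where "N t = B t * (cmod (p t))\<^sup>2 + (cmod (q t))\<^sup>2 / B t" for t
  have S: "S t = (cmod (p t))\<^sup>2 + (cmod (q t))\<^sup>2" for t
  proof -
    have "(cmod (u * of_real c + v * of_real s))\<^sup>2 + (cmod (v * of_real c - u * of_real s))\<^sup>2
        = ((cmod u)\<^sup>2 + (cmod v)\<^sup>2) * (s\<^sup>2 + c\<^sup>2)" for u v s c
      unfolding cmod_power2 by (simp add: power2_eq_square algebra_simps)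
    from this[of "w1 t" "cos (phi t)" "w2 t" "sin (phi t)"]
    have "(cmod (p t))\<^sup>2 + (cmod (q t))\<^sup>2 = (cmod (w1 t))\<^sup>2 + (cmod (w2 t))\<^sup>2"
      by (simp add: p_def q_def)
    then show ?thesis by (simp add: S_def)
  qed
  have sub: "{t0..1} \<subseteq> {0<..1}" "{t0..1} \<subseteq> {0..1}" using t0 by auto
  have c: "continuous_on {t0..1} w1" "continuous_on {t0..1} w2" "continuous_on {t0..1} phi"
    using sol sub contphi unfolding row_solution_def by (blast intro: continuous_on_subset)+
  have pc: "continuous_on {t0..1} p" "continuous_on {t0..1} q"
    unfolding p_def q_def by (intro continuous_intros c)+
  have Bpos: "B t > 0" if "0 < t" for t using that r by (simp add: B_def)
  have Bc: "continuous_on {t0..1} B" unfolding B_def using t0 by (auto intro!: continuous_intros)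
  define N' where "N' t = e * B t / t * (cmod (p t))\<^sup>2 + B t * (2 * (p t \<bullet> (of_real (phi' t) * q t)))
     + (2 * (q t \<bullet> ((z - of_real (phi' t)) * p t)) / B t - (cmod (q t))\<^sup>2 * (e * B t / t) / (B t)\<^sup>2)" for t
  \<comment> \<open>The first term pays for the variation of the weight. In the second, r / B
    contributes 1, and phi' contributes K twice, once through p' and once through q'.\<close>
  define G where "G t = \<bar>e\<bar> * ln t + (2 * K + 1) * sqrt r * Psi t" for t
  have "N 1 \<le> N t0 * exp (G 1 - G t0)"
  proof (rule gronwall[where N' = N' and k = "\<lambda>t. \<bar>e\<bar> / t + (2 * K + 1) * sqrt r * t powr (- e)"])
    show "t0 \<le> 1" by fact
    show "continuous_on {t0..1} N" unfolding N_def
      using Bpos t0 by (auto intro!: continuous_intros pc Bc simp: less_imp_neq[symmetric])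
    have Psic: "continuous_on {t0..1} Psi"
      by (rule DERIV_continuous_on[where D = "\<lambda>t. t powr (- e)"]) (use dPsi t0 in \<open>auto intro: has_field_derivative_at_within\<close>)
    show "continuous_on {t0..1} G" unfolding G_def using t0 by (auto intro!: continuous_intros Psic)
    fix t assume t: "t0 < t" "t < 1"
    then have tp: "0 < t" using t0 by simp
    show "(G has_real_derivative \<bar>e\<bar> / t + (2 * K + 1) * sqrt r * t powr (- e)) (at t)"
      unfolding G_def using tp by (auto intro!: derivative_eq_intros dPsi)
    have w: "(w1 has_vector_derivative - z * p t * of_real (sin (phi t))) (at t)"
      "(w2 has_vector_derivative z * p t * of_real (cos (phi t))) (at t)"
      using sol t tp by (auto simp: row_solution_def p_def)
    have cs: "((\<lambda>t. complex_of_real (cos (phi t))) has_vector_derivative of_real (- sin (phi t) * phi' t)) (at t)"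
       "((\<lambda>t. complex_of_real (sin (phi t))) has_vector_derivative of_real (cos (phi t) * phi' t)) (at t)"
      using dphi[OF t] by (auto intro!: has_vector_derivative_of_real derivative_eq_intros)
    have sc: "complex_of_real (sin (phi t)) * of_real (sin (phi t)) + of_real (cos (phi t)) * of_real (cos (phi t)) = 1"
      by (metis of_real_1 of_real_add of_real_mult power2_eq_square sin_cos_squared_add)
    have "(p has_vector_derivative (w1 t * of_real (- sin (phi t) * phi' t) + - z * p t * of_real (sin (phi t)) * of_real (cos (phi t)))
        + (w2 t * of_real (cos (phi t) * phi' t) + z * p t * of_real (cos (phi t)) * of_real (sin (phi t)))) (at t)"
      unfolding p_def[abs_def] by (intro has_vector_derivative_add has_vector_derivative_mult w[unfolded p_def] cs)
    then have dp: "(p has_vector_derivative of_real (phi' t) * q t) (at t)"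
      by (rule has_vector_derivative_eq_rhs) (simp add: q_def algebra_simps)
    have "(q has_vector_derivative (w2 t * of_real (- sin (phi t) * phi' t) + z * p t * of_real (cos (phi t)) * of_real (cos (phi t)))
        - (w1 t * of_real (cos (phi t) * phi' t) + - z * p t * of_real (sin (phi t)) * of_real (sin (phi t)))) (at t)"
      unfolding q_def[abs_def] by (intro has_vector_derivative_diff has_vector_derivative_mult w cs)
    moreover have "(w2 t * of_real (- sin (phi t) * phi' t) + z * p t * of_real (cos (phi t)) * of_real (cos (phi t)))
        - (w1 t * of_real (cos (phi t) * phi' t) + - z * p t * of_real (sin (phi t)) * of_real (sin (phi t)))
        = z * p t * (of_real (sin (phi t)) * of_real (sin (phi t)) + of_real (cos (phi t)) * of_real (cos (phi t))) - of_real (phi' t) * p t"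
      by (simp add: p_def algebra_simps)
    moreover have "\<dots> = (z - of_real (phi' t)) * p t"
      unfolding sc by (simp add: algebra_simps)
    ultimately have dq: "(q has_vector_derivative (z - of_real (phi' t)) * p t) (at t)"
      by (simp only:)
    have "(B has_real_derivative sqrt r * (e * t powr (e - 1))) (at t)"
      unfolding B_def using tp by (intro DERIV_cmult has_real_derivative_powr)
    moreover have "sqrt r * (e * t powr (e - 1)) = e * B t / t"
      using tp by (simp add: B_def powr_diff)
    ultimately have dB: "(B has_real_derivative e * B t / t) (at t)" by simp
    have Bt: "B t > 0" using Bpos tp by simp
    have "(N has_real_derivative (e * B t / t * (cmod (p t))\<^sup>2 + 2 * (p t \<bullet> (of_real (phi' t) * q t)) * B t) +
         (2 * (q t \<bullet> ((z - of_real (phi' t)) * p t)) * B t - (cmod (q t))\<^sup>2 * (e * B t / t)) / (B t * B t)) (at t)"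
      unfolding N_def[abs_def]
      by (intro DERIV_add DERIV_mult DERIV_divide dB has_real_derivative_norm_square dp dq) (use Bt in auto)
    then show "(N has_real_derivative N' t) (at t)"
      by (rule DERIV_cong) (use Bt in \<open>simp add: N'_def diff_divide_distrib power2_eq_square\<close>)
    define x y f b where "x = cmod (p t)" and "y = cmod (q t)" and "f = \<bar>phi' t\<bar>" and "b = B t"
    have b1: "b \<ge> 1" unfolding b_def B_def using B1[of t] t by simp
    have nn: "x \<ge> 0" "y \<ge> 0" "f \<ge> 0" by (auto simp: x_def y_def f_def)
    define n where "n = b * x\<^sup>2 + y\<^sup>2 / b"
    have nN: "N t = n" by (simp add: N_def n_def x_def y_def b_def)
    have n0: "n \<ge> 0" using b1 by (simp add: n_def)
    have "0 \<le> (b * x - y)\<^sup>2 / b" using b1 by simp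
    then have amgm: "2 * x * y \<le> n" using b1 by (simp add: n_def field_simps power2_eq_square)
    have i1: "p t \<bullet> (of_real (phi' t) * q t) \<le> x * (f * y)"
      by (rule order_trans[OF norm_cauchy_schwarz]) (simp add: x_def y_def f_def norm_mult)
    have "cmod (z - of_real (phi' t)) \<le> r + f"
      by (rule order_trans[OF norm_triangle_ineq4]) (use z in \<open>simp add: f_def\<close>)
    then have i2: "q t \<bullet> ((z - of_real (phi' t)) * p t) \<le> y * ((r + f) * x)"
      by (intro order_trans[OF norm_cauchy_schwarz]) (auto simp: x_def y_def norm_mult intro!: mult_left_mono mult_right_mono)
    have "e * B t / t * (cmod (p t))\<^sup>2 \<le> \<bar>e\<bar> * b / t * x\<^sup>2"
      unfolding b_def[symmetric] x_def[symmetric] using b1 tp by (intro mult_right_mono divide_right_mono) auto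
    then have t1: "e * B t / t * (cmod (p t))\<^sup>2 \<le> \<bar>e\<bar> / t * (b * x\<^sup>2)" by (simp add: mult_ac)
    have t2: "B t * (2 * (p t \<bullet> (of_real (phi' t) * q t))) \<le> b * f * n"
    proof -
      have "B t * (2 * (p t \<bullet> (of_real (phi' t) * q t))) \<le> b * (2 * (x * (f * y)))"
        unfolding b_def[symmetric] using i1 b1 by (intro mult_left_mono) auto
      also have "\<dots> = b * f * (2 * x * y)" by simp
      also have "\<dots> \<le> b * f * n" using amgm b1 nn by (intro mult_left_mono) auto
      finally show ?thesis .
    qed
    have t3: "2 * (q t \<bullet> ((z - of_real (phi' t)) * p t)) / B t \<le> (r / b + b * f) * n"
    proof -
      have "2 * (q t \<bullet> ((z - of_real (phi' t)) * p t)) / B t \<le> 2 * (y * ((r + f) * x)) / b"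
        unfolding b_def[symmetric] using i2 b1 by (intro divide_right_mono mult_left_mono) auto
      also have "\<dots> = (r / b + f / b) * (2 * x * y)" by (simp add: add_divide_distrib algebra_simps)
      also have "\<dots> \<le> (r / b + f / b) * n" using amgm b1 nn r by (intro mult_left_mono) auto
      also have "\<dots> \<le> (r / b + b * f) * n"
      proof -
        \<comment> \<open>The assumption B >= 1 enters here: the phi' in q' comes with the factor 1
          / B, which is then at most B.\<close>
        have "f / b \<le> f" using b1 nn by (simp add: divide_le_eq mult_left_le mult_le_cancel_left1)
        also have "f \<le> b * f" using b1 nn by (simp add: mult_le_cancel_right1)
        finally show ?thesis using n0 by (intro mult_right_mono) auto
      qed
      finally show ?thesis .
    qed
    have t4: "- ((cmod (q t))\<^sup>2 * (e * B t / t) / (B t)\<^sup>2) \<le> \<bar>e\<bar> / t * (y\<^sup>2 / b)"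
    proof -
      have "- ((cmod (q t))\<^sup>2 * (e * B t / t) / (B t)\<^sup>2) = - e / t * (y\<^sup>2 / b)"
        using b1 tp by (simp add: y_def b_def power2_eq_square)
      also have "\<dots> \<le> \<bar>e\<bar> / t * (y\<^sup>2 / b)" using b1 tp by (intro mult_right_mono divide_right_mono) auto
      finally show ?thesis .
    qed
    have "N' t \<le> \<bar>e\<bar> / t * n + (r / b + 2 * (b * f)) * n"
    proof -
      have "\<bar>e\<bar> / t * n = \<bar>e\<bar> / t * (b * x\<^sup>2) + \<bar>e\<bar> / t * (y\<^sup>2 / b)" by (simp only: n_def distrib_left)
      moreover have "(r / b + 2 * (b * f)) * n = b * f * n + (r / b + b * f) * n" by (simp add: distrib_right)
      ultimately show ?thesis unfolding N'_def using t1 t2 t3 t4 by linarith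
    qed
    also have "\<dots> \<le> \<bar>e\<bar> / t * n + (2 * K + 1) * sqrt r * t powr (- e) * n"
    proof -
      have "r / b = sqrt r * t powr (- e)"
        using r tp real_sqrt_mult_self[of r] by (simp add: b_def B_def powr_minus field_simps)
      moreover have "b * f \<le> b * (K * t powr (- 2 * e))"
        using bphi[OF t] b1 by (intro mult_left_mono) (auto simp: f_def)
      moreover have "b * (K * t powr (- 2 * e)) = K * (sqrt r * t powr (- e))"
        using tp by (simp add: b_def B_def mult_ac flip: powr_add)
      moreover have "(2 * K + 1) * sqrt r * t powr (- e) = 2 * (K * (sqrt r * t powr (- e))) + sqrt r * t powr (- e)"
        by (simp add: algebra_simps)
      ultimately have "r / b + 2 * (b * f) \<le> (2 * K + 1) * sqrt r * t powr (- e)"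
        by linarith
      then show ?thesis using n0 by (intro add_left_mono mult_right_mono) auto
    qed
    finally show "N' t \<le> (\<bar>e\<bar> / t + (2 * K + 1) * sqrt r * t powr (- e)) * N t"
      unfolding nN by (simp add: algebra_simps)
  qed
  \<comment> \<open>Return to the Euclidean norm: the weight costs sqrt r at the end 1, and B t0 at
    the start.\<close>
  moreover have "S 1 \<le> sqrt r * N 1"
  proof -
    have b: "B 1 = sqrt r" by (simp add: B_def)
    have "1 * (cmod (p 1))\<^sup>2 \<le> r * (cmod (p 1))\<^sup>2" using r by (intro mult_right_mono) auto
    moreover have "sqrt r * (sqrt r * (cmod (p 1))\<^sup>2) = r * (cmod (p 1))\<^sup>2"
      using r by (simp flip: mult.assoc)
    moreover have "sqrt r * ((cmod (q 1))\<^sup>2 / sqrt r) = (cmod (q 1))\<^sup>2" using r by simp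
    ultimately show ?thesis unfolding S N_def b distrib_left by linarith
  qed
  moreover have "N t0 \<le> sqrt r * t0 powr e * S t0"
  proof -
    have b: "1 \<le> B t0" unfolding B_def using B1[of t0] t0 by simp
    have "(cmod (q t0))\<^sup>2 / B t0 \<le> (cmod (q t0))\<^sup>2 / 1" using b by (intro divide_left_mono) auto
    also have "\<dots> \<le> B t0 * (cmod (q t0))\<^sup>2" using b by (simp add: mult_le_cancel_right1)
    finally show ?thesis unfolding S N_def B_def[symmetric] by (simp add: algebra_simps)
  qed
  ultimately have "S 1 \<le> sqrt r * (sqrt r * t0 powr e * S t0 * exp (G 1 - G t0))"
    using r by (meson exp_ge_zero mult_left_mono mult_right_mono order_trans real_sqrt_ge_zero zero_le_one)
  also have "\<dots> = (sqrt r * sqrt r) * t0 powr e * exp (G 1 - G t0) * S t0" by simp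
  also have "G 1 - G t0 = - \<bar>e\<bar> * ln t0 + (2 * K + 1) * sqrt r * (Psi 1 - Psi t0)"
    by (simp add: G_def algebra_simps)
  finally show ?thesis using r by (simp add: S_def)
qed

section \<open>Packing steep stretches of the angle\<close>

lemma sin_square_lower:
  assumes "\<bar>y\<bar> \<le> (1::real)" shows "(y / 2)\<^sup>2 \<le> (sin y)\<^sup>2"
proof -
  have pos: "u / 2 \<le> sin u" if u: "0 \<le> u" "u \<le> 1" for u :: real
  proof -
    have "u / 2 - 0 / 2 \<le> sin u - sin 0"
    proof (rule mono_on_interior_derivative[where f' = "\<lambda>_. 1 / 2" and g' = cos])
      fix t :: real assume t: "0 < t" "t < u"
      have "cos (pi / 3) \<le> cos t" using t u pi_gt3 by (intro cos_monotone_0_pi_le) auto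
      then show "1 / 2 \<le> cos t" by (simp add: cos_60)
    qed (use u in \<open>auto intro!: continuous_intros derivative_eq_intros\<close>)
    then show ?thesis by simp
  qed
  have "(\<bar>y\<bar> / 2)\<^sup>2 \<le> (sin \<bar>y\<bar>)\<^sup>2" using pos[of "\<bar>y\<bar>"] assms by (intro power_mono) auto
  moreover have "(sin \<bar>y\<bar>)\<^sup>2 = (sin y)\<^sup>2" by (cases "y \<ge> 0") auto
  ultimately show ?thesis by (simp add: power_divide)
qed

context angle
begin

context
  fixes c r :: real
  assumes c: "c > 0" and r: "r > 0"
begin

text \<open>On an interval of length l the angle turns by at least m * l / 3 between the outer
  thirds and by at most L * m * l <= 1 in all, so the sine is at least half its argument. Hence OD
  >= (m * l / 6)^2 * (l / 3)^2 = m^2 * l^4 / 324, which is c / r^2 for l = K / sqrt (r * m) and K^4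
  = 324 * c. \<open>small\<close> amounts to L * m * l <= 1, and \<open>long\<close> says that one
  such interval fits.\<close>

lemma kstep_block:
  assumes ab: "0 < a" "a < b" "b < 1" and m: "m > 0" and L: "L \<ge> 1" and eps: "\<bar>eps\<bar> = 1"
    and d: "\<And>t. a \<le> t \<Longrightarrow> t \<le> b \<Longrightarrow> (phi has_real_derivative phi' t) (at t)"
    and bd: "\<And>t. a \<le> t \<Longrightarrow> t \<le> b \<Longrightarrow> m \<le> eps * phi' t \<and> eps * phi' t \<le> L * m"
    and K: "K > 0" "K ^ 4 = 324 * c"
    and small: "K\<^sup>2 * L\<^sup>2 * m \<le> r" and long: "K \<le> (b - a) * sqrt (r * m)"
  shows "\<exists>n. (kstep (ham_of phi) c r ^^ n) a \<le> b \<and> (b - a) * sqrt (r * m) / (2 * K) \<le> real n"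
proof -
  let ?T = "kstep (ham_of phi) c r"
  define l where "l = K / sqrt (r * m)"
  have rm: "sqrt (r * m) > 0" using r m by simp
  have l: "l > 0" using K rm by (simp add: l_def)
  have l2: "l\<^sup>2 = K\<^sup>2 / (r * m)" using r m by (simp add: l_def power_divide)
  have Lml: "L * m * l \<le> 1"
  proof -
    have "(L * m * l)\<^sup>2 = L\<^sup>2 * m\<^sup>2 * (K\<^sup>2 / (r * m))" by (simp add: power_mult_distrib l2)
    also have "\<dots> = K\<^sup>2 * L\<^sup>2 * m / r" using m r by (simp add: power2_eq_square)
    also have "\<dots> \<le> 1" using small r by simp
    finally have "(L * m * l)\<^sup>2 \<le> 1\<^sup>2" by simp
    then show ?thesis by (rule power2_le_imp_le) simp
  qed
  have step: "?T u \<le> u + l" if u: "a \<le> u" "u + l \<le> b" for u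
  proof (rule kstep_le[OF c r])
    have "(m * l / 6)\<^sup>2 * ((u + l / 3) - u) * ((u + l) - (u + 2 * l / 3)) \<le> OD u (u + l)"
    proof (rule OD_lower_bound)
      fix s t assume st: "u < s" "s < u + l / 3" "u + 2 * l / 3 < t" "t < u + l"
      have *: "m * t - m * s \<le> eps * phi t - eps * phi s" "eps * phi t - eps * phi s \<le> L * m * t - L * m * s"
      proof -
        have d': "((\<lambda>t. eps * phi t) has_real_derivative eps * phi' x) (at x)" if "s \<le> x" "x \<le> t" for x
          using d[of x] that st u l by (intro DERIV_cmult) auto
        have c': "continuous_on {s..t} (\<lambda>t. eps * phi t)"
          by (rule DERIV_continuous_on[OF has_field_derivative_at_within[OF d']]) auto
        show "m * t - m * s \<le> eps * phi t - eps * phi s"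
          by (rule mono_on_interior_derivative[where f' = "\<lambda>_. m" and g' = "\<lambda>x. eps * phi' x"])
            (use st l u bd in \<open>auto intro!: continuous_intros c' d' derivative_eq_intros\<close>)
        show "eps * phi t - eps * phi s \<le> L * m * t - L * m * s"
          by (rule mono_on_interior_derivative[where g' = "\<lambda>_. L * m" and f' = "\<lambda>x. eps * phi' x"])
            (use st l u bd in \<open>auto intro!: continuous_intros c' d' derivative_eq_intros\<close>)
      qed
      define y where "y = phi t - phi s"
      have y1: "m * (t - s) \<le> eps * y" "eps * y \<le> L * m * (t - s)" using * by (auto simp: y_def algebra_simps)
      have "m * (l / 3) \<le> m * (t - s)" "L * m * (t - s) \<le> L * m * l"
        using st m L by (auto intro!: mult_left_mono)
      then have y2: "m * l / 3 \<le> eps * y" "eps * y \<le> 1" using y1 Lml by auto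
      have "0 \<le> m * l / 3" using m l by simp
      then have "\<bar>y\<bar> = eps * y" using eps y2 by (metis abs_mult abs_of_nonneg mult_1 order_trans)
      then have y3: "m * l / 3 \<le> \<bar>y\<bar>" "\<bar>y\<bar> \<le> 1" using y2 by auto
      have "m * l / 6 \<le> \<bar>y\<bar> / 2" using y3(1) by linarith
      then have "(m * l / 6)\<^sup>2 \<le> (\<bar>y\<bar> / 2)\<^sup>2" using m l by (intro power_mono) auto
      also have "\<dots> \<le> (sin y)\<^sup>2" using sin_square_lower[OF y3(2)] by (simp add: power_divide)
      finally show "(m * l / 6)\<^sup>2 \<le> (sin (phi t - phi s))\<^sup>2" by (simp add: y_def)
    qed (use u l ab in auto)
    moreover have "(m * l / 6)\<^sup>2 * ((u + l / 3) - u) * ((u + l) - (u + 2 * l / 3)) = c / r\<^sup>2"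
    proof -
      have "(m * l / 6)\<^sup>2 * ((u + l / 3) - u) * ((u + l) - (u + 2 * l / 3)) = m\<^sup>2 * (l\<^sup>2)\<^sup>2 / 324"
        by (simp add: power2_eq_square)
      also have "\<dots> = K ^ 4 / (324 * r\<^sup>2)" unfolding l2 using m r by (simp add: field_simps power2_eq_square eval_nat_numeral)
      finally show ?thesis using K by simp
    qed
    ultimately show "c / r\<^sup>2 \<le> OD u (u + l)" by (simp only:)
  qed (use u ab l in auto)
  have iter: "(?T ^^ i) a \<le> a + real i * l" if "a + real i * l \<le> b" for i
    using that
  proof (induction i)
    case (Suc i)
    have le: "a + real i * l \<le> b" "a + real i * l + l \<le> b" using Suc.prems l by (auto simp: algebra_simps)
    have "(?T ^^ Suc i) a \<le> ?T (a + real i * l)"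
      using Suc.IH[OF le(1)] kstep_iter_range[OF c r, of a i] ab le l
      by (auto intro!: kstep_mono[OF c r])
    also have "\<dots> \<le> a + real i * l + l" using step[of "a + real i * l"] le l by simp
    finally show ?case by (simp add: algebra_simps)
  qed simp
  define x where "x = (b - a) / l"
  have x1: "1 \<le> x" using long l rm by (simp add: x_def l_def field_simps)
  have xx: "x / 2 = (b - a) * sqrt (r * m) / (2 * K)" by (simp add: x_def l_def)
  define n where "n = nat \<lfloor>x\<rfloor>"
  have n: "real n = of_int \<lfloor>x\<rfloor>" using x1 by (simp add: n_def)
  have "real n \<le> x" unfolding n by simp
  then have "real n * l \<le> b - a" using l by (simp add: x_def pos_le_divide_eq)
  then have 1: "(?T ^^ n) a \<le> b" using iter[of n] by simp
  have "1 \<le> \<lfloor>x\<rfloor>" using x1 by simp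
  then have "1 \<le> real n" "x < real n + 1" unfolding n by linarith+
  \<comment> \<open>For x >= 1 the integer part is at least x / 2; this is where \<open>long\<close>
    pays off.\<close>
  then have "x / 2 \<le> real n" by linarith
  then show ?thesis using 1 xx by auto
qed

text \<open>The blocks accumulate at 0, so k counts them from right to left and block j is the
  leftmost. Starting from 0 <= a j, monotonicity lets the algorithm stay behind the steps made block
  by block. After the total number of steps it is still at most b k0 < 1, hence has not
  finished.\<close>

lemma kappa_lower_blocks:
  assumes kj: "k0 \<le> j" and L: "L \<ge> 1" and eps: "\<bar>eps\<bar> = 1" and K: "K > 0" "K ^ 4 = 324 * c"
    and ab: "\<And>k. k0 \<le> k \<Longrightarrow> k \<le> j \<Longrightarrow> 0 < a k \<and> a k < b k \<and> b k < 1 \<and> 0 < m k"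
    and ord: "\<And>k. k0 \<le> k \<Longrightarrow> k < j \<Longrightarrow> b (Suc k) \<le> a k"
    and d: "\<And>k t. k0 \<le> k \<Longrightarrow> k \<le> j \<Longrightarrow> a k \<le> t \<Longrightarrow> t \<le> b k \<Longrightarrow> (phi has_real_derivative phi' t) (at t)"
    and bd: "\<And>k t. k0 \<le> k \<Longrightarrow> k \<le> j \<Longrightarrow> a k \<le> t \<Longrightarrow> t \<le> b k \<Longrightarrow> m k \<le> eps * phi' t \<and> eps * phi' t \<le> L * m k"
    and small: "\<And>k. k0 \<le> k \<Longrightarrow> k \<le> j \<Longrightarrow> K\<^sup>2 * L\<^sup>2 * m k \<le> r"
    and long: "\<And>k. k0 \<le> k \<Longrightarrow> k \<le> j \<Longrightarrow> K \<le> (b k - a k) * sqrt (r * m k)"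
  shows "(\<Sum>k=k0..j. (b k - a k) * sqrt (r * m k) / (2 * K)) \<le> real (kappa (ham_of phi) c r)"
proof -
  let ?T = "kstep (ham_of phi) c r"
  have "\<exists>n. (?T ^^ n) (a k) \<le> b k \<and> (b k - a k) * sqrt (r * m k) / (2 * K) \<le> real n" if k: "k0 \<le> k" "k \<le> j" for k
    by (rule kstep_block[OF _ _ _ _ L eps d bd K small long]) (use ab[OF k] k in auto)
  then obtain n where n: "\<And>k. k0 \<le> k \<Longrightarrow> k \<le> j \<Longrightarrow> (?T ^^ n k) (a k) \<le> b k"
    "\<And>k. k0 \<le> k \<Longrightarrow> k \<le> j \<Longrightarrow> (b k - a k) * sqrt (r * m k) / (2 * K) \<le> real (n k)" by metis
  have "i \<le> j \<longrightarrow> (?T ^^ (\<Sum>k=k0..i. n k)) (a i) \<le> b k0" if "k0 \<le> i" for i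
    using that
  proof (induction i rule: dec_induct)
    case base then show ?case using n by simp
  next
    case (step i)
    show ?case
    proof
      assume i: "Suc i \<le> j"
      have "(?T ^^ n (Suc i)) (a (Suc i)) \<le> a i"
        using n(1)[of "Suc i"] ord[of i] step i by simp
      moreover have "(?T ^^ (\<Sum>k=k0..i. n k)) (a i) \<le> b k0" using step i by simp
      ultimately have "(?T ^^ ((\<Sum>k=k0..i. n k) + n (Suc i))) (a (Suc i)) \<le> b k0"
        using ab[of i] ab[of "Suc i"] step i by (intro kstep_iter_trans[OF c r, where b = "a i"]) auto
      then show "(?T ^^ (\<Sum>k=k0..Suc i. n k)) (a (Suc i)) \<le> b k0" using step by simp
    qed
  qed
  from this[of j] have "(?T ^^ (\<Sum>k=k0..j. n k)) (a j) \<le> b k0" using kj by simp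
  moreover have "(?T ^^ (\<Sum>k=k0..j. n k)) 0 \<le> (?T ^^ (\<Sum>k=k0..j. n k)) (a j)"
    using ab[of j] kj by (intro kstep_iter_mono[OF c r]) auto
  ultimately have "ksigma (ham_of phi) c r (\<Sum>k=k0..j. n k) < 1"
    using ab[of k0] kj by (simp add: ksigma_def)
  then have "(\<Sum>k=k0..j. n k) < kappa (ham_of phi) c r" by (rule kappa_props(2)[OF c r])
  moreover have "(\<Sum>k=k0..j. (b k - a k) * sqrt (r * m k) / (2 * K)) \<le> (\<Sum>k=k0..j. real (n k))"
    by (intro sum_mono n) auto
  ultimately show ?thesis by (simp flip: of_nat_sum)
qed

end
end

section \<open>The oscillating angle\<close>

definition osc :: "real \<Rightarrow> real \<Rightarrow> real \<Rightarrow> real" where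
  "osc \<gamma> \<beta> t = t powr \<gamma> * sin (t powr (- \<beta>))"

text \<open>The factorisation isolates t^(-2e) with 2e = \<beta> - \<gamma> + 1. The bracket is
  bounded for every sign of \<beta>, because |sin x| <= |x| gives t^\<beta> * |sin (t^(-\<beta>))|
  <= 1.\<close>

definition osc_deriv :: "real \<Rightarrow> real \<Rightarrow> real \<Rightarrow> real" where
  "osc_deriv \<gamma> \<beta> t = t powr (\<gamma> - \<beta> - 1) * (\<gamma> * t powr \<beta> * sin (t powr (- \<beta>)) - \<beta> * cos (t powr (- \<beta>)))"

lemma osc_has_derivative:
  assumes "t > 0" shows "(osc \<gamma> \<beta> has_real_derivative osc_deriv \<gamma> \<beta> t) (at t)"
proof -
  have "(osc \<gamma> \<beta> has_real_derivative \<gamma> * t powr (\<gamma> - 1) * sin (t powr (- \<beta>))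
      + cos (t powr (- \<beta>)) * (- \<beta> * t powr (- \<beta> - 1)) * t powr \<gamma>) (at t)"
    unfolding osc_def[abs_def]
    by (intro DERIV_mult has_real_derivative_powr DERIV_chain2[OF DERIV_sin] assms)
  then show ?thesis
    by (rule DERIV_cong) (use assms in \<open>simp add: osc_deriv_def powr_diff powr_minus field_simps powr_add\<close>)
qed

lemma osc_angle: "angle (osc \<gamma> \<beta>)"
  by standard (rule DERIV_continuous_on[OF has_field_derivative_at_within[OF osc_has_derivative]], auto)

lemma osc_deriv_bound:
  assumes "t > 0" shows "\<bar>osc_deriv \<gamma> \<beta> t\<bar> \<le> (\<bar>\<gamma>\<bar> + \<bar>\<beta>\<bar>) * t powr (\<gamma> - \<beta> - 1)"
proof -
  have "\<bar>\<gamma> * t powr \<beta> * sin (t powr (- \<beta>))\<bar> = \<bar>\<gamma>\<bar> * (t powr \<beta> * \<bar>sin (t powr (- \<beta>))\<bar>)"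
    by (simp add: abs_mult)
  also have "\<dots> \<le> \<bar>\<gamma>\<bar> * (t powr \<beta> * t powr (- \<beta>))"
    using abs_sin_x_le_abs_x[of "t powr (- \<beta>)"] by (intro mult_left_mono) auto
  also have "\<dots> = \<bar>\<gamma>\<bar>" using assms by (simp flip: powr_add)
  finally have 1: "\<bar>\<gamma> * t powr \<beta> * sin (t powr (- \<beta>))\<bar> \<le> \<bar>\<gamma>\<bar>" .
  have 2: "\<bar>\<beta> * cos (t powr (- \<beta>))\<bar> \<le> \<bar>\<beta>\<bar>" by (simp add: abs_mult mult_left_le)
  have "\<bar>\<gamma> * t powr \<beta> * sin (t powr (- \<beta>)) - \<beta> * cos (t powr (- \<beta>))\<bar> \<le> \<bar>\<gamma>\<bar> + \<bar>\<beta>\<bar>"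
    using 1 2 by linarith
  from mult_left_mono[OF this, of "t powr (\<gamma> - \<beta> - 1)"] show ?thesis
    by (simp add: osc_deriv_def abs_mult mult.commute)
qed

text \<open>The interval is cut at t0. To the left, |sin phi| <= t0^gp yields the exponent r * t0^(1
  + gp). To the right the rotating frame applies, since \<nu> >= 2e keeps its weight sqrt r * t^e at
  least 1. \<open>Psi\<close> stays abstract so that powers and the logarithm are treated
  together.\<close>

lemma osc_row_bound:
  assumes sol: "row_solution (osc \<gamma> \<beta>) z w1 w2" and z: "norm z \<le> r" and r: "r \<ge> 1"
    and e: "2 * e = \<beta> - \<gamma> + 1" and nu: "\<nu> \<ge> 2" "\<nu> \<ge> 2 * e"
    and dPsi: "\<And>t. 0 < t \<Longrightarrow> (Psi has_real_derivative t powr (- e)) (at t)"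
    and gp: "gp = max \<gamma> 0" and t0: "t0 = r powr (- 1 / \<nu>)"
    and init: "(cmod (w1 0))\<^sup>2 + (cmod (w2 0))\<^sup>2 \<le> 1"
  shows "(cmod (w1 1))\<^sup>2 + (cmod (w2 1))\<^sup>2 \<le> exp ((1 + 2 * \<bar>e\<bar> + 2 * gp) * ln r + 4 * (r * t0 powr (1 + gp))
      + (2 * (\<bar>\<gamma>\<bar> + \<bar>\<beta>\<bar>) + 1) * sqrt r * (Psi 1 - Psi t0))"
proof -
  interpret angle "osc \<gamma> \<beta>" by (rule osc_angle)
  have t0pos: "0 < t0" using r by (simp add: t0)
  have lnt0: "ln t0 = - ln r / \<nu>" using r by (simp add: t0 ln_powr)
  have t01: "t0 \<le> 1" using r nu powr_mono[of "- 1 / \<nu>" 0 r] by (simp add: t0)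
  have gp0: "gp \<ge> 0" by (simp add: gp)
  define \<theta> where "\<theta> = t0 powr gp"
  have th: "0 < \<theta>" "\<theta> \<le> 1" using t0pos t01 gp0 by (auto simp: \<theta>_def intro!: powr_le1)
  have small: "\<bar>sin (osc \<gamma> \<beta> t)\<bar> \<le> \<theta>" if t: "t \<in> {0<..<t0}" for t
  proof (cases "\<gamma> > 0")
    case True
    have "\<bar>sin (osc \<gamma> \<beta> t)\<bar> \<le> \<bar>osc \<gamma> \<beta> t\<bar>" by (rule abs_sin_x_le_abs_x)
    also have "\<dots> \<le> t powr \<gamma> * 1" unfolding osc_def abs_mult by (intro mult_mono) auto
    also have "\<dots> \<le> t0 powr \<gamma>" using t True by (auto intro: powr_mono2)
    finally show ?thesis using True by (simp add: \<theta>_def gp)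
  qed (use t0pos in \<open>simp add: \<theta>_def gp\<close>)
  have n1: "(cmod (w1 t0))\<^sup>2 / \<theta> + \<theta> * (cmod (w2 t0))\<^sup>2 \<le> ((cmod (w1 0))\<^sup>2 / \<theta> + \<theta> * (cmod (w2 0))\<^sup>2) * exp (4 * r * \<theta> * t0)"
    by (rule row_solution_bound_near_0[OF sol th _ t01 small z]) (use t0pos in auto)
  \<comment> \<open>Entering and leaving the weighted norm costs \<theta>^(-2) = t0^(-2 gp), a mere
    multiple of ln r in the exponent.\<close>
  have "\<theta> * ((cmod (w1 t0))\<^sup>2 + (cmod (w2 t0))\<^sup>2) \<le> (cmod (w1 t0))\<^sup>2 / \<theta> + \<theta> * (cmod (w2 t0))\<^sup>2"
  proof -
    have "\<theta> * (cmod (w1 t0))\<^sup>2 \<le> 1 * (cmod (w1 t0))\<^sup>2" using th by (intro mult_right_mono) auto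
    also have "\<dots> \<le> (cmod (w1 t0))\<^sup>2 / \<theta>" using th by (simp add: pos_le_divide_eq mult_left_le)
    finally show ?thesis by (simp add: distrib_left)
  qed
  also note n1
  also have "((cmod (w1 0))\<^sup>2 / \<theta> + \<theta> * (cmod (w2 0))\<^sup>2) * exp (4 * r * \<theta> * t0) \<le> 1 / \<theta> * exp (4 * r * \<theta> * t0)"
  proof -
    have "\<theta> * (cmod (w2 0))\<^sup>2 \<le> 1 * (cmod (w2 0))\<^sup>2" using th by (intro mult_right_mono) auto
    also have "\<dots> \<le> (cmod (w2 0))\<^sup>2 / \<theta>" using th by (simp add: pos_le_divide_eq mult_left_le)
    finally have "(cmod (w1 0))\<^sup>2 / \<theta> + \<theta> * (cmod (w2 0))\<^sup>2 \<le> ((cmod (w1 0))\<^sup>2 + (cmod (w2 0))\<^sup>2) / \<theta>"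
      by (simp add: add_divide_distrib)
    also have "\<dots> \<le> 1 / \<theta>" using init th by (intro divide_right_mono) auto
    finally show ?thesis by (intro mult_right_mono) auto
  qed
  finally have "(cmod (w1 t0))\<^sup>2 + (cmod (w2 t0))\<^sup>2 \<le> 1 / \<theta> * exp (4 * r * \<theta> * t0) / \<theta>"
    using th by (simp add: pos_le_divide_eq mult.commute)
  also have "\<dots> = exp (- 2 * gp * ln t0 + 4 * (r * t0 powr (1 + gp)))"
  proof -
    have "1 / \<theta> = exp (- gp * ln t0)" using t0pos by (simp add: \<theta>_def powr_def exp_minus field_simps)
    moreover have "4 * r * \<theta> * t0 = 4 * (r * t0 powr (1 + gp))" using t0pos by (simp add: \<theta>_def powr_add)
    moreover have "1 / \<theta> * E / \<theta> = 1 / \<theta> * (1 / \<theta>) * E" for E by simp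
    ultimately have "1 / \<theta> * exp (4 * r * \<theta> * t0) / \<theta> = exp (- gp * ln t0) * exp (- gp * ln t0) * exp (4 * (r * t0 powr (1 + gp)))"
      by (simp only:)
    then show ?thesis by (simp flip: exp_add)
  qed
  finally have S0: "(cmod (w1 t0))\<^sup>2 + (cmod (w2 t0))\<^sup>2 \<le> exp (- 2 * gp * ln t0 + 4 * (r * t0 powr (1 + gp)))" .
  have B1: "1 \<le> sqrt r * t powr e" if t: "t0 \<le> t" "t \<le> 1" for t
  proof (cases "e > 0")
    case True
    have "1 \<le> r powr (1/2 - e / \<nu>)" using r nu by (intro ge_one_powr_ge_zero) (auto simp: field_simps)
    also have "\<dots> = sqrt r * t0 powr e"
      using r by (simp add: t0 powr_powr powr_half_sqrt flip: powr_add)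
        (simp add: powr_half_sqrt[symmetric] flip: powr_add)
    also have "\<dots> \<le> sqrt r * t powr e" using t t0pos True r by (intro mult_left_mono powr_mono2) auto
    finally show ?thesis .
  next
    case False
    have "1 * 1 \<le> sqrt r * t powr e"
      using t t0pos False r powr_mono2'[of e t 1] by (intro mult_mono) auto
    then show ?thesis by simp
  qed
  have "(cmod (w1 1))\<^sup>2 + (cmod (w2 1))\<^sup>2 \<le> r * t0 powr e *
      exp (- \<bar>e\<bar> * ln t0 + (2 * (\<bar>\<gamma>\<bar> + \<bar>\<beta>\<bar>) + 1) * sqrt r * (Psi 1 - Psi t0)) * ((cmod (w1 t0))\<^sup>2 + (cmod (w2 t0))\<^sup>2)"
    using e osc_deriv_bound[of _ \<gamma> \<beta>] t0pos
    by (intro row_solution_bound_rotating[OF sol z r t0pos t01 _ phi_cont osc_has_derivative _ B1 dPsi]) auto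
  also have "\<dots> \<le> r * t0 powr e *
      exp (- \<bar>e\<bar> * ln t0 + (2 * (\<bar>\<gamma>\<bar> + \<bar>\<beta>\<bar>) + 1) * sqrt r * (Psi 1 - Psi t0)) * exp (- 2 * gp * ln t0 + 4 * (r * t0 powr (1 + gp)))"
    using S0 r by (intro mult_left_mono) auto
  also have "\<dots> = exp ((ln r + e * ln t0 - \<bar>e\<bar> * ln t0 - 2 * gp * ln t0) + 4 * (r * t0 powr (1 + gp))
      + (2 * (\<bar>\<gamma>\<bar> + \<bar>\<beta>\<bar>) + 1) * sqrt r * (Psi 1 - Psi t0))"
  proof -
    have "r * t0 powr e = exp (ln r + e * ln t0)" using r t0pos by (simp add: powr_def exp_add)
    then show ?thesis by (simp add: algebra_simps flip: exp_add)
  qed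
  also have "\<dots> \<le> exp ((1 + 2 * \<bar>e\<bar> + 2 * gp) * ln r + 4 * (r * t0 powr (1 + gp))
      + (2 * (\<bar>\<gamma>\<bar> + \<bar>\<beta>\<bar>) + 1) * sqrt r * (Psi 1 - Psi t0))"
  proof -
    have l0: "ln r \<ge> 0" using r by simp
    then have l: "- ln t0 \<le> ln r" "0 \<le> - ln t0"
      unfolding lnt0 using nu by (auto simp: divide_le_eq mult_le_cancel_left1)
    have "(- e + \<bar>e\<bar> + 2 * gp) * (- ln t0) \<le> (2 * \<bar>e\<bar> + 2 * gp) * ln r"
      using l gp0 by (intro mult_mono) auto
    then show ?thesis by (simp add: algebra_simps)
  qed
  finally show ?thesis .
qed

section \<open>Operator norm of the monodromy matrix\<close>

lemma onorm_matrix_le: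
  fixes M :: "complex^2^2"
  assumes "\<And>i j. norm (M$i$j) \<le> B"
  shows "onorm (\<lambda>x. M *v x) \<le> 4 * B"
proof (rule onorm_le)
  fix x :: "complex^2"
  have "norm (M *v x) \<le> (\<Sum>i\<in>UNIV. norm ((M *v x) $ i))"
    unfolding norm_vec_def[of "M *v x"] by (rule L2_set_le_sum) auto
  also have "\<dots> \<le> (\<Sum>i\<in>(UNIV::2 set). \<Sum>j\<in>(UNIV::2 set). B * norm x)"
  proof (intro sum_mono)
    fix i :: 2
    have "norm ((M *v x) $ i) \<le> (\<Sum>j\<in>UNIV. norm (M$i$j * x$j))"
      by (simp add: matrix_vector_mult_def norm_sum)
    also have "\<dots> \<le> (\<Sum>j\<in>(UNIV::2 set). B * norm x)"
      unfolding norm_mult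
      by (intro sum_mono mult_mono assms Finite_Cartesian_Product.norm_nth_le) (use assms norm_ge_zero order_trans in blast)+
    finally show "norm ((M *v x) $ i) \<le> (\<Sum>j\<in>(UNIV::2 set). B * norm x)" .
  qed
  also have "\<dots> = 4 * B * norm x" by simp
  finally show "norm (M *v x) \<le> 4 * B * norm x" .
qed

lemma norm_entry_le_onorm:
  fixes M :: "complex^2^2"
  shows "norm (M$i$j) \<le> onorm (\<lambda>x. M *v x)"
proof -
  have bl: "bounded_linear (\<lambda>x. M *v x)"
    by (intro linear_conv_bounded_linear[THEN iffD1] linearI)
      (auto simp: vec_eq_iff matrix_vector_mult_def sum_2 algebra_simps)
  have "M$i$j = (M *v axis j 1) $ i" by (simp add: matrix_vector_mult_def axis_def if_distrib cong: if_cong)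
  then have "norm (M$i$j) \<le> norm (M *v axis j 1)" by (simp add: Finite_Cartesian_Product.norm_nth_le)
  also have "\<dots> \<le> onorm (\<lambda>x. M *v x) * norm (axis j 1 :: complex^2)" by (rule onorm[OF bl])
  also have "norm (axis j 1 :: complex^2) = 1" using exhaust_2[of j] by (auto simp: norm_vec_def L2_set_def axis_def sum_2)
  finally show ?thesis by simp
qed

lemma osc_monodromy_bounds:
  assumes r: "r \<ge> 1" and e: "2 * e = \<beta> - \<gamma> + 1" and nu: "\<nu> \<ge> 2" "\<nu> \<ge> 2 * e"
    and dPsi: "\<And>t. 0 < t \<Longrightarrow> (Psi has_real_derivative t powr (- e)) (at t)"
    and gp: "gp = max \<gamma> 0" and t0: "t0 = r powr (- 1 / \<nu>)"
  defines "N \<equiv> SUP z\<in>sphere 0 r. onorm (\<lambda>x. monodromy (ham_of (osc \<gamma> \<beta>)) z *v x)"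
  shows "cmod (monodromy (ham_of (osc \<gamma> \<beta>)) (\<i> * complex_of_real r) $ 2 $ 2) \<le> N"
    and "ln N \<le> ln 4 + ((1 + 2 * \<bar>e\<bar> + 2 * gp) * ln r + 4 * (r * t0 powr (1 + gp))
      + (2 * (\<bar>\<gamma>\<bar> + \<bar>\<beta>\<bar>) + 1) * sqrt r * (Psi 1 - Psi t0)) / 2"
proof -
  interpret angle "osc \<gamma> \<beta>" by (rule osc_angle)
  define X where "X = (1 + 2 * \<bar>e\<bar> + 2 * gp) * ln r + 4 * (r * t0 powr (1 + gp))
      + (2 * (\<bar>\<gamma>\<bar> + \<bar>\<beta>\<bar>) + 1) * sqrt r * (Psi 1 - Psi t0)"
  let ?M = "\<lambda>z. monodromy (ham_of (osc \<gamma> \<beta>)) z"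
  have entry: "norm (?M z $ i $ j) \<le> exp (X / 2)" if z: "z \<in> sphere 0 r" for z i j
  proof -
    obtain w1 w2 where w: "row_solution (osc \<gamma> \<beta>) z w1 w2" "w1 0 = mat 1 $ i $ 1" "w2 0 = mat 1 $ i $ 2"
      "?M z $ i $ 1 = w1 1" "?M z $ i $ 2 = w2 1" by (rule monodromy_row[of z i])
    have "(cmod (w1 0))\<^sup>2 + (cmod (w2 0))\<^sup>2 \<le> 1"
      using exhaust_2[of i] w(2,3) by (auto simp: mat_def)
    then have "(cmod (w1 1))\<^sup>2 + (cmod (w2 1))\<^sup>2 \<le> exp X"
      unfolding X_def using z by (intro osc_row_bound[OF w(1) _ r e nu dPsi gp t0]) auto
    moreover have "exp X = (exp (X / 2))\<^sup>2" by (simp add: power2_eq_square flip: exp_add)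
    ultimately have "(cmod (w1 1))\<^sup>2 \<le> (exp (X / 2))\<^sup>2" "(cmod (w2 1))\<^sup>2 \<le> (exp (X / 2))\<^sup>2"
      using zero_le_power2[of "cmod (w1 1)"] zero_le_power2[of "cmod (w2 1)"] by linarith+
    then have "cmod (w1 1) \<le> exp (X / 2)" "cmod (w2 1) \<le> exp (X / 2)"
      by (auto intro: power2_le_imp_le)
    then show ?thesis using exhaust_2[of j] w(4,5) by auto
  qed
  have ub: "onorm (\<lambda>x. ?M z *v x) \<le> 4 * exp (X / 2)" if "z \<in> sphere 0 r" for z
    by (rule onorm_matrix_le[OF entry[OF that]])
  have ir: "\<i> * complex_of_real r \<in> sphere 0 r" using r by (simp add: norm_mult)
  \<comment> \<open>Without this bound the real-valued \<open>SUP\<close> would be an unspecified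
    number and could not be compared with the entries.\<close>
  have bdd: "bdd_above ((\<lambda>z. onorm (\<lambda>x. ?M z *v x)) ` sphere 0 r)"
    using ub by (intro bdd_aboveI2)
  show *: "cmod (?M (\<i> * complex_of_real r) $ 2 $ 2) \<le> N"
    unfolding N_def by (rule order_trans[OF norm_entry_le_onorm cSUP_upper[OF ir bdd]])
  have "1 \<le> N" using norm_monodromy_22_ge_1[of r] r * by simp
  moreover have "N \<le> 4 * exp (X / 2)" unfolding N_def using r ub by (intro cSUP_least) auto
  ultimately have "ln N \<le> ln (4 * exp (X / 2))" by (intro ln_mono) auto
  then show "ln N \<le> ln 4 + X / 2" by (simp add: ln_mult)
qed

text \<open>On {k..k+1} the quotient x / k lies between 1 and 2, hence x^(f - 1) <= 2^|f - 1| * k^(f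
  - 1) for either sign of f - 1. \<open>Lam\<close> is any antiderivative: a power for f > 0, ln for
  f = 0.\<close>

lemma sum_powr_lower:
  fixes Lam :: "real \<Rightarrow> real"
  assumes k0: "1 \<le> k0" "k0 \<le> j"
    and d: "\<And>x. 0 < x \<Longrightarrow> (Lam has_real_derivative x powr (f - 1)) (at x)"
  shows "Lam (real (Suc j)) - Lam (real k0) \<le> 2 powr \<bar>f - 1\<bar> * (\<Sum>k=k0..j. real k powr (f - 1))"
proof -
  have "Lam (real (Suc k)) - Lam (real k) \<le> 2 powr \<bar>f - 1\<bar> * real k powr (f - 1)" if k: "k \<in> {k0..j}" for k
  proof -
    have k1: "real k \<ge> 1" using k k0 by auto
    have "Lam (real (Suc k)) - Lam (real k) \<le> 2 powr \<bar>f - 1\<bar> * real k powr (f - 1) * real (Suc k) - 2 powr \<bar>f - 1\<bar> * real k powr (f - 1) * real k"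
    proof (rule mono_on_interior_derivative[where f' = "\<lambda>x. x powr (f - 1)" and g' = "\<lambda>_. 2 powr \<bar>f - 1\<bar> * real k powr (f - 1)"])
      show "continuous_on {real k..real (Suc k)} Lam"
        by (rule DERIV_continuous_on[OF has_field_derivative_at_within[OF d]]) (use k1 in auto)
      fix x assume x: "real k < x" "x < real (Suc k)"
      show "(Lam has_real_derivative x powr (f - 1)) (at x)" using d x k1 by simp
      have q: "1 \<le> x / real k" "x / real k \<le> 2" using x k1 by (auto simp: field_simps)
      have "(x / real k) powr (f - 1) \<le> 2 powr \<bar>f - 1\<bar>"
      proof (cases "f \<ge> 1")
        case True
        then show ?thesis using q powr_mono2[of "f - 1" "x / real k" 2] by simp
      next
        case False
        then have "(x / real k) powr (f - 1) \<le> 1" using q powr_mono2'[of "f - 1" 1 "x / real k"] by simp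
        also have "1 \<le> 2 powr \<bar>f - 1\<bar>" by (intro ge_one_powr_ge_zero) auto
        finally show ?thesis .
      qed
      then have "(x / real k) powr (f - 1) * real k powr (f - 1) \<le> 2 powr \<bar>f - 1\<bar> * real k powr (f - 1)"
        by (intro mult_right_mono) auto
      then show "x powr (f - 1) \<le> 2 powr \<bar>f - 1\<bar> * real k powr (f - 1)"
        using x k1 by (simp add: powr_divide)
    qed (auto intro!: continuous_intros derivative_eq_intros)
    then show ?thesis by (simp add: algebra_simps)
  qed
  then have "(\<Sum>k=k0..j. Lam (real (Suc k)) - Lam (real k)) \<le> (\<Sum>k=k0..j. 2 powr \<bar>f - 1\<bar> * real k powr (f - 1))"
    by (rule sum_mono)
  then show ?thesis
    using sum_Suc_diff[of k0 j "\<lambda>k. Lam (real k)"] k0 by (simp add: sum_distrib_left)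
qed

text \<open>Block k is to be thought of near t = k^(-1/\<theta>), with length of order t^(\<theta> +
  1) and slope of order t^(-2e); it then holds about sqrt r * k^((e - 1)/\<theta> - 1) steps. Up to
  index j, \<nu> >= 2e keeps the slope small against r, and \<nu> >= 2 \<theta> + 2 - 2e keeps the
  block long enough for one step.\<close>

lemma (in angle) kappa_lower_power_blocks:
  fixes a b :: "nat \<Rightarrow> real"
  assumes c: "c > 0" and th: "\<theta> > 0" and k0: "k0 \<ge> 1" and c12: "c1 > 0" "c2 > 0" and L: "L \<ge> 1" and eps: "\<bar>eps\<bar> = 1"
    and ab: "\<And>k. k \<ge> k0 \<Longrightarrow> 0 < a k \<and> b k < 1" and ord: "\<And>k. k \<ge> k0 \<Longrightarrow> b (Suc k) \<le> a k"
    and len: "\<And>k. k \<ge> k0 \<Longrightarrow> c1 * real k powr (- (\<theta> + 1) / \<theta>) \<le> b k - a k"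
    and d: "\<And>t. 0 < t \<Longrightarrow> (phi has_real_derivative phi' t) (at t)"
    and bd: "\<And>k t. k \<ge> k0 \<Longrightarrow> a k \<le> t \<Longrightarrow> t \<le> b k \<Longrightarrow>
      c2 * real k powr (2 * e / \<theta>) \<le> eps * phi' t \<and> eps * phi' t \<le> L * (c2 * real k powr (2 * e / \<theta>))"
    and nu: "\<nu> \<ge> 2 * e" "\<nu> \<ge> 2 * \<theta> + 2 - 2 * e"
  obtains C ee where "C > 0" "ee > 0" "\<And>r j. r \<ge> 1 \<Longrightarrow> k0 \<le> j \<Longrightarrow> real j powr (\<nu> / \<theta>) \<le> ee * r \<Longrightarrow>
    C * sqrt r * (\<Sum>k=k0..j. real k powr ((e - 1) / \<theta> - 1)) \<le> real (kappa (ham_of phi) c r)"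
proof -
  define K where "K = sqrt (sqrt (324 * c))"
  have K: "K > 0" "K ^ 4 = 324 * c"
  proof -
    show "K > 0" using c by (simp add: K_def)
    have "K ^ 4 = (K\<^sup>2)\<^sup>2" by simp
    then show "K ^ 4 = 324 * c" using c by (simp only: K_def real_sqrt_pow2_iff) simp
  qed
  define h where "h = (e - 1) / \<theta> - 1"
  \<comment> \<open>The first entry serves \<open>small\<close>, the second serves
    \<open>long\<close> of \<open>kappa_lower_blocks\<close>.\<close>
  define ee where "ee = min (1 / (K\<^sup>2 * L\<^sup>2 * c2)) ((c1 * sqrt c2 / K)\<^sup>2)"
  have ee: "ee > 0" using K L c12 by (auto simp: ee_def)
  define C where "C = c1 * sqrt c2 / (2 * K)"
  have C: "C > 0" using K c12 by (simp add: C_def)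
  have nuth: "0 \<le> \<nu> / \<theta>" using nu th by (intro divide_nonneg_pos) linarith+
  have "C * sqrt r * (\<Sum>k=k0..j. real k powr h) \<le> real (kappa (ham_of phi) c r)"
    if r: "r \<ge> 1" and j: "k0 \<le> j" "real j powr (\<nu> / \<theta>) \<le> ee * r" for r j
  proof -
    have r0: "r > 0" using r by simp
    let ?m = "\<lambda>k. c2 * real k powr (2 * e / \<theta>)"
    have kX: "real k powr (\<nu> / \<theta>) \<le> ee * r" if "k0 \<le> k" "k \<le> j" for k
      using powr_mono2[OF nuth, of "real k" "real j"] that j k0 by simp
    have T: "c1 * sqrt c2 * sqrt r * real k powr h \<le> (b k - a k) * sqrt (r * ?m k)" if k: "k0 \<le> k" for k
    proof -
      have k1: "real k > 0" using k k0 by simp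
      have "sqrt (real k powr (2 * e / \<theta>)) = real k powr (e / \<theta>)"
        using k1 by (simp add: powr_half_sqrt[symmetric] powr_powr)
      then have s: "sqrt (r * ?m k) = sqrt c2 * sqrt r * real k powr (e / \<theta>)" by (simp add: real_sqrt_mult)
      have "h = - (\<theta> + 1) / \<theta> + e / \<theta>" using th by (simp add: h_def field_simps)
      then have "c1 * sqrt c2 * sqrt r * real k powr h = c1 * real k powr (- (\<theta> + 1) / \<theta>) * (sqrt c2 * sqrt r * real k powr (e / \<theta>))"
        by (simp add: powr_add)
      also have "\<dots> \<le> (b k - a k) * (sqrt c2 * sqrt r * real k powr (e / \<theta>))"
        using len[OF k] c12 r by (intro mult_right_mono) auto
      finally show ?thesis unfolding s .
    qed
    have long: "K \<le> c1 * sqrt c2 * sqrt r * real k powr h" if k: "k0 \<le> k" "k \<le> j" for k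
    proof -
      have k1: "real k \<ge> 1" using k k0 by simp
      have "(\<theta> + 1 - e) / \<theta> \<le> (\<nu> / 2) / \<theta>" using nu th by (intro divide_right_mono) auto
      then have "- h \<le> \<nu> / \<theta> / 2" using th by (simp add: h_def diff_divide_distrib add_divide_distrib mult.commute)
      then have "real k powr (- h) \<le> real k powr (\<nu> / \<theta> / 2)" using k1 by (intro powr_mono) auto
      also have "\<dots> = sqrt (real k powr (\<nu> / \<theta>))" using k1 by (simp add: powr_half_sqrt[symmetric] powr_powr)
      also have "\<dots> \<le> sqrt ((c1 * sqrt c2 / K)\<^sup>2 * r)"
      proof (rule real_sqrt_le_mono)
        have "ee * r \<le> (c1 * sqrt c2 / K)\<^sup>2 * r" using r by (intro mult_right_mono) (auto simp: ee_def)
        then show "real k powr (\<nu> / \<theta>) \<le> (c1 * sqrt c2 / K)\<^sup>2 * r" using kX[OF k] by linarith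
      qed
      also have "\<dots> = c1 * sqrt c2 / K * sqrt r" using c12 K by (simp add: real_sqrt_mult)
      finally have "real k powr (- h) * K \<le> c1 * sqrt c2 * sqrt r" using K by (simp add: field_simps)
      then have "real k powr (- h) * K * real k powr h \<le> c1 * sqrt c2 * sqrt r * real k powr h"
        by (intro mult_right_mono) auto
      moreover have "real k powr (- h) * K * real k powr h = K" using k1 by (simp add: powr_minus)
      ultimately show ?thesis by simp
    qed
    have small: "K\<^sup>2 * L\<^sup>2 * ?m k \<le> r" if k: "k0 \<le> k" "k \<le> j" for k
    proof -
      have "real k powr (2 * e / \<theta>) \<le> real k powr (\<nu> / \<theta>)"
        using nu th k k0 by (intro powr_mono divide_right_mono) auto
      also have "\<dots> \<le> ee * r" by (rule kX[OF k])
      also have "\<dots> \<le> 1 / (K\<^sup>2 * L\<^sup>2 * c2) * r" using r by (intro mult_right_mono) (auto simp: ee_def)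
      finally have "K\<^sup>2 * L\<^sup>2 * c2 * real k powr (2 * e / \<theta>) \<le> K\<^sup>2 * L\<^sup>2 * c2 * (1 / (K\<^sup>2 * L\<^sup>2 * c2) * r)"
        using K L c12 by (intro mult_left_mono) auto
      also have "\<dots> = r" using K L c12 by simp
      finally show ?thesis by (simp add: mult.assoc)
    qed
    have "(\<Sum>k=k0..j. (b k - a k) * sqrt (r * ?m k) / (2 * K)) \<le> real (kappa (ham_of phi) c r)"
    proof (rule kappa_lower_blocks[OF c r0 j(1) L eps K, where a = a and b = b and m = ?m and phi' = phi'])
      fix k assume k: "k0 \<le> k" "k \<le> j"
      have k1: "real k > 0" using k k0 by simp
      have "0 < c1 * real k powr (- (\<theta> + 1) / \<theta>)" using c12 k1 by simp
      then have "a k < b k" using len[OF k(1)] by linarith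
      then show "0 < a k \<and> a k < b k \<and> b k < 1 \<and> 0 < ?m k"
        using ab[OF k(1)] c12 k1 by auto
      show "K \<le> (b k - a k) * sqrt (r * ?m k)" using long[OF k] T[OF k(1)] by linarith
      show "(phi has_real_derivative phi' t) (at t)" if "a k \<le> t" for t using d[of t] ab[OF k(1)] that by simp
    qed (use ord bd small in auto)
    moreover have "C * sqrt r * (\<Sum>k=k0..j. real k powr h) \<le> (\<Sum>k=k0..j. (b k - a k) * sqrt (r * ?m k) / (2 * K))"
      unfolding sum_distrib_left
    proof (rule sum_mono)
      fix k assume "k \<in> {k0..j}"
      then have "c1 * sqrt c2 * sqrt r * real k powr h / (2 * K) \<le> (b k - a k) * sqrt (r * ?m k) / (2 * K)"
        using T[of k] K by (intro divide_right_mono) auto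
      then show "C * sqrt r * real k powr h \<le> (b k - a k) * sqrt (r * ?m k) / (2 * K)"
        by (simp add: C_def)
    qed
    ultimately show ?thesis by linarith
  qed
  then show ?thesis using that[OF C ee] unfolding h_def by blast
qed

text \<open>The blocks are the sets where t^(-\<beta>) lies in {2 pi k..2 pi k + pi/3}, so that its
  cosine is at least 1/2. There -\<beta> cos dominates the bracket of \<open>osc_deriv\<close>; the
  choice of k0 makes the term with \<gamma> at most \<beta>/4 in absolute value.\<close>

lemma osc_blocks_pos:
  assumes be: "\<beta> > 0" and e: "2 * e = \<beta> - \<gamma> + 1" "e > 0"
  obtains k0 c1 c2 L and a b :: "nat \<Rightarrow> real" where "k0 \<ge> 1" "c1 > 0" "c2 > 0" "L \<ge> 1"
    "\<And>k. k \<ge> k0 \<Longrightarrow> 0 < a k \<and> b k < 1" "\<And>k. k \<ge> k0 \<Longrightarrow> b (Suc k) \<le> a k"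
    "\<And>k. k \<ge> k0 \<Longrightarrow> c1 * real k powr (- (\<beta> + 1) / \<beta>) \<le> b k - a k"
    "\<And>k t. k \<ge> k0 \<Longrightarrow> a k \<le> t \<Longrightarrow> t \<le> b k \<Longrightarrow>
      c2 * real k powr (2 * e / \<beta>) \<le> - 1 * osc_deriv \<gamma> \<beta> t \<and> - 1 * osc_deriv \<gamma> \<beta> t \<le> L * (c2 * real k powr (2 * e / \<beta>))"
proof -
  define k0 where "k0 = nat \<lceil>4 * \<bar>\<gamma>\<bar> / \<beta>\<rceil> + 1"
  define a b where "a k = (2 * pi * real k + pi / 3) powr (- 1 / \<beta>)" and "b k = (2 * pi * real k) powr (- 1 / \<beta>)" for k
  define c1 where "c1 = pi / (3 * \<beta>) * (4 * pi) powr (- 1 / \<beta> - 1)"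
  define s where "s = 2 * e / \<beta>"
  define c2 where "c2 = \<beta> / 4 * (2 * pi) powr s"
  \<comment> \<open>The negated bracket varies between \<beta>/4 and 5 \<beta>/4, and x between 2 pi
    k and 4 pi k; hence the factors 5 and 2^s.\<close>
  define L where "L = 5 * 2 powr s"
  have s: "s > 0" using e be by (simp add: s_def)
  have kp: "k \<ge> 1" "real k \<ge> 1" "2 * pi * real k > 1" if "k \<ge> k0" for k
  proof -
    show "k \<ge> 1" using that by (simp add: k0_def)
    then show "real k \<ge> 1" by simp
    then have "2 * pi * 1 \<le> 2 * pi * real k" by (intro mult_left_mono) auto
    then show "2 * pi * real k > 1" using pi_gt3 by linarith
  qed
  show ?thesis
  proof (rule that[of k0 c1 c2 L a b])
    show "k0 \<ge> 1" by (simp add: k0_def)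
    show "c1 > 0" "c2 > 0" using be by (auto simp: c1_def c2_def)
    have "1 \<le> 2 powr s" using s by (intro ge_one_powr_ge_zero) auto
    then show "L \<ge> 1" by (simp add: L_def)
    fix k assume k: "k \<ge> k0"
    note kp = kp[OF k]
    have kp3: "0 < 2 * pi * real k + pi / 3" using kp pi_gt_zero by linarith
    have "b k < 1 powr (- 1 / \<beta>)" unfolding b_def using kp be by (intro powr_less_mono2_neg) auto
    then show "0 < a k \<and> b k < 1" using kp3 by (auto simp: a_def)
    show "b (Suc k) \<le> a k" unfolding a_def b_def using kp be pi_gt_zero
      by (intro powr_mono2') (auto simp: algebra_simps add_pos_pos)
    show "c1 * real k powr (- (\<beta> + 1) / \<beta>) \<le> b k - a k"
    proof -
      let ?x = "2 * pi * real k" and ?q = "- 1 / \<beta>"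
      \<comment> \<open>Mean value bound: |d/dx x^(-1/\<beta>)| decreases in x, and every x
        considered is at most 4 pi k.\<close>
      define M where "M = 1 / \<beta> * (4 * pi * real k) powr (?q - 1)"
      have "M * (?x + pi / 3) - M * ?x \<le> (- ((?x + pi / 3) powr ?q)) - (- (?x powr ?q))"
      proof (rule mono_on_interior_derivative[where f' = "\<lambda>_. M" and g' = "\<lambda>x. - (?q * x powr (?q - 1))"])
        fix x assume x: "?x < x" "x < ?x + pi / 3"
        then have xp: "0 < x" using kp by linarith
        show "((\<lambda>x. - (x powr ?q)) has_real_derivative - (?q * x powr (?q - 1))) (at x)"
          using xp by (intro DERIV_minus has_real_derivative_powr)
        have "pi * 1 \<le> pi * real k" using kp by (intro mult_left_mono) auto
        then have "x \<le> 4 * pi * real k" using x pi_gt_zero by linarith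
        then have "(4 * pi * real k) powr (?q - 1) \<le> x powr (?q - 1)"
          using xp be divide_nonneg_nonneg[of 1 \<beta>] by (intro powr_mono2') (simp_all add: field_simps)
        then have "1 / \<beta> * (4 * pi * real k) powr (?q - 1) \<le> 1 / \<beta> * x powr (?q - 1)"
          using be by (intro mult_left_mono) auto
        then show "M \<le> - (?q * x powr (?q - 1))" by (simp add: M_def)
      next
        show "continuous_on {?x..?x + pi / 3} (\<lambda>x. - (x powr ?q))"
          using kp by (intro continuous_intros) auto
      qed (auto intro!: continuous_intros derivative_eq_intros)
      moreover have "M * (?x + pi / 3) - M * ?x = c1 * real k powr (- (\<beta> + 1) / \<beta>)"
      proof -
        have q: "- (\<beta> + 1) / \<beta> = ?q - 1" using be by (simp add: field_simps)
        have "M * (?x + pi / 3) - M * ?x = M * (pi / 3)" by (simp add: algebra_simps)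
        also have "\<dots> = c1 * real k powr (?q - 1)" using kp by (simp add: M_def c1_def powr_mult mult_ac)
        finally show ?thesis unfolding q .
      qed
      ultimately show ?thesis by (simp add: a_def b_def)
    qed
    fix t assume t: "a k \<le> t" "t \<le> b k"
    have ap: "0 < a k" using kp3 by (auto simp: a_def)
    then have tp: "0 < t" using t by linarith
    define x where "x = t powr (- \<beta>)"
    have "b k powr (- \<beta>) \<le> x" "x \<le> a k powr (- \<beta>)"
      unfolding x_def using t tp ap be by (auto intro!: powr_mono2')
    then have x: "2 * pi * real k \<le> x" "x \<le> 2 * pi * real k + pi / 3"
      using kp kp3 be by (auto simp: a_def b_def powr_powr)
    have cosx: "1 / 2 \<le> cos x"
    proof -
      have "cos x = cos ((x - 2 * pi * real k) + of_nat k * (2 * pi))" by (simp add: algebra_simps)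
      also have "\<dots> = cos (x - 2 * pi * real k)" using cos.plus_of_nat[of "x - 2 * pi * real k" k] by simp
      also have "\<dots> \<ge> cos (pi / 3)" using x pi_gt_zero by (intro cos_monotone_0_pi_le) auto
      finally show ?thesis by (simp add: cos_60)
    qed
    have gk: "\<bar>\<gamma>\<bar> / x \<le> \<beta> / 4"
    proof -
      have "4 * \<bar>\<gamma>\<bar> / \<beta> \<le> real k0" unfolding k0_def by linarith
      also have "\<dots> \<le> real k" using k by simp
      also have "\<dots> \<le> x"
      proof -
        have "1 * real k \<le> 2 * pi * real k" using pi_gt3 kp by (intro mult_right_mono) auto
        then show ?thesis using x by linarith
      qed
      finally show ?thesis using be x kp by (simp add: field_simps)
    qed
    have tb: "t powr \<beta> = 1 / x" using tp by (simp add: x_def powr_minus field_simps)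
    have xp: "x > 0" using x kp by linarith
    have "\<bar>\<gamma> * t powr \<beta> * sin x\<bar> = \<bar>\<gamma>\<bar> / x * \<bar>sin x\<bar>" using xp by (simp add: tb abs_mult)
    also have "\<dots> \<le> \<bar>\<gamma>\<bar> / x * 1" using xp by (intro mult_left_mono) auto
    finally have g1: "\<bar>\<gamma> * t powr \<beta> * sin x\<bar> \<le> \<beta> / 4" using gk by linarith
    define Br where "Br = \<beta> * cos x - \<gamma> * t powr \<beta> * sin x"
    have "\<beta> * (1 / 2) \<le> \<beta> * cos x" "\<beta> * cos x \<le> \<beta> * 1" using cosx be by (auto intro!: mult_left_mono)
    then have Br: "\<beta> / 4 \<le> Br" "Br \<le> 5 * \<beta> / 4" using g1 unfolding Br_def by linarith+
    have D: "- 1 * osc_deriv \<gamma> \<beta> t = x powr s * Br"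
    proof -
      have "x powr s = t powr (\<gamma> - \<beta> - 1)" using be e by (simp add: x_def s_def powr_powr)
      then show ?thesis unfolding osc_deriv_def Br_def x_def[symmetric] by (simp add: algebra_simps)
    qed
    have xs: "(2 * pi * real k) powr s \<le> x powr s" using x kp s by (intro powr_mono2) auto
    have "pi * 1 \<le> pi * real k" using kp by (intro mult_left_mono) auto
    then have "x \<le> 4 * pi * real k" using x pi_gt_zero by linarith
    then have xs2: "x powr s \<le> (4 * pi * real k) powr s" using xp s by (intro powr_mono2) auto
    have "c2 * real k powr s = (2 * pi * real k) powr s * (\<beta> / 4)"
      using kp by (simp add: c2_def powr_mult)
    also have "\<dots> \<le> x powr s * Br" using xs Br be by (intro mult_mono) auto
    finally have l: "c2 * real k powr s \<le> x powr s * Br" .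
    have "x powr s * Br \<le> (4 * pi * real k) powr s * (5 * \<beta> / 4)" using xs2 Br be by (intro mult_mono) auto
    also have "\<dots> = L * (c2 * real k powr s)"
    proof -
      have "(4::real) powr s = 2 powr s * 2 powr s" using powr_mult[of 2 2 s] by simp
      then show ?thesis using kp by (simp add: L_def c2_def powr_mult)
    qed
    finally show "c2 * real k powr (2 * e / \<beta>) \<le> - 1 * osc_deriv \<gamma> \<beta> t \<and> - 1 * osc_deriv \<gamma> \<beta> t \<le> L * (c2 * real k powr (2 * e / \<beta>))"
      using l unfolding D s_def by blast
  qed
qed

text \<open>For \<beta> <= 0 the sine does not oscillate, as its argument u = t^(-\<beta>) stays in
  {0..1}. But e >= 1 means \<gamma> <= \<beta> - 1, so phi itself comes down from infinity at the
  rate t^(-2e), and consecutive intervals between reciprocals of integers serve as blocks, with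
  \<theta> = 1.\<close>

lemma osc_blocks_nonpos:
  assumes be: "\<beta> \<le> 0" and e: "2 * e = \<beta> - \<gamma> + 1" "e \<ge> 1"
  obtains c1 c2 L and a b :: "nat \<Rightarrow> real" where "c1 > 0" "c2 > 0" "L \<ge> 1"
    "\<And>k. k \<ge> 2 \<Longrightarrow> 0 < a k \<and> b k < 1" "\<And>k. k \<ge> 2 \<Longrightarrow> b (Suc k) \<le> a k"
    "\<And>k. k \<ge> 2 \<Longrightarrow> c1 * real k powr (- (1 + 1) / 1) \<le> b k - a k"
    "\<And>k t. k \<ge> 2 \<Longrightarrow> a k \<le> t \<Longrightarrow> t \<le> b k \<Longrightarrow>
      c2 * real k powr (2 * e / 1) \<le> - 1 * osc_deriv \<gamma> \<beta> t \<and> - 1 * osc_deriv \<gamma> \<beta> t \<le> L * (c2 * real k powr (2 * e / 1))"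
proof -
  define \<delta> where "\<delta> = \<beta> - \<gamma>"
  have de: "\<delta> \<ge> 1" "2 * e = \<delta> + 1" "- \<gamma> \<ge> \<delta>" using e be by (auto simp: \<delta>_def)
  define L where "L = - \<gamma> * 2 powr (2 * e) / (\<delta> / 2)"
  show ?thesis
  proof (rule that[of "1/2" "\<delta> / 2" L "\<lambda>k. 1 / (real k + 1)" "\<lambda>k. 1 / real k"])
    show "0 < \<delta> / 2" using de by simp
    have "1 * (\<delta> / 2) \<le> 2 powr (2 * e) * (- \<gamma>)"
      using e de by (intro mult_mono ge_one_powr_ge_zero) auto
    then have "1 * (\<delta> / 2) \<le> - \<gamma> * 2 powr (2 * e)" by (simp add: mult.commute)
    then show "L \<ge> 1" unfolding L_def using de by (intro iffD2[OF pos_le_divide_eq]) auto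
    fix k :: nat assume k: "k \<ge> 2"
    show "0 < 1 / (real k + 1) \<and> 1 / real k < 1" using k by auto
    have "real k * (real k + 1) \<le> 2 * (real k * real k)" using k by simp
    then have "1 / (2 * (real k * real k)) \<le> 1 / (real k * (real k + 1))" using k by (intro divide_left_mono) auto
    also have "\<dots> = 1 / real k - 1 / (real k + 1)" using k by (simp add: field_simps)
    finally show "1 / 2 * real k powr (- (1 + 1) / 1) \<le> 1 / real k - 1 / (real k + 1)"
      using k by (simp add: powr_minus powr_numeral power2_eq_square field_simps)
    fix t assume t: "1 / (real k + 1) \<le> t" "t \<le> 1 / real k"
    have "0 < 1 / (real k + 1)" by simp
    then have tp: "0 < t" using t by linarith
    have "1 / real k \<le> 1" using k by simp
    then have t1: "t \<le> 1" using t by linarith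
    define u where "u = t powr (- \<beta>)"
    have u: "0 < u" "u \<le> 1" using tp t1 be by (auto simp: u_def intro!: powr_le1)
    have tb: "t powr \<beta> = 1 / u" using tp by (simp add: u_def powr_minus field_simps)
    have "cos (pi / 3) \<le> cos u" using u pi_gt3 by (intro cos_monotone_0_pi_le) auto
    then have cosu: "1 / 2 \<le> cos u" by (simp add: cos_60)
    have "0 - 0 \<le> (sin u - u * cos u) - (sin 0 - 0 * cos 0)"
    proof (rule mono_on_interior_derivative[where f = "\<lambda>_. 0" and f' = "\<lambda>_. 0" and g' = "\<lambda>x. x * sin x" and g = "\<lambda>x. sin x - x * cos x"])
      fix x assume x: "0 < x" "x < u"
      show "((\<lambda>x. sin x - x * cos x) has_real_derivative x * sin x) (at x)"
        by (auto intro!: derivative_eq_intros)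
      show "0 \<le> x * sin x" using x u pi_gt3 by (intro mult_nonneg_nonneg sin_ge_zero) auto
    qed (use u in \<open>auto intro!: continuous_intros\<close>)
    then have su: "cos u \<le> sin u / u" using u by (simp add: field_simps)
    have su1: "sin u / u \<le> 1" using u sin_x_le_x[of u] by simp
    \<comment> \<open>\<open>Br\<close> is the negated bracket of \<open>osc_deriv\<close>; by cos u
      <= sin u / u <= 1 it lies between (\<beta> - \<gamma>) cos u and -\<gamma>.\<close>
    define Br where "Br = - \<gamma> * (sin u / u) + \<beta> * cos u"
    have "\<delta> / 2 \<le> \<delta> * cos u" using cosu de by simp
    also have "\<dots> = - \<gamma> * cos u + \<beta> * cos u" by (simp add: \<delta>_def algebra_simps)
    also have "\<dots> \<le> Br" unfolding Br_def using su de by (intro add_right_mono mult_left_mono) auto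
    finally have Br1: "\<delta> / 2 \<le> Br" .
    have "- \<gamma> * (sin u / u) \<le> - \<gamma> * 1" using su1 de by (intro mult_left_mono) auto
    moreover have "\<beta> * cos u \<le> 0" using be cosu by (intro mult_nonpos_nonneg) auto
    ultimately have Br2: "Br \<le> - \<gamma>" unfolding Br_def by linarith
    have D: "- 1 * osc_deriv \<gamma> \<beta> t = t powr (- (2 * e)) * Br"
    proof -
      have "\<gamma> - \<beta> - 1 = - (2 * e)" using e by simp
      moreover have "\<gamma> * (1 / u) * sin u - \<beta> * cos u = - Br" by (simp add: Br_def)
      ultimately show ?thesis unfolding osc_deriv_def u_def[symmetric] tb by simp
    qed
    have "(1 / real k) powr (- (2 * e)) \<le> t powr (- (2 * e))" "t powr (- (2 * e)) \<le> (1 / (real k + 1)) powr (- (2 * e))"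
      using t tp e by (auto intro!: powr_mono2')
    then have ts: "real k powr (2 * e) \<le> t powr (- (2 * e))" "t powr (- (2 * e)) \<le> (real k + 1) powr (2 * e)"
      using k by (auto simp: powr_divide powr_minus field_simps)
    have "(real k + 1) powr (2 * e) \<le> (2 * real k) powr (2 * e)" using k e by (intro powr_mono2) auto
    then have ts3: "t powr (- (2 * e)) \<le> 2 powr (2 * e) * real k powr (2 * e)" using ts k by (simp add: powr_mult)
    have "\<delta> / 2 * real k powr (2 * e) \<le> Br * t powr (- (2 * e))" using ts Br1 de by (intro mult_mono) auto
    moreover have "Br * t powr (- (2 * e)) \<le> - \<gamma> * (2 powr (2 * e) * real k powr (2 * e))"
      using ts3 Br1 Br2 de by (intro mult_mono) auto
    moreover have "- \<gamma> * (2 powr (2 * e) * real k powr (2 * e)) = L * (\<delta> / 2 * real k powr (2 * e))"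
      using de by (simp add: L_def)
    ultimately show "\<delta> / 2 * real k powr (2 * e / 1) \<le> - 1 * osc_deriv \<gamma> \<beta> t \<and> - 1 * osc_deriv \<gamma> \<beta> t \<le> L * (\<delta> / 2 * real k powr (2 * e / 1))"
      unfolding D by (simp add: mult.commute)
  qed (auto simp: add.commute)
qed

section \<open>Elementary growth comparisons\<close>

lemma eventually_le_powr:
  assumes "p > 0" shows "eventually (\<lambda>r::real. D \<le> r powr p) at_top"
  using eventually_ge_at_top[of "exp (D / p)"]
proof eventually_elim
  case (elim r)
  have r: "r > 0" using elim exp_gt_zero[of "D / p"] by linarith
  have "D / p \<le> ln r" using ln_mono[of "exp (D / p)" r] elim by simp
  then have "D \<le> p * ln r" using assms by (simp add: pos_divide_le_eq mult.commute)
  also have "\<dots> \<le> exp (p * ln r)" using exp_ge_add_one_self[of "p * ln r"] by linarith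
  also have "\<dots> = r powr p" using r by (simp add: powr_def)
  finally show ?case .
qed

lemma eventually_le_ln: "eventually (\<lambda>r::real. D \<le> ln r) at_top"
  using eventually_ge_at_top[of "exp D"]
  by eventually_elim (metis exp_gt_zero ln_exp ln_mono)

lemma eventually_ln_le_sqrt:
  assumes "\<epsilon> > 0" "A \<ge> 0" shows "eventually (\<lambda>r. A * ln r + D \<le> \<epsilon> * sqrt r) at_top"
proof -
  have "(0::real) < 1/4" by simp
  from eventually_le_powr[OF this, of "(4 * A + \<bar>D\<bar>) / \<epsilon>"] eventually_ge_at_top[of 1]
  show ?thesis
  proof eventually_elim
    case (elim r)
    let ?x = "r powr (1/4)"
    have x1: "1 \<le> ?x" using elim by (intro ge_one_powr_ge_zero) auto
    have "A * ln r \<le> A * (4 * ?x)" using ln_powr_bound[of r "1/4"] elim assms by (intro mult_left_mono) auto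
    moreover have "\<bar>D\<bar> \<le> \<bar>D\<bar> * ?x" using x1 by (simp add: mult_le_cancel_left1)
    ultimately have "A * ln r + D \<le> (4 * A + \<bar>D\<bar>) * ?x" by (simp add: algebra_simps)
    also have "\<dots> \<le> (\<epsilon> * ?x) * ?x"
      using elim assms x1 by (intro mult_right_mono) (auto simp: pos_divide_le_eq mult.commute)
    also have "\<dots> = \<epsilon> * sqrt r" using elim by (simp add: mult.assoc powr_half_sqrt[symmetric] flip: powr_add)
    finally show ?case .
  qed
qed

text \<open>The exclusion of \<gamma> = \<beta> = 0, where the angle is constant, enters here. For
  \<beta> > 0 the phase t^(-\<beta>) takes the values pi and pi/2, at which only one term of the
  bracket survives.\<close>

lemma osc_deriv_nonzero:
  assumes "(\<gamma>, \<beta>) \<noteq> (0, 0)" obtains t where "0 < t" "t < 1" "osc_deriv \<gamma> \<beta> t \<noteq> 0"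
proof -
  consider "\<beta> = 0" | "\<beta> > 0" | "\<beta> < 0" by linarith
  then show ?thesis
  proof cases
    case 1
    have "sin (1::real) > 0" using pi_gt3 by (intro sin_gt_zero) auto
    then show ?thesis using 1 assms by (intro that[of "1/2"]) (auto simp: osc_deriv_def)
  next
    case 2
    define x where "x = (if \<gamma> = 0 then pi else pi / 2)"
    have x: "x > 1" using pi_gt3 by (simp add: x_def)
    define t where "t = x powr (- 1 / \<beta>)"
    have "t < 1 powr (- 1 / \<beta>)" unfolding t_def using x 2 by (intro powr_less_mono2_neg) auto
    then have t: "0 < t" "t < 1" using x by (auto simp: t_def)
    have tx: "t powr (- \<beta>) = x" using x 2 by (simp add: t_def powr_powr)
    have "osc_deriv \<gamma> \<beta> t \<noteq> 0"
      unfolding osc_deriv_def tx using t 2 by (auto simp: x_def)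
    with t show ?thesis by (rule that)
  next
    case 3
    define T where "T u = u powr (- 1 / \<beta>)" for u :: real
    have T: "0 < T u" "T u < 1" "T u powr (- \<beta>) = u" "T u powr \<beta> = 1 / u" if "0 < u" "u < 1" for u
    proof -
      have "T u < 1 powr (- 1 / \<beta>)" unfolding T_def using that 3 by (intro powr_less_mono2) auto
      then show "T u < 1" by simp
      show "0 < T u" "T u powr (- \<beta>) = u" using that 3 by (auto simp: T_def powr_powr)
      have "T u powr \<beta> = u powr (- 1)" using that 3 by (simp add: T_def powr_powr)
      then show "T u powr \<beta> = 1 / u" using that by (simp add: powr_minus inverse_eq_divide)
    qed
    show ?thesis
    proof (rule ccontr)
      assume "\<not> thesis"
      then have zero: "osc_deriv \<gamma> \<beta> (T u) = 0" if "0 < u" "u < 1" for u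
        using that T[OF that] \<open>(\<And>t. 0 < t \<Longrightarrow> t < 1 \<Longrightarrow> osc_deriv \<gamma> \<beta> t \<noteq> 0 \<Longrightarrow> thesis)\<close> by blast
      have eq: "\<gamma> * sin u = \<beta> * u * cos u" if "0 < u" "u < 1" for u
        using zero[OF that] T[OF that] that by (simp add: osc_deriv_def field_simps)
      \<comment> \<open>The identity \<gamma> sin u = \<beta> u cos u at u = 1/2, expanded by the
        double angle formulas, is incompatible with the one at u = 1/4 unless \<beta> = 0.\<close>
      have e2: "\<gamma> * (2 * sin (1/4) * cos (1/4)) = \<beta> * (1/2) * ((cos (1/4))\<^sup>2 - (sin (1/4))\<^sup>2)"
        using eq[of "1/2"] sin_double[of "1/4::real"] cos_double[of "1/4::real"] by simp
      have e4: "\<gamma> * sin (1/4) = \<beta> * (1/4) * cos (1/4)" using eq[of "1/4"] by simp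
      have "\<gamma> * (2 * sin (1/4) * cos (1/4)) = 2 * (\<gamma> * sin (1/4)) * cos (1/4)" by simp
      also have "\<dots> = \<beta> * (1/2) * (cos (1/4))\<^sup>2" unfolding e4 by (simp add: power2_eq_square)
      finally have "\<beta> * (sin (1/4))\<^sup>2 = 0" using e2 by (simp add: algebra_simps)
      moreover have "sin (1/4::real) > 0" using pi_gt3 by (intro sin_gt_zero) auto
      ultimately show False using 3 by simp
    qed
  qed
qed

text \<open>A single block around a point with phi' \<noteq> 0 holds of order sqrt r steps. On it
  |phi'| lies between m and 3 m, where 2 m is the value at the centre; hence L = 3.\<close>

lemma osc_kappa_ge_sqrt:
  assumes "(\<gamma>, \<beta>) \<noteq> (0, 0)" and c: "c > 0"
  shows "\<exists>C>0. eventually (\<lambda>r. C * sqrt r \<le> real (kappa (ham_of (osc \<gamma> \<beta>)) c r)) at_top"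
proof -
  interpret angle "osc \<gamma> \<beta>" by (rule osc_angle)
  obtain t0 where t0: "0 < t0" "t0 < 1" "osc_deriv \<gamma> \<beta> t0 \<noteq> 0" using osc_deriv_nonzero[OF assms(1)] .
  let ?D = "osc_deriv \<gamma> \<beta>"
  have "isCont ?D t0" unfolding osc_deriv_def using t0 by (auto intro!: continuous_intros)
  then obtain d where d: "d > 0" "\<And>t. \<bar>t - t0\<bar> < d \<Longrightarrow> \<bar>?D t - ?D t0\<bar> < \<bar>?D t0\<bar> / 2"
    unfolding continuous_at_eps_delta using t0 by (metis dist_real_def half_gt_zero zero_less_abs_iff)
  define h where "h = min d (min t0 (1 - t0)) / 2"
  have h: "0 < h" "h < d" "h < t0" "h < 1 - t0" using d t0 by (auto simp: h_def)
  define m where "m = \<bar>?D t0\<bar> / 2"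
  have m: "m > 0" using t0 by (simp add: m_def)
  define K where "K = sqrt (sqrt (324 * c))"
  have K: "K > 0" "K ^ 4 = 324 * c"
  proof -
    show "K > 0" using c by (simp add: K_def)
    have "K ^ 4 = (K\<^sup>2)\<^sup>2" by simp
    then show "K ^ 4 = 324 * c" using c by (simp only: K_def real_sqrt_pow2_iff) simp
  qed
  define C where "C = 2 * h * sqrt m / (2 * K)"
  have C: "C > 0" using h m K by (simp add: C_def)
  have "eventually (\<lambda>r. C * sqrt r \<le> real (kappa (ham_of (osc \<gamma> \<beta>)) c r)) at_top"
    using eventually_ge_at_top[of "K\<^sup>2 * 3\<^sup>2 * m"] eventually_ge_at_top[of "(K / (2 * h * sqrt m))\<^sup>2"]
      eventually_gt_at_top[of 0]
  proof eventually_elim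
    case (elim r)
    have "K / (2 * h * sqrt m) \<le> sqrt r" using elim(2) h m K by (simp add: real_le_rsqrt)
    then have long: "K \<le> 2 * h * sqrt (r * m)" using h m by (simp add: field_simps real_sqrt_mult)
    have "(\<Sum>k=0..0::nat. ((t0 + h) - (t0 - h)) * sqrt (r * m) / (2 * K)) \<le> real (kappa (ham_of (osc \<gamma> \<beta>)) c r)"
    proof (rule kappa_lower_blocks[OF c elim(3) _ _ _ K, where a = "\<lambda>_. t0 - h" and b = "\<lambda>_. t0 + h" and m = "\<lambda>_. m"
          and L = 3 and phi' = ?D and eps = "sgn (?D t0)"])
      show "\<bar>sgn (?D t0)\<bar> = 1" using t0 by (simp add: abs_sgn_eq)
      fix t assume t: "t0 - h \<le> t" "t \<le> t0 + h"
      show "(osc \<gamma> \<beta> has_real_derivative ?D t) (at t)" using osc_has_derivative[of t] t h by simp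
      have "\<bar>t - t0\<bar> < d" using t h by linarith
      from d(2)[OF this] show "m \<le> sgn (?D t0) * ?D t \<and> sgn (?D t0) * ?D t \<le> 3 * m"
        by (auto simp: m_def sgn_real_def abs_if split: if_splits)
    qed (use h m long elim in auto)
    then show ?case by (simp add: C_def real_sqrt_mult mult_ac)
  qed
  with C show ?thesis by blast
qed

text \<open>\<theta> is \<beta> for oscillating blocks and 1 otherwise. In the first case 2 \<theta>
  + 2 - 2e = 2e + 2 \<gamma>, in the second 4 - 2e <= 2e, so that \<nu> meets both conditions of the
  packing.\<close>

lemma osc_kappa_lower_sum:
  assumes c: "c > 0" and e: "2 * e = \<beta> - \<gamma> + 1" "e \<ge> 1" and nu: "\<nu> = 2 * e + 2 * max \<gamma> 0"
  obtains \<theta> k0 C ee where "\<theta> > 0" "k0 \<ge> 1" "C > 0" "ee > 0"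
    "\<And>r j. r \<ge> 1 \<Longrightarrow> k0 \<le> j \<Longrightarrow> real j powr (\<nu> / \<theta>) \<le> ee * r \<Longrightarrow>
      C * sqrt r * (\<Sum>k=k0..j. real k powr ((e - 1) / \<theta> - 1)) \<le> real (kappa (ham_of (osc \<gamma> \<beta>)) c r)"
proof -
  interpret angle "osc \<gamma> \<beta>" by (rule osc_angle)
  have eps1: "\<bar>- 1 :: real\<bar> = 1" by simp
  show ?thesis
  proof (cases "\<beta> > 0")
    case True
    have e0: "e > 0" using e by simp
    have nus: "\<nu> \<ge> 2 * e" "\<nu> \<ge> 2 * \<beta> + 2 - 2 * e" using nu e by auto
    show ?thesis
    proof (rule osc_blocks_pos[OF True e(1) e0])
      fix k0 c1 c2 L and a b :: "nat \<Rightarrow> real"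
      assume *: "k0 \<ge> 1" "c1 > 0" "c2 > 0" "L \<ge> 1"
        "\<And>k. k \<ge> k0 \<Longrightarrow> 0 < a k \<and> b k < 1" "\<And>k. k \<ge> k0 \<Longrightarrow> b (Suc k) \<le> a k"
        "\<And>k. k \<ge> k0 \<Longrightarrow> c1 * real k powr (- (\<beta> + 1) / \<beta>) \<le> b k - a k"
        "\<And>k t. k \<ge> k0 \<Longrightarrow> a k \<le> t \<Longrightarrow> t \<le> b k \<Longrightarrow>
          c2 * real k powr (2 * e / \<beta>) \<le> - 1 * osc_deriv \<gamma> \<beta> t \<and> - 1 * osc_deriv \<gamma> \<beta> t \<le> L * (c2 * real k powr (2 * e / \<beta>))"
      show ?thesis
        by (rule kappa_lower_power_blocks[OF c True *(1-4) eps1 *(5-7) osc_has_derivative *(8) nus])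
          (assumption | fact that[OF True *(1)])+
    qed
  next
    case False
    then have be: "\<beta> \<le> 0" by simp
    have nus: "\<nu> \<ge> 2 * e" "\<nu> \<ge> 2 * 1 + 2 - 2 * e" using nu e by auto
    have k2: "(2::nat) \<ge> 1" by simp
    show ?thesis
    proof (rule osc_blocks_nonpos[OF be e])
      fix c1 c2 L and a b :: "nat \<Rightarrow> real"
      assume *: "c1 > 0" "c2 > 0" "L \<ge> 1"
        "\<And>k. k \<ge> 2 \<Longrightarrow> 0 < a k \<and> b k < 1" "\<And>k. k \<ge> 2 \<Longrightarrow> b (Suc k) \<le> a k"
        "\<And>k. k \<ge> 2 \<Longrightarrow> c1 * real k powr (- (1 + 1) / 1) \<le> b k - a k"
        "\<And>k t. k \<ge> 2 \<Longrightarrow> a k \<le> t \<Longrightarrow> t \<le> b k \<Longrightarrow>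
          c2 * real k powr (2 * e / 1) \<le> - 1 * osc_deriv \<gamma> \<beta> t \<and> - 1 * osc_deriv \<gamma> \<beta> t \<le> L * (c2 * real k powr (2 * e / 1))"
      show ?thesis
        by (rule kappa_lower_power_blocks[OF c zero_less_one k2 *(1-3) eps1 *(4-6) osc_has_derivative *(7) nus])
          (assumption | fact that[OF zero_less_one k2])+
    qed
  qed
qed

text \<open>The sum runs up to the last admissible index, about (ee * r)^(\<theta>/\<nu>). Under t =
  k^(-1/\<theta>) this means t of order r^(-1/\<nu>), the cut-off of the upper bound.\<close>

lemma osc_kappa_ge_antiderivative:
  assumes c: "c > 0" and e: "2 * e = \<beta> - \<gamma> + 1" "e \<ge> 1" and nu: "\<nu> = 2 * e + 2 * max \<gamma> 0"
  obtains \<theta> k0 C ee where "\<theta> > 0" "k0 \<ge> 1" "C > 0" "ee > 0"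
    "\<And>Lam. (\<And>x. 0 < x \<Longrightarrow> (Lam has_real_derivative x powr ((e - 1) / \<theta> - 1)) (at x)) \<Longrightarrow>
      eventually (\<lambda>r. C * sqrt r * (Lam ((ee * r) powr (\<theta> / \<nu>)) - Lam (real k0)) \<le> real (kappa (ham_of (osc \<gamma> \<beta>)) c r)) at_top"
proof -
  have nu0: "\<nu> > 0" using nu e by simp
  show ?thesis
  proof (rule osc_kappa_lower_sum[OF c e nu])
    fix \<theta> k0 C ee
    assume *: "\<theta> > 0" "k0 \<ge> 1" "C > 0" "ee > 0"
    "\<And>r j. r \<ge> 1 \<Longrightarrow> k0 \<le> j \<Longrightarrow> real j powr (\<nu> / \<theta>) \<le> ee * r \<Longrightarrow>
      C * sqrt r * (\<Sum>k=k0..j. real k powr ((e - 1) / \<theta> - 1)) \<le> real (kappa (ham_of (osc \<gamma> \<beta>)) c r)"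
    define f where "f = (e - 1) / \<theta>"
    show ?thesis
    proof (rule that[of \<theta> k0 "C / 2 powr \<bar>f - 1\<bar>" ee])
      fix Lam :: "real \<Rightarrow> real"
      assume "\<And>x. 0 < x \<Longrightarrow> (Lam has_real_derivative x powr ((e - 1) / \<theta> - 1)) (at x)"
      then have d: "\<And>x. 0 < x \<Longrightarrow> (Lam has_real_derivative x powr (f - 1)) (at x)" by (simp add: f_def)
      have "\<theta> / \<nu> > 0" using * nu0 by simp
      from eventually_le_powr[OF this, of "real k0 / ee powr (\<theta> / \<nu>)"] eventually_ge_at_top[of 1]
      show "eventually (\<lambda>r. C / 2 powr \<bar>f - 1\<bar> * sqrt r * (Lam ((ee * r) powr (\<theta> / \<nu>)) - Lam (real k0)) \<le> real (kappa (ham_of (osc \<gamma> \<beta>)) c r)) at_top"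
      proof eventually_elim
        case (elim r)
        define Y where "Y = (ee * r) powr (\<theta> / \<nu>)"
        have Yk: "real k0 \<le> Y" using elim * by (simp add: Y_def powr_mult pos_divide_le_eq mult.commute)
        then have Y1: "1 \<le> Y" using * by linarith
        define j where "j = nat \<lfloor>Y\<rfloor>"
        have j: "real j \<le> Y" "Y \<le> real (Suc j)" using Y1 unfolding j_def by linarith+
        have jk: "k0 \<le> j" using Yk unfolding j_def by (simp add: le_nat_floor)
        have "real j powr (\<nu> / \<theta>) \<le> Y powr (\<nu> / \<theta>)" using j nu0 * by (intro powr_mono2) auto
        also have "\<dots> = ee * r" using * nu0 elim by (simp add: Y_def powr_powr)
        finally have 1: "C * sqrt r * (\<Sum>k=k0..j. real k powr (f - 1)) \<le> real (kappa (ham_of (osc \<gamma> \<beta>)) c r)"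
          unfolding f_def using elim jk by (intro *(5)) auto
        \<comment> \<open>\<open>Lam\<close> increases and Y <= j + 1, so the upper limit Suc j of
          \<open>sum_powr_lower\<close> can be replaced by Y.\<close>
        have "0 - 0 \<le> Lam (real (Suc j)) - Lam Y"
          by (rule mono_on_interior_derivative[where f = "\<lambda>_. 0" and f' = "\<lambda>_. 0" and g' = "\<lambda>x. x powr (f - 1)"])
            (use j Y1 d in \<open>auto intro!: DERIV_continuous_on[OF has_field_derivative_at_within[OF d]]\<close>)
        then have "Lam Y - Lam (real k0) \<le> 2 powr \<bar>f - 1\<bar> * (\<Sum>k=k0..j. real k powr (f - 1))"
          using sum_powr_lower[OF *(2) jk d] by linarith
        then have "(Lam Y - Lam (real k0)) / 2 powr \<bar>f - 1\<bar> \<le> (\<Sum>k=k0..j. real k powr (f - 1))"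
          by (simp add: pos_divide_le_eq mult.commute)
        then have "C * sqrt r * ((Lam Y - Lam (real k0)) / 2 powr \<bar>f - 1\<bar>) \<le> C * sqrt r * (\<Sum>k=k0..j. real k powr (f - 1))"
          using * elim by (intro mult_left_mono) auto
        then show ?case using 1 unfolding Y_def[symmetric] by simp
      qed
    qed (use * in auto)
  qed
qed

section \<open>Asymptotics\<close>

text \<open>The exponent consists of logarithmic losses, the part below t0 and the part above t0;
  \<open>g1\<close> (through sqrt r), \<open>g2\<close> and \<open>g3\<close> let g dominate them in
  this order.\<close>

lemma osc_log_monodromy_upper:
  fixes g :: "real \<Rightarrow> real"
  assumes e: "2 * e = \<beta> - \<gamma> + 1" and nu: "\<nu> \<ge> 2" "\<nu> \<ge> 2 * e"
    and dPsi: "\<And>t. 0 < t \<Longrightarrow> (Psi has_real_derivative t powr (- e)) (at t)" and C: "C \<ge> 0"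
    and g1: "eventually (\<lambda>r. sqrt r \<le> g r) at_top"
    and g2: "eventually (\<lambda>r. r * (r powr (- 1 / \<nu>)) powr (1 + max \<gamma> 0) \<le> g r) at_top"
    and g3: "eventually (\<lambda>r. sqrt r * (Psi 1 - Psi (r powr (- 1 / \<nu>))) \<le> C * g r) at_top"
  shows "\<exists>C'>0. eventually (\<lambda>r. ln (SUP z\<in>sphere 0 r. onorm (\<lambda>x. monodromy (ham_of (osc \<gamma> \<beta>)) z *v x)) \<le> C' * g r) at_top"
proof -
  define A where "A = (1 + 2 * \<bar>e\<bar> + 2 * max \<gamma> 0) / 2"
  define B where "B = (2 * (\<bar>\<gamma>\<bar> + \<bar>\<beta>\<bar>) + 1) / 2"
  have A: "A \<ge> 0" and B: "B \<ge> 0" by (auto simp: A_def B_def)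
  have "eventually (\<lambda>r. ln (SUP z\<in>sphere 0 r. onorm (\<lambda>x. monodromy (ham_of (osc \<gamma> \<beta>)) z *v x)) \<le> (3 + B * C) * g r) at_top"
    using g1 g2 g3 eventually_ln_le_sqrt[OF zero_less_one A, of "ln 4"] eventually_ge_at_top[of 1]
  proof eventually_elim
    case (elim r)
    let ?t = "r powr (- 1 / \<nu>)"
    have "ln (SUP z\<in>sphere 0 r. onorm (\<lambda>x. monodromy (ham_of (osc \<gamma> \<beta>)) z *v x))
      \<le> (A * ln r + ln 4) + 2 * (r * ?t powr (1 + max \<gamma> 0)) + B * (sqrt r * (Psi 1 - Psi ?t))"
      using osc_monodromy_bounds(2)[OF elim(5) e nu dPsi refl refl] by (simp add: A_def B_def field_simps)
    also have "\<dots> \<le> g r + 2 * g r + B * (C * g r)"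
      using elim B by (intro add_mono mult_left_mono) auto
    finally show ?case by (simp add: algebra_simps)
  qed
  moreover have "3 + B * C > 0" using B C by (simp add: add_pos_nonneg)
  ultimately show ?thesis by blast
qed

lemma powr_antiderivative:
  fixes p x :: real
  assumes "x > 0" "p \<noteq> 0" shows "((\<lambda>x. x powr p / p) has_real_derivative x powr (p - 1)) (at x)"
  using DERIV_cdivide[OF has_real_derivative_powr[OF assms(1), of p], of p] assms(2) by simp

text \<open>Here e < 1, so t^(-e) is integrable at 0 and the part above any cut-off costs O(sqrt r).
  The cut-off r^(-1/2) already makes the part below it cost at most sqrt r.\<close>

lemma osc_growth_subcritical:
  assumes nz: "(\<gamma>, \<beta>) \<noteq> (0, 0)" and c: "c > 0" and lt: "\<beta> < \<gamma> + 1"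
  shows "\<exists>C>0. eventually (\<lambda>r. ln (SUP z\<in>sphere 0 r. onorm (\<lambda>x. monodromy (ham_of (osc \<gamma> \<beta>)) z *v x)) \<le> C * r powr (1/2)) at_top"
    and "\<exists>C>0. eventually (\<lambda>r. C * r powr (1/2) \<le> real (kappa (ham_of (osc \<gamma> \<beta>)) c r)) at_top"
proof -
  define e where "e = (\<beta> - \<gamma> + 1) / 2"
  have e: "2 * e = \<beta> - \<gamma> + 1" "e < 1" using lt by (auto simp: e_def)
  show "\<exists>C>0. eventually (\<lambda>r. ln (SUP z\<in>sphere 0 r. onorm (\<lambda>x. monodromy (ham_of (osc \<gamma> \<beta>)) z *v x)) \<le> C * r powr (1/2)) at_top"
  proof (rule osc_log_monodromy_upper[OF e(1), of 2 "\<lambda>t. t powr (1 - e) / (1 - e)" "1 / (1 - e)"])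
    show "((\<lambda>t. t powr (1 - e) / (1 - e)) has_real_derivative t powr (- e)) (at t)" if "0 < t" for t
      using powr_antiderivative[OF that, of "1 - e"] e by simp
    show "eventually (\<lambda>r. sqrt r \<le> r powr (1/2)) at_top"
      using eventually_ge_at_top[of 0] by eventually_elim (simp add: powr_half_sqrt)
    show "eventually (\<lambda>r. r * (r powr (- 1 / 2)) powr (1 + max \<gamma> 0) \<le> r powr (1/2)) at_top"
      using eventually_ge_at_top[of 1]
    proof eventually_elim
      case (elim r)
      have "r * (r powr (- 1 / 2)) powr (1 + max \<gamma> 0) = r powr 1 * r powr (- ((1 + max \<gamma> 0) / 2))"
        using elim by (simp add: powr_powr)
      also have "\<dots> = r powr (1 + - ((1 + max \<gamma> 0) / 2))" by (simp only: powr_add)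
      also have "\<dots> \<le> r powr (1/2)" using elim by (intro powr_mono) (auto simp: field_simps)
      finally show ?case .
    qed
    show "eventually (\<lambda>r. sqrt r * (1 powr (1 - e) / (1 - e) - (r powr (- 1 / 2)) powr (1 - e) / (1 - e)) \<le> 1 / (1 - e) * r powr (1/2)) at_top"
      using eventually_ge_at_top[of 1]
    proof eventually_elim
      case (elim r)
      have "sqrt r * (1 powr (1 - e) / (1 - e) - (r powr (- 1 / 2)) powr (1 - e) / (1 - e)) \<le> sqrt r * (1 / (1 - e))"
        using e elim by (intro mult_left_mono) auto
      then show ?case using elim by (simp add: powr_half_sqrt)
    qed
  qed (use e in auto)
  obtain C where C: "C > 0" "eventually (\<lambda>r. C * sqrt r \<le> real (kappa (ham_of (osc \<gamma> \<beta>)) c r)) at_top"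
    using osc_kappa_ge_sqrt[OF nz c] by blast
  have "eventually (\<lambda>r. C * r powr (1/2) \<le> real (kappa (ham_of (osc \<gamma> \<beta>)) c r)) at_top"
    using C(2) eventually_ge_at_top[of 0] by eventually_elim (simp add: powr_half_sqrt)
  with C(1) show "\<exists>C>0. eventually (\<lambda>r. C * r powr (1/2) \<le> real (kappa (ham_of (osc \<gamma> \<beta>)) c r)) at_top" by blast
qed

text \<open>For e = 1 the antiderivative is ln, and - ln t0 = ln r / \<nu> supplies the logarithm;
  the part below t0 contributes exactly r^(1/2).\<close>

lemma osc_growth_critical:
  assumes c: "c > 0" and eq: "\<beta> = \<gamma> + 1"
  shows "\<exists>C>0. eventually (\<lambda>r. ln (SUP z\<in>sphere 0 r. onorm (\<lambda>x. monodromy (ham_of (osc \<gamma> \<beta>)) z *v x)) \<le> C * (r powr (1/2) * ln r)) at_top"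
    and "\<exists>C>0. eventually (\<lambda>r. C * (r powr (1/2) * ln r) \<le> real (kappa (ham_of (osc \<gamma> \<beta>)) c r)) at_top"
proof -
  have e: "2 * 1 = \<beta> - \<gamma> + 1" "(1::real) \<ge> 1" using eq by auto
  define \<nu> where "\<nu> = 2 * 1 + 2 * max \<gamma> 0"
  have nu: "\<nu> \<ge> 2" by (simp add: \<nu>_def)
  have dln: "(ln has_real_derivative x powr (- 1)) (at x)" if "0 < x" for x :: real
    using DERIV_ln_divide[OF that] that by (simp add: powr_minus inverse_eq_divide)
  show "\<exists>C>0. eventually (\<lambda>r. ln (SUP z\<in>sphere 0 r. onorm (\<lambda>x. monodromy (ham_of (osc \<gamma> \<beta>)) z *v x)) \<le> C * (r powr (1/2) * ln r)) at_top"
  proof (rule osc_log_monodromy_upper[OF e(1), of \<nu> ln 1])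
    have *: "eventually (\<lambda>r. sqrt r \<le> r powr (1/2) * ln r) at_top"
      using eventually_ge_at_top[of 0] eventually_le_ln[of 1]
      by eventually_elim (simp add: powr_half_sqrt mult_le_cancel_left1)
    then show "eventually (\<lambda>r. sqrt r \<le> r powr (1/2) * ln r) at_top" .
    show "eventually (\<lambda>r. r * (r powr (- 1 / \<nu>)) powr (1 + max \<gamma> 0) \<le> r powr (1/2) * ln r) at_top"
      using eventually_ge_at_top[of 1] *
    proof eventually_elim
      case (elim r)
      have "r * (r powr (- 1 / \<nu>)) powr (1 + max \<gamma> 0) = r powr 1 * r powr (- ((1 + max \<gamma> 0) / \<nu>))"
        using elim by (simp add: powr_powr)
      also have "\<dots> = r powr (1 + - ((1 + max \<gamma> 0) / \<nu>))" by (simp only: powr_add)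
      also have "1 + - ((1 + max \<gamma> 0) / \<nu>) = 1 / 2" using nu by (simp add: \<nu>_def field_simps)
      finally show ?case using elim by (simp add: powr_half_sqrt)
    qed
    show "eventually (\<lambda>r. sqrt r * (ln 1 - ln (r powr (- 1 / \<nu>))) \<le> 1 * (r powr (1/2) * ln r)) at_top"
      using eventually_ge_at_top[of 1]
    proof eventually_elim
      case (elim r)
      have "ln r \<ge> 0" using elim by simp
      then have "ln r / \<nu> \<le> ln r" using nu by (simp add: divide_le_eq mult_le_cancel_left1)
      then have "sqrt r * (ln r / \<nu>) \<le> sqrt r * ln r" using elim by (intro mult_left_mono) auto
      then show ?case using elim by (simp add: powr_half_sqrt ln_powr)
    qed
  qed (use nu dln in auto)
  show "\<exists>C>0. eventually (\<lambda>r. C * (r powr (1/2) * ln r) \<le> real (kappa (ham_of (osc \<gamma> \<beta>)) c r)) at_top"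
  proof (rule osc_kappa_ge_antiderivative[OF c e \<nu>_def])
    fix \<theta> k0 C ee
    assume *: "\<theta> > 0" "k0 \<ge> 1" "C > 0" "ee > 0"
      "\<And>Lam. (\<And>x. 0 < x \<Longrightarrow> (Lam has_real_derivative x powr ((1 - 1) / \<theta> - 1)) (at x)) \<Longrightarrow>
        eventually (\<lambda>r. C * sqrt r * (Lam ((ee * r) powr (\<theta> / \<nu>)) - Lam (real k0)) \<le> real (kappa (ham_of (osc \<gamma> \<beta>)) c r)) at_top"
    define q where "q = \<theta> / \<nu>"
    have q: "q > 0" using * nu by (simp add: q_def)
    have "eventually (\<lambda>r. C * sqrt r * (ln ((ee * r) powr q) - ln (real k0)) \<le> real (kappa (ham_of (osc \<gamma> \<beta>)) c r)) at_top"
      unfolding q_def by (rule *(5)) (use dln in simp)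
    then have "eventually (\<lambda>r. (C * (q / 2)) * (r powr (1/2) * ln r) \<le> real (kappa (ham_of (osc \<gamma> \<beta>)) c r)) at_top"
      using eventually_le_ln[of "(ln (real k0) - q * ln ee) / (q / 2)"] eventually_ge_at_top[of 1]
    proof eventually_elim
      case (elim r)
      have "ln ((ee * r) powr q) = q * ln ee + q * ln r" using elim * by (simp add: ln_powr ln_mult algebra_simps)
      moreover have "ln (real k0) - q * ln ee \<le> q / 2 * ln r" using elim q by (simp add: pos_divide_le_eq mult.commute)
      ultimately have "q / 2 * ln r \<le> ln ((ee * r) powr q) - ln (real k0)" by (simp add: algebra_simps)
      then have "C * sqrt r * (q / 2 * ln r) \<le> C * sqrt r * (ln ((ee * r) powr q) - ln (real k0))"
        using * elim by (intro mult_left_mono) auto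
      moreover have "C * sqrt r * (q / 2 * ln r) = C * (q / 2) * (r powr (1/2) * ln r)"
        using elim by (simp add: powr_half_sqrt)
      ultimately show ?case using elim(1) by linarith
    qed
    moreover have "C * (q / 2) > 0" using * q by simp
    ultimately show ?thesis by blast
  qed
qed

text \<open>Here r * t0^(1 + max \<gamma> 0) has the exponent 1 - (1 + max \<gamma> 0)/\<nu>, and
  sqrt r * t0^(1 - e) has 1/2 + (e - 1)/\<nu>. They agree for \<nu> = 2e + 2 max \<gamma> 0, and the
  common value is \<rho>.\<close>

lemma osc_growth_supercritical:
  assumes c: "c > 0" and gt: "\<beta> > \<gamma> + 1"
  defines "\<rho> \<equiv> (if \<gamma> \<ge> 0 then \<beta> / (\<beta> + \<gamma> + 1) else (\<beta> - \<gamma>) / (\<beta> - \<gamma> + 1))"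
  shows "1/2 \<le> \<rho>"
    and "\<exists>C>0. eventually (\<lambda>r. ln (SUP z\<in>sphere 0 r. onorm (\<lambda>x. monodromy (ham_of (osc \<gamma> \<beta>)) z *v x)) \<le> C * r powr \<rho>) at_top"
    and "\<exists>C>0. eventually (\<lambda>r. C * r powr \<rho> \<le> real (kappa (ham_of (osc \<gamma> \<beta>)) c r)) at_top"
proof -
  define e where "e = (\<beta> - \<gamma> + 1) / 2"
  have e: "2 * e = \<beta> - \<gamma> + 1" "e > 1" using gt by (auto simp: e_def)
  have e1: "e \<ge> 1" using e by simp
  define \<nu> where "\<nu> = 2 * e + 2 * max \<gamma> 0"
  have nu: "\<nu> > 2" "\<nu> \<ge> 2 * e" using e by (auto simp: \<nu>_def)
  define p where "p = (e - 1) / \<nu>"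
  have p: "p > 0" using e nu by (simp add: p_def)
  \<comment> \<open>The two formulas for \<rho> correspond to the two values of max \<gamma> 0
    inside \<nu>.\<close>
  have rho: "\<rho> = 1 / 2 + p"
  proof (cases "\<gamma> \<ge> 0")
    case True
    have n: "\<nu> = \<beta> + \<gamma> + 1" using True e by (simp add: \<nu>_def)
    have "1 / 2 + p = (\<nu> + 2 * e - 2) / (2 * \<nu>)" using nu by (simp add: p_def field_simps)
    also have "\<nu> + 2 * e - 2 = 2 * \<beta>" using n e by simp
    finally have "1 / 2 + p = \<beta> / \<nu>" by simp
    then show ?thesis using True n by (simp add: \<rho>_def)
  next
    case False
    have n: "\<nu> = \<beta> - \<gamma> + 1" using False e by (simp add: \<nu>_def)
    have "1 / 2 + p = (\<nu> + 2 * e - 2) / (2 * \<nu>)" using nu by (simp add: p_def field_simps)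
    also have "\<nu> + 2 * e - 2 = 2 * (\<beta> - \<gamma>)" using n e by simp
    finally have "1 / 2 + p = (\<beta> - \<gamma>) / \<nu>" by (simp only: mult_divide_mult_cancel_left_if) simp
    then show ?thesis using False n by (simp add: \<rho>_def)
  qed
  show "1/2 \<le> \<rho>" using rho p by simp
  show "\<exists>C>0. eventually (\<lambda>r. ln (SUP z\<in>sphere 0 r. onorm (\<lambda>x. monodromy (ham_of (osc \<gamma> \<beta>)) z *v x)) \<le> C * r powr \<rho>) at_top"
  proof (rule osc_log_monodromy_upper[OF e(1), of \<nu> "\<lambda>t. t powr (1 - e) / (1 - e)" "1 / (e - 1)"])
    show "((\<lambda>t. t powr (1 - e) / (1 - e)) has_real_derivative t powr (- e)) (at t)" if "0 < t" for t
      using powr_antiderivative[OF that, of "1 - e"] e by simp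
    show "eventually (\<lambda>r. sqrt r \<le> r powr \<rho>) at_top"
      using eventually_ge_at_top[of 1]
    proof eventually_elim
      case (elim r)
      have "r powr (1/2) \<le> r powr \<rho>" using elim rho p by (intro powr_mono) auto
      then show ?case using elim by (simp add: powr_half_sqrt)
    qed
    show "eventually (\<lambda>r. r * (r powr (- 1 / \<nu>)) powr (1 + max \<gamma> 0) \<le> r powr \<rho>) at_top"
      using eventually_ge_at_top[of 1]
    proof eventually_elim
      case (elim r)
      have "r * (r powr (- 1 / \<nu>)) powr (1 + max \<gamma> 0) = r powr 1 * r powr (- ((1 + max \<gamma> 0) / \<nu>))"
        using elim by (simp add: powr_powr)
      also have "\<dots> = r powr (1 + - ((1 + max \<gamma> 0) / \<nu>))" by (simp only: powr_add)
      also have "1 + - ((1 + max \<gamma> 0) / \<nu>) = \<rho>"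
      proof -
        have m: "max \<gamma> 0 = \<nu> / 2 - e" by (simp add: \<nu>_def add_divide_distrib)
        show ?thesis unfolding m rho p_def using nu by (simp add: field_simps)
      qed
      finally show ?case by simp
    qed
    show "eventually (\<lambda>r. sqrt r * (1 powr (1 - e) / (1 - e) - (r powr (- 1 / \<nu>)) powr (1 - e) / (1 - e)) \<le> 1 / (e - 1) * r powr \<rho>) at_top"
      using eventually_ge_at_top[of 1]
    proof eventually_elim
      case (elim r)
      have "- 1 / \<nu> * (1 - e) = p" using nu by (simp add: p_def field_simps)
      then have tp: "(r powr (- 1 / \<nu>)) powr (1 - e) = r powr p" by (simp only: powr_powr)
      have "1 powr (1 - e) / (1 - e) - r powr p / (1 - e) = (r powr p - 1) / (e - 1)"
        using e by (simp add: field_simps)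
      also have "\<dots> \<le> r powr p / (e - 1)" using e by (intro divide_right_mono) auto
      finally have "sqrt r * (1 powr (1 - e) / (1 - e) - r powr p / (1 - e)) \<le> sqrt r * (r powr p / (e - 1))"
        using elim by (intro mult_left_mono) auto
      also have "\<dots> = 1 / (e - 1) * r powr \<rho>" using elim by (simp add: rho powr_add powr_half_sqrt)
      finally show ?case unfolding tp .
    qed
  qed (use e nu in auto)
  show "\<exists>C>0. eventually (\<lambda>r. C * r powr \<rho> \<le> real (kappa (ham_of (osc \<gamma> \<beta>)) c r)) at_top"
  proof (rule osc_kappa_ge_antiderivative[OF c e(1) e1 \<nu>_def])
    fix \<theta> k0 C ee
    assume *: "\<theta> > 0" "k0 \<ge> 1" "C > 0" "ee > 0"
      "\<And>Lam. (\<And>x. 0 < x \<Longrightarrow> (Lam has_real_derivative x powr ((e - 1) / \<theta> - 1)) (at x)) \<Longrightarrow>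
        eventually (\<lambda>r. C * sqrt r * (Lam ((ee * r) powr (\<theta> / \<nu>)) - Lam (real k0)) \<le> real (kappa (ham_of (osc \<gamma> \<beta>)) c r)) at_top"
    define f where "f = (e - 1) / \<theta>"
    have f: "f > 0" using * e by (simp add: f_def)
    define A where "A = ee powr p / f"
    have A: "A > 0" using * f by (simp add: A_def)
    have "eventually (\<lambda>r. C * sqrt r * (((ee * r) powr (\<theta> / \<nu>)) powr f / f - real k0 powr f / f) \<le> real (kappa (ham_of (osc \<gamma> \<beta>)) c r)) at_top"
      by (rule *(5)[of "\<lambda>x. x powr f / f", folded f_def]) (use powr_antiderivative[of _ f] f in auto)
    then have "eventually (\<lambda>r. (C * (A / 2)) * r powr \<rho> \<le> real (kappa (ham_of (osc \<gamma> \<beta>)) c r)) at_top"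
      using eventually_le_powr[OF p, of "(real k0 powr f / f) / (A / 2)"] eventually_ge_at_top[of 1]
    proof eventually_elim
      case (elim r)
      have "\<theta> / \<nu> * f = p" using * nu by (simp add: f_def p_def)
      then have "((ee * r) powr (\<theta> / \<nu>)) powr f / f = A * r powr p"
        using * elim by (simp add: A_def powr_powr powr_mult)
      moreover have "real k0 powr f / f \<le> A / 2 * r powr p"
        using elim(2) A by (simp only: pos_divide_le_eq[of "A / 2"] half_gt_zero) (simp add: mult.commute)
      ultimately have "A / 2 * r powr p \<le> ((ee * r) powr (\<theta> / \<nu>)) powr f / f - real k0 powr f / f" by simp
      then have "C * sqrt r * (A / 2 * r powr p) \<le> C * sqrt r * (((ee * r) powr (\<theta> / \<nu>)) powr f / f - real k0 powr f / f)"
        using * elim by (intro mult_left_mono) auto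
      moreover have "C * sqrt r * (A / 2 * r powr p) = (C * (A / 2)) * r powr \<rho>"
        using elim by (simp add: rho powr_add powr_half_sqrt)
      ultimately show ?case using elim by linarith
    qed
    moreover have "C * (A / 2) > 0" using * A by simp
    ultimately show ?thesis by blast
  qed
qed

text \<open>The estimates form a cycle: CK * g <= k, then q * k <= ln w + ln r + C0, then ln w <= ln
  N <= CU * g. As g >= sqrt r, the terms ln r + C0 are absorbed, and every quantity in the cycle is
  bounded on both sides.\<close>

lemma osc_growth_asymp:
  fixes g :: "real \<Rightarrow> real"
  assumes c: "c > 0" and g1: "eventually (\<lambda>r. sqrt r \<le> g r) at_top"
    and U: "\<exists>C>0. eventually (\<lambda>r. ln (SUP z\<in>sphere 0 r. onorm (\<lambda>x. monodromy (ham_of (osc \<gamma> \<beta>)) z *v x)) \<le> C * g r) at_top"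
    and K: "\<exists>C>0. eventually (\<lambda>r. C * g r \<le> real (kappa (ham_of (osc \<gamma> \<beta>)) c r)) at_top"
  shows "(\<lambda>r. ln (SUP z\<in>sphere 0 r. onorm (\<lambda>x. monodromy (ham_of (osc \<gamma> \<beta>)) z *v x))) \<asymp> g
     \<and> (\<lambda>r. ln (cmod (monodromy (ham_of (osc \<gamma> \<beta>)) (\<i> * complex_of_real r) $ 2 $ 2))) \<asymp> g
     \<and> (\<lambda>r. real (kappa (ham_of (osc \<gamma> \<beta>)) c r)) \<asymp> g"
proof -
  interpret angle "osc \<gamma> \<beta>" by (rule osc_angle)
  define N where "N r = (SUP z\<in>sphere 0 r. onorm (\<lambda>x. monodromy (ham_of (osc \<gamma> \<beta>)) z *v x))" for r
  define w where "w r = cmod (monodromy (ham_of (osc \<gamma> \<beta>)) (\<i> * complex_of_real r) $ 2 $ 2)" for r :: real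
  define k where "k r = real (kappa (ham_of (osc \<gamma> \<beta>)) c r)" for r
  obtain CU where CU: "CU > 0" "eventually (\<lambda>r. ln (N r) \<le> CU * g r) at_top"
    using U unfolding N_def by blast
  obtain CK where CK: "CK > 0" "eventually (\<lambda>r. CK * g r \<le> k r) at_top"
    using K unfolding k_def by blast
  obtain q C0 where q: "q > 0" "\<And>r. r \<ge> 1 \<Longrightarrow> q * k r \<le> ln (w r) + ln r + C0"
    using kappa_le_log_monodromy[OF c] unfolding k_def w_def by metis
  define e where "e = (\<beta> - \<gamma> + 1) / 2"
  have wN: "1 \<le> w r" "w r \<le> N r" if "r \<ge> 1" for r
  proof -
    show "1 \<le> w r" unfolding w_def using norm_monodromy_22_ge_1[of r] that by simp
    have "\<exists>Psi. \<forall>t>0. (Psi has_real_derivative t powr (- e)) (at t)"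
    proof (cases "e = 1")
      case True
      then show ?thesis by (intro exI[of _ ln]) (auto intro!: derivative_eq_intros simp: powr_minus inverse_eq_divide)
    next
      case False
      then show ?thesis using powr_antiderivative[of _ "1 - e"] by (intro exI[of _ "\<lambda>t. t powr (1 - e) / (1 - e)"]) auto
    qed
    then obtain Psi where Psi: "\<And>t. 0 < t \<Longrightarrow> (Psi has_real_derivative t powr (- e)) (at t)" by blast
    show "w r \<le> N r"
      unfolding w_def N_def
      by (rule osc_monodromy_bounds(1)[OF that _ _ _ Psi refl refl, of \<beta> \<gamma> "max 2 (2 * e)"]) (auto simp: e_def)
  qed
  have small: "eventually (\<lambda>r. ln r + C0 \<le> d * g r) at_top" if "d > 0" for d
    using eventually_ln_le_sqrt[OF that zero_le_one, of C0] g1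
  proof eventually_elim
    case (elim r)
    have "d * sqrt r \<le> d * g r" using elim that by (intro mult_left_mono) auto
    then show ?case using elim by simp
  qed
  have lw: "eventually (\<lambda>r. q * CK / 2 * g r \<le> ln (w r)) at_top"
  proof -
    have "q * CK / 2 > 0" using q CK by simp
    from small[OF this] CK(2) eventually_ge_at_top[of 1] show ?thesis
    proof eventually_elim
      case (elim r)
      have "q * (CK * g r) \<le> q * k r" using elim q by (intro mult_left_mono) auto
      then show ?case using q(2)[of r] elim by (simp add: algebra_simps)
    qed
  qed
  have ww: "eventually (\<lambda>r. ln (w r) \<le> ln (N r)) at_top"
    using eventually_ge_at_top[of 1]
  proof eventually_elim
    case (elim r)
    then show ?case using wN[OF elim] by (intro ln_mono) auto
  qed
  have C1: "q * CK / 2 > 0" using q CK by simp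
  have 1: "(\<lambda>r. ln (N r)) \<asymp> g"
    unfolding asymp_eq_def
  proof (intro exI conjI)
    show "eventually (\<lambda>r. q * CK / 2 * g r \<le> ln (N r) \<and> ln (N r) \<le> CU * g r) at_top"
      using lw ww CU(2) by eventually_elim linarith
  qed (use C1 CU in auto)
  have 2: "(\<lambda>r. ln (w r)) \<asymp> g"
    unfolding asymp_eq_def
  proof (intro exI conjI)
    show "eventually (\<lambda>r. q * CK / 2 * g r \<le> ln (w r) \<and> ln (w r) \<le> CU * g r) at_top"
      using lw ww CU(2) by eventually_elim linarith
  qed (use C1 CU in auto)
  have 3: "k \<asymp> g"
    unfolding asymp_eq_def
  proof (intro exI conjI)
    show "eventually (\<lambda>r. CK * g r \<le> k r \<and> k r \<le> (CU + 1) / q * g r) at_top"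
      using CK(2) ww CU(2) small[OF zero_less_one] eventually_ge_at_top[of 1]
    proof eventually_elim
      case (elim r)
      have "q * k r \<le> (CU + 1) * g r" using q(2)[of r] elim by (simp add: algebra_simps)
      then show ?case using elim q by (simp add: field_simps)
    qed
    show "(CU + 1) / q > 0" using CU q by simp
  qed (use CK in auto)
  show ?thesis using 1 2 3 unfolding N_def w_def k_def by blast
qed

theorem theorem6p9:
  fixes \<gamma> \<beta> c :: real
  assumes "(\<gamma>, \<beta>) \<noteq> (0, 0)" and "c > 0"
  defines "H \<equiv> ham_of (\<lambda>t. t powr \<gamma> * sin (t powr (- \<beta>)))"
  defines "\<rho> \<equiv> (if \<gamma> \<ge> 0 then \<beta> / (\<beta> + \<gamma> + 1) else (\<beta> - \<gamma>) / (\<beta> - \<gamma> + 1))"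
  defines "g \<equiv> (\<lambda>r::real. if \<beta> < \<gamma> + 1 then r powr (1/2)
                 else if \<beta> = \<gamma> + 1 then r powr (1/2) * ln r
                 else r powr \<rho>)"
  shows "(\<lambda>r. ln (SUP z\<in>sphere 0 r. onorm (\<lambda>x. monodromy H z *v x))) \<asymp> g
     \<and> (\<lambda>r. ln (cmod (monodromy H (\<i> * complex_of_real r) $ 2 $ 2))) \<asymp> g
     \<and> (\<lambda>r. real (kappa H c r)) \<asymp> g"
proof -
  have H: "H = ham_of (osc \<gamma> \<beta>)" unfolding H_def osc_def[abs_def] ..
  consider "\<beta> < \<gamma> + 1" | "\<beta> = \<gamma> + 1" | "\<beta> > \<gamma> + 1" by linarith
  then show ?thesis
  proof cases
    case 1
    have g: "g = (\<lambda>r. r powr (1/2))" using 1 by (simp add: g_def)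
    have "eventually (\<lambda>r. sqrt r \<le> r powr (1/2)) at_top"
      using eventually_ge_at_top[of 0] by eventually_elim (simp add: powr_half_sqrt)
    then show ?thesis unfolding H g
      by (rule osc_growth_asymp[OF assms(2) _ osc_growth_subcritical[OF assms(1,2) 1]])
  next
    case 2
    have g: "g = (\<lambda>r. r powr (1/2) * ln r)" using 2 by (simp add: g_def)
    have "eventually (\<lambda>r. sqrt r \<le> r powr (1/2) * ln r) at_top"
      using eventually_ge_at_top[of 0] eventually_le_ln[of 1]
      by eventually_elim (simp add: powr_half_sqrt mult_le_cancel_left1)
    then show ?thesis unfolding H g
      by (rule osc_growth_asymp[OF assms(2) _ osc_growth_critical[OF assms(2) 2]])
  next
    case 3
    have g: "g = (\<lambda>r. r powr \<rho>)" using 3 by (simp add: g_def)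
    note super = osc_growth_supercritical[OF assms(2) 3, folded \<rho>_def]
    have "eventually (\<lambda>r. sqrt r \<le> r powr \<rho>) at_top"
      using eventually_ge_at_top[of 1]
    proof eventually_elim
      case (elim r)
      have "r powr (1/2) \<le> r powr \<rho>" using elim super(1) by (intro powr_mono) auto
      then show ?case using elim by (simp add: powr_half_sqrt)
    qed
    then show ?thesis unfolding H g by (rule osc_growth_asymp[OF assms(2) _ super(2,3)])
  qed
qed

end
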